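(* Let $n\ge2$ and let $E,F\subset\mathbb{R}^n$ be compact sets with $\dim_{qH}E=0$ and $\dim_H F=0$. If $0<\overline{\dim}_B F=\dim_A F$, then no quasiconformal map of $\mathbb{R}^n$ sends $E$ to $F$; that is, there is no quasiconformal homeomorphism $f:\mathbb{R}^n\to\mathbb{R}^n$ with $f(E)=F$.
   Context: $\dim_H$ is Hausdorff dimension. For a bounded set $A\subset\mathbb{R}^n$ and $0<\theta<1$, the upper $\theta$-intermediate dimension $\overline{\dim}_\theta A$ is the infimum of those $s>0$ such that for each $\epsilon>0$ there exists $\delta_0>0$ so that for each $0<\delta\le\delta_0$ there is a countable covering $(A_i)$ of $A$ by subsets of $\mathbb{R}^n$ with $\delta^{1/\theta}\le\operatorname{diam}(A_i)\le\delta$ for all $i$ and $\sum_i(\operatorname{diam}A_i)^s<\epsilon$. The (upper) quasi-Hausdorff dimension is $\dim_{qH}A:=\lim_{\theta\searrow0}\overline{\dim}_\theta A$ (the limit exists by monotonicity in $\theta$). $\overline{\dim}_B A:=\limsup_{r\to0}\frac{\log N(A,r)}{-\log r}$ is the upper box-counting dimension, where $N(A,r)$ is the minimal number of sets of diameter $r$ needed to cover $A$. The Assouad dimension $\dim_A A$ is the infimum of those $s>0$ for which there is $C>0$ so that for every ball $B(x,R)$ in $A$ and every $0<r<R$, $B(x,R)$ can be covered by no more than $C(R/r)^s$ balls of radius $r$. A homeomorphism $f:\Omega\to\Omega'$ between domains in $\mathbb{R}^n$, $n\ge2$, is $K$-quasiconformal ($K\ge1$) if $f\in W^{1,n}_{loc}(\Omega:\mathbb{R}^n)$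 and $\|Df(x)\|^n\le K\det Df(x)$ for a.e. $x\in\Omega$ (operator norm); it is quasiconformal if it is $K$-quasiconformal for some $K\ge1$. *)

theory Defs
  imports "HOL-Analysis.Analysis"
begin

section \<open>Dimensions\<close>

text \<open>
  All dimensions are \<^typ>\<open>ereal\<close>-valued, so that an infimum over an empty set of exponents is
  \<open>\<infinity>\<close>. A countable family of sets is given as \<open>(U i)\<close> for \<open>i\<close> in an index set \<open>I\<close> of natural
  numbers; thus finite and empty families are included. As \<^const>\<open>diameter\<close> is only meaningful
  for bounded sets, covering sets are always required to be bounded. The sums are taken in
  \<^typ>\<open>ennreal\<close>, where they always exist.
\<close>

definition hausdorff_pre :: "real \<Rightarrow> real \<Rightarrow> 'a::metric_space set \<Rightarrow> ennreal" where
  "hausdorff_pre s \<delta> A =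
     Inf {(\<Sum>\<^sub>\<infinity>i\<in>I. ennreal (diameter (U i) powr s)) | (I :: nat set) (U :: nat \<Rightarrow> 'a set).
            A \<subseteq> (\<Union>i\<in>I. U i) \<and> (\<forall>i\<in>I. bounded (U i) \<and> diameter (U i) \<le> \<delta>)}"

definition hausdorff_measure :: "real \<Rightarrow> 'a::metric_space set \<Rightarrow> ennreal" where
  "hausdorff_measure s A = (SUP \<delta>\<in>{0<..}. hausdorff_pre s \<delta> A)"

text \<open>Only exponents \<open>s > 0\<close> occur, so the convention for \<open>0\<^sup>0\<close> (\<open>0 powr 0 = 0\<close>) is irrelevant.\<close>

definition hausdorff_dim :: "'a::metric_space set \<Rightarrow> ereal" where
  "hausdorff_dim A = (INF s\<in>{s. 0 < s \<and> hausdorff_measure s A = 0}. ereal s)"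

definition has_cover :: "real \<Rightarrow> real \<Rightarrow> real \<Rightarrow> real \<Rightarrow> 'a::metric_space set \<Rightarrow> bool" where
  "has_cover s \<epsilon> a b A \<longleftrightarrow>
     (\<exists>(I :: nat set) (U :: nat \<Rightarrow> 'a set).
        A \<subseteq> (\<Union>i\<in>I. U i) \<and>
        (\<forall>i\<in>I. bounded (U i) \<and> a \<le> diameter (U i) \<and> diameter (U i) \<le> b) \<and>
        (\<Sum>\<^sub>\<infinity>i\<in>I. ennreal (diameter (U i) powr s)) < ennreal \<epsilon>)"

definition upper_intermediate_dim :: "real \<Rightarrow> 'a::metric_space set \<Rightarrow> ereal" where
  "upper_intermediate_dim \<theta> A =
     (INF s\<in>{s. 0 < s \<and>
        (\<forall>\<epsilon>>0. \<exists>\<delta>0>0. \<forall>\<delta>. 0 < \<delta> \<and> \<delta> \<le> \<delta>0 \<longrightarrow>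
          has_cover s \<epsilon> (\<delta> powr (1 / \<theta>)) \<delta> A)}. ereal s)"

definition quasi_hausdorff_dim :: "'a::metric_space set \<Rightarrow> ereal" where
  "quasi_hausdorff_dim A = Lim (at_right 0) (\<lambda>\<theta>. upper_intermediate_dim \<theta> A)"

text \<open>The limit in the definition of the quasi-Hausdorff dimension exists.\<close>

lemma has_cover_mono: "has_cover s \<epsilon> a b A \<Longrightarrow> a' \<le> a \<Longrightarrow> has_cover s \<epsilon> a' b A"
  unfolding has_cover_def by (meson order_trans)

lemma upper_intermediate_dim_mono:
  assumes "0 < \<theta>" "\<theta> \<le> \<phi>"
  shows "upper_intermediate_dim \<theta> A \<le> upper_intermediate_dim \<phi> A"
  unfolding upper_intermediate_dim_def
proof (rule INF_superset_mono[OF _ order_refl], rule subsetI)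
  fix s
  assume "s \<in> {s. 0 < s \<and> (\<forall>\<epsilon>>0. \<exists>\<delta>0>0. \<forall>\<delta>. 0 < \<delta> \<and> \<delta> \<le> \<delta>0 \<longrightarrow>
    has_cover s \<epsilon> (\<delta> powr (1 / \<phi>)) \<delta> A)}"
  then have s: "0 < s" and cov: "\<And>\<epsilon>. \<epsilon> > 0 \<Longrightarrow> \<exists>\<delta>0>0. \<forall>\<delta>. 0 < \<delta> \<and> \<delta> \<le> \<delta>0 \<longrightarrow>
    has_cover s \<epsilon> (\<delta> powr (1 / \<phi>)) \<delta> A"
    by auto
  have le: "\<delta> powr (1 / \<theta>) \<le> \<delta> powr (1 / \<phi>)" if "0 < \<delta>" "\<delta> \<le> 1" for \<delta> :: real
    using that assms by (intro powr_mono') (auto simp: field_simps)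
  have "\<exists>\<delta>0>0. \<forall>\<delta>. 0 < \<delta> \<and> \<delta> \<le> \<delta>0 \<longrightarrow> has_cover s \<epsilon> (\<delta> powr (1 / \<theta>)) \<delta> A"
    if "\<epsilon> > 0" for \<epsilon>
  proof -
    obtain \<delta>0 where \<delta>0: "\<delta>0 > 0"
      and *: "\<And>\<delta>. 0 < \<delta> \<Longrightarrow> \<delta> \<le> \<delta>0 \<Longrightarrow> has_cover s \<epsilon> (\<delta> powr (1 / \<phi>)) \<delta> A"
      using cov[OF \<open>\<epsilon> > 0\<close>] by blast
    have "has_cover s \<epsilon> (\<delta> powr (1 / \<theta>)) \<delta> A" if "0 < \<delta>" "\<delta> \<le> min \<delta>0 1" for \<delta>
      using that by (intro has_cover_mono[OF * le]) auto
    then show ?thesis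
      using \<delta>0 by (intro exI[of _ "min \<delta>0 1"]) simp
  qed
  with s show "s \<in> {s. 0 < s \<and> (\<forall>\<epsilon>>0. \<exists>\<delta>0>0. \<forall>\<delta>. 0 < \<delta> \<and> \<delta> \<le> \<delta>0 \<longrightarrow>
    has_cover s \<epsilon> (\<delta> powr (1 / \<theta>)) \<delta> A)}"
    by auto
qed

lemma quasi_hausdorff_dim_tendsto:
  "((\<lambda>\<theta>. upper_intermediate_dim \<theta> A) \<longlongrightarrow> quasi_hausdorff_dim A) (at_right 0)"
proof -
  let ?d = "\<lambda>\<theta>. upper_intermediate_dim \<theta> A"
  have "(?d \<longlongrightarrow> (INF \<theta>\<in>{0<..}. ?d \<theta>)) (at_right 0)"
  proof (rule order_tendstoI)
    fix a assume "a < (INF \<theta>\<in>{0<..}. ?d \<theta>)"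
    then have "a < ?d \<theta>" if "0 < \<theta>" for \<theta>
      using that by (meson INF_lower greaterThan_iff less_le_trans)
    then show "\<forall>\<^sub>F \<theta> in at_right 0. a < ?d \<theta>"
      by (auto simp: eventually_at_filter)
  next
    fix a assume "(INF \<theta>\<in>{0<..}. ?d \<theta>) < a"
    then obtain \<phi> where "0 < \<phi>" "?d \<phi> < a"
      by (auto simp: INF_less_iff)
    then show "\<forall>\<^sub>F \<theta> in at_right 0. ?d \<theta> < a"
      unfolding eventually_at_right_field
      by (meson less_imp_le le_less_trans upper_intermediate_dim_mono)
  qed
  then show ?thesis
    unfolding quasi_hausdorff_dim_def using tendsto_Lim trivial_limit_at_right_real by metis
qed

text \<open>Intended for totally bounded \<open>A\<close>; otherwise no finite cover exists and the value is arbitrary.\<close>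

definition covering_number :: "'a::metric_space set \<Rightarrow> real \<Rightarrow> nat" where
  "covering_number A r =
     (LEAST k. \<exists>\<U>. finite \<U> \<and> card \<U> = k \<and> A \<subseteq> \<Union>\<U> \<and> (\<forall>U\<in>\<U>. bounded U \<and> diameter U = r))"

text \<open>By the convention \<open>ln 0 = 0\<close>, the empty set has upper box dimension \<open>0\<close>.\<close>

definition upper_box_dim :: "'a::metric_space set \<Rightarrow> ereal" where
  "upper_box_dim A =
     Limsup (at_right 0) (\<lambda>r. ereal (ln (real (covering_number A r)) / (- ln r)))"

text \<open>
  Balls in \<open>A\<close> are balls of the metric subspace \<open>A\<close>, i.e. sets \<open>A \<inter> ball x R\<close> with centre \<open>x \<in> A\<close>.
\<close>

definition assouad_dim :: "'a::metric_space set \<Rightarrow> ereal" where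
  "assouad_dim A =
     (INF s\<in>{s. 0 < s \<and>
        (\<exists>C>0. \<forall>x\<in>A. \<forall>R r. 0 < r \<and> r < R \<longrightarrow>
          (\<exists>Y\<subseteq>A. finite Y \<and> real (card Y) \<le> C * (R / r) powr s \<and>
             A \<inter> ball x R \<subseteq> (\<Union>y\<in>Y. A \<inter> ball y r)))}. ereal s)"


section \<open>Sobolev spaces and quasiconformal maps\<close>

definition partial_deriv :: "'n::finite \<Rightarrow> (real^'n \<Rightarrow> real) \<Rightarrow> real^'n \<Rightarrow> real" where
  "partial_deriv j \<phi> x = frechet_derivative \<phi> (at x) (axis j 1)"

primrec Ck :: "nat \<Rightarrow> (real^'n::finite \<Rightarrow> real) \<Rightarrow> bool" where
  "Ck 0 \<phi> \<longleftrightarrow> continuous_on UNIV \<phi>"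
| "Ck (Suc k) \<phi> \<longleftrightarrow> (\<forall>x. \<phi> differentiable at x) \<and> (\<forall>j. Ck k (partial_deriv j \<phi>))"

text \<open>The space \<open>C\<^sub>c\<^sup>\<infinity>(\<Omega>)\<close>, its elements being extended by zero to the whole space.\<close>

definition test_function :: "(real^'n::finite) set \<Rightarrow> (real^'n \<Rightarrow> real) \<Rightarrow> bool" where
  "test_function \<Omega> \<phi> \<longleftrightarrow>
     (\<forall>k. Ck k \<phi>) \<and> compact (closure {x. \<phi> x \<noteq> 0}) \<and> closure {x. \<phi> x \<noteq> 0} \<subseteq> \<Omega>"

definition Lp_loc ::
  "real \<Rightarrow> (real^'n::finite) set \<Rightarrow> (real^'n \<Rightarrow> 'b::euclidean_space) \<Rightarrow> bool" where
  "Lp_loc p \<Omega> f \<longleftrightarrow>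
     f \<in> borel_measurable (lebesgue_on \<Omega>) \<and>
     (\<forall>K. compact K \<and> K \<subseteq> \<Omega> \<longrightarrow> integrable (lebesgue_on K) (\<lambda>x. norm (f x) powr p))"

text \<open>\<open>D x $ i $ j\<close> is the weak partial derivative with respect to \<open>x\<^sub>j\<close> of the \<open>i\<close>-th component.\<close>

definition weak_derivative ::
  "(real^'n::finite) set \<Rightarrow> (real^'n \<Rightarrow> real^'n) \<Rightarrow> (real^'n \<Rightarrow> real^'n^'n) \<Rightarrow> bool" where
  "weak_derivative \<Omega> f D \<longleftrightarrow>
     Lp_loc 1 \<Omega> f \<and> Lp_loc 1 \<Omega> D \<and>
     (\<forall>\<phi> i j. test_function \<Omega> \<phi> \<longrightarrow>
        (LINT x|lebesgue_on \<Omega>. f x $ i * partial_deriv j \<phi> x) =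
        - (LINT x|lebesgue_on \<Omega>. D x $ i $ j * \<phi> x))"

definition W1_loc :: "real \<Rightarrow> (real^'n::finite) set \<Rightarrow> (real^'n \<Rightarrow> real^'n) \<Rightarrow> bool" where
  "W1_loc p \<Omega> f \<longleftrightarrow> Lp_loc p \<Omega> f \<and> (\<exists>D. weak_derivative \<Omega> f D \<and> Lp_loc p \<Omega> D)"

definition domain :: "'a::topological_space set \<Rightarrow> bool" where
  "domain \<Omega> \<longleftrightarrow> open \<Omega> \<and> connected \<Omega> \<and> \<Omega> \<noteq> {}"

text \<open>The weak derivative is unique up to null sets, so the choice of \<open>D\<close> is immaterial.\<close>

definition K_quasiconformal ::
  "real \<Rightarrow> (real^'n::finite) set \<Rightarrow> (real^'n) set \<Rightarrow> (real^'n \<Rightarrow> real^'n) \<Rightarrow> bool" where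
  "K_quasiconformal K \<Omega> \<Omega>' f \<longleftrightarrow>
     domain \<Omega> \<and> domain \<Omega>' \<and> (\<exists>g. homeomorphism \<Omega> \<Omega>' f g) \<and>
     W1_loc (real CARD('n)) \<Omega> f \<and>
     (\<exists>D. weak_derivative \<Omega> f D \<and>
        (AE x in lebesgue_on \<Omega>. onorm ((*v) (D x)) ^ CARD('n) \<le> K * det (D x)))"

definition quasiconformal ::
  "(real^'n::finite) set \<Rightarrow> (real^'n) set \<Rightarrow> (real^'n \<Rightarrow> real^'n) \<Rightarrow> bool" where
  "quasiconformal \<Omega> \<Omega>' f \<longleftrightarrow> (\<exists>K\<ge>1. K_quasiconformal K \<Omega> \<Omega>' f)"

end

theory Submission
  imports Defs
begin

text \<open>
  A quasiconformal map \<open>f\<close> is locally Hoelder continuous, and Hoelder maps send a set of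
  quasi-Hausdorff dimension \<open>0\<close> to such a set: images of the covering sets can be enlarged so that
  their diameters stay in the admissible range. On the other hand, if the upper box dimension of \<open>F\<close>
  equals its Assouad dimension \<open>d\<close>, subdividing the sets of a cover with diameters in
  \<open>[\<delta>\<^sup>1\<^sup>/\<^sup>\<theta>, \<delta>]\<close> into pieces of the smallest size shows that all intermediate dimensions of \<open>F\<close>
  are at least \<open>d\<close>.

  Hoelder continuity is obtained by Widman's hole-filling method. Since the Jacobian is a null
  Lagrangian, \<open>|Df|\<^sup>n \<le> K det Df\<close> yields a Caccioppoli inequality, whose right-hand side lives on an
  annulus. With the Poincare inequality there, the energy \<open>\<integral>|Df|\<^sup>n\<close> of a cube is at most a constant times
  the energy of the surrounding annulus, hence decays geometrically, and the averages of \<open>f\<close> over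
  shrinking cubes converge to \<open>f\<close> geometrically.
\<close>

section \<open>Intermediate, box and Assouad dimensions\<close>

text \<open>Three obstacles shape the argument. The covers for an intermediate dimension have
  diameters bounded from below, and a Hoelder map puts a constant in front of this bound; the
  constant is paid for by halving \<theta>. This is affordable because any positive \<theta> makes
  the counting argument gain a definite amount over the Assouad exponent. Next, \<open>f\<close> is
  only weakly differentiable, whereas the null Lagrangian identity needs symmetric second
  derivatives. The integral inequalities are therefore proved for mollifications, which converge
  locally uniformly to \<open>f\<close> and, together with their derivatives, in mean of order n;
  the determinant, being of degree n, is just continuous enough for this. Finally, on the line an
  annulus is disconnected, so no single constant could approximate \<open>f\<close> on it; n >= 2
  enters through slabs in two different coordinate directions. Since the exponent of the energy
  equals the dimension, the radius cancels when the Caccioppoli and Poincare inequalities are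
  combined, and the same decay factor works at every scale.\<close>

text \<open>Each covering set contributes at least \<open>a powr s\<close> > 0 to a sum below
  \<epsilon>, so there are only finitely many of them and the sum may be taken over the
  reals.\<close>

lemma has_cover_finite_sum:
  fixes A :: "'a::metric_space set"
  assumes "has_cover s \<epsilon> a b A" "0 < a" "0 < s"
  obtains J :: "nat set" and U where "finite J" "A \<subseteq> (\<Union>i\<in>J. U i)"
    "\<And>i. i \<in> J \<Longrightarrow> bounded (U i)" "\<And>i. i \<in> J \<Longrightarrow> a \<le> diameter (U i)"
    "\<And>i. i \<in> J \<Longrightarrow> diameter (U i) \<le> b" "(\<Sum>i\<in>J. diameter (U i) powr s) < \<epsilon>"
proof -
  obtain I :: "nat set" and U where U: "A \<subseteq> (\<Union>i\<in>I. U i)"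
    "\<And>i. i \<in> I \<Longrightarrow> bounded (U i) \<and> a \<le> diameter (U i) \<and> diameter (U i) \<le> b"
    and S: "(\<Sum>\<^sub>\<infinity>i\<in>I. ennreal (diameter (U i) powr s)) < ennreal \<epsilon>"
    using assms(1) unfolding has_cover_def by blast
  have fin_le: "(\<Sum>i\<in>J. diameter (U i) powr s) < \<epsilon>" if "finite J" "J \<subseteq> I" for J
  proof -
    have "ennreal (\<Sum>i\<in>J. diameter (U i) powr s) = (\<Sum>i\<in>J. ennreal (diameter (U i) powr s))"
      by simp
    also have "\<dots> = (\<Sum>\<^sub>\<infinity>i\<in>J. ennreal (diameter (U i) powr s))"
      using that by simp
    also have "\<dots> \<le> (\<Sum>\<^sub>\<infinity>i\<in>I. ennreal (diameter (U i) powr s))"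
      by (intro infsum_mono_neutral) (use that in \<open>auto intro: nonneg_summable_on_complete\<close>)
    also note S
    finally show ?thesis
      by (simp add: ennreal_less_iff sum_nonneg)
  qed
  have "finite I"
  proof (rule ccontr)
    assume "infinite I"
    \<comment> \<open>So many sets would by themselves exhaust \<epsilon>.\<close>
    define k where "k = nat \<lceil>\<epsilon> / (a powr s)\<rceil>"
    obtain J where J: "finite J" "card J = k" "J \<subseteq> I"
      using infinite_arbitrarily_large[OF \<open>infinite I\<close>] by blast
    have "\<epsilon> \<le> real k * a powr s"
      using \<open>0 < a\<close> unfolding k_def by (metis divide_le_eq powr_gt_zero real_nat_ceiling_ge less_irrefl)
    also have "\<dots> = (\<Sum>i\<in>J. a powr s)"
      using J by simp
    also have "\<dots> \<le> (\<Sum>i\<in>J. diameter (U i) powr s)"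
      using J U assms by (intro sum_mono powr_mono2) auto
    also have "\<dots> < \<epsilon>"
      using fin_le J by blast
    finally show False by simp
  qed
  then show ?thesis
    using that[of I U] U fin_le by blast
qed

text \<open>\<open>covering_number\<close> prescribes the diameter exactly, and a closed ball of
  radius r in a Euclidean space has diameter exactly 2r; hence the pairing of radius r with scale
  2r.\<close>

lemma covering_number_le:
  fixes F :: "'a::euclidean_space set"
  assumes "finite Y" "F \<subseteq> (\<Union>y\<in>Y. cball y r)" "0 < r"
  shows "covering_number F (2 * r) \<le> card Y"
proof -
  have "covering_number F (2 * r) \<le> card ((\<lambda>y. cball y r) ` Y)"
    unfolding covering_number_def
    by (rule Least_le, rule exI[of _ "(\<lambda>y. cball y r) ` Y"]) (use assms in auto)
  also have "\<dots> \<le> card Y"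
    using assms by (intro card_image_le)
  finally show ?thesis .
qed

text \<open>After taking logarithms the constant contributes only L / (- ln \<rho>), which vanishes
  in the limit.\<close>

lemma upper_box_dim_leI:
  assumes "0 \<le> t" "0 < \<rho>0"
    and bd: "\<And>\<rho>. 0 < \<rho> \<Longrightarrow> \<rho> < \<rho>0 \<Longrightarrow>
        real (covering_number F \<rho>) \<le> C * \<rho> powr (- t)"
  shows "upper_box_dim F \<le> ereal t"
proof -
  \<comment> \<open>The maximum with 1 makes L nonnegative, which also settles covering number 0,
    where the convention \<open>ln 0 = 0\<close> applies.\<close>
  define L where "L = ln (max C 1)"
  have L: "0 \<le> L" by (simp add: L_def)
  have le: "ln (real (covering_number F \<rho>)) / (- ln \<rho>) \<le> t + L / (- ln \<rho>)"
    if "0 < \<rho>" "\<rho> < \<rho>0" "\<rho> < 1" for \<rho>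
  proof -
    have neg: "- ln \<rho> > 0" using that by simp
    have "ln (real (covering_number F \<rho>)) \<le> L + t * (- ln \<rho>)"
    proof (cases "covering_number F \<rho> = 0")
      case True
      then show ?thesis using L mult_nonneg_nonneg[OF \<open>0 \<le> t\<close> less_imp_le[OF neg]] by simp
    next
      case False
      have "real (covering_number F \<rho>) \<le> C * \<rho> powr (- t)" using bd that by blast
      also have "\<dots> \<le> max C 1 * \<rho> powr (- t)" by (intro mult_right_mono) auto
      finally have "ln (real (covering_number F \<rho>)) \<le> ln (max C 1 * \<rho> powr (- t))"
        using False by (intro ln_mono) auto
      also have "\<dots> = L + t * (- ln \<rho>)"
        using that by (subst ln_mult) (auto simp: L_def ln_powr)
      finally show ?thesis .
    qed
    then show ?thesis using neg by (simp add: field_simps)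
  qed
  have "((\<lambda>\<rho>. t + L / (- ln \<rho>)) \<longlongrightarrow> t + 0) (at_right 0)"
  proof (intro tendsto_intros)
    have "filterlim (\<lambda>\<rho>::real. - ln \<rho>) at_top (at_right 0)"
      using ln_at_0 by (simp add: filterlim_uminus_at_bot)
    then have "filterlim (\<lambda>\<rho>::real. - ln \<rho>) at_infinity (at_right 0)"
      by (rule filterlim_at_top_imp_at_infinity)
    then show "((\<lambda>\<rho>. L / (- ln \<rho>)) \<longlongrightarrow> 0) (at_right 0)"
      by (rule tendsto_divide_0[OF tendsto_const])
  qed
  then have "((\<lambda>\<rho>. ereal (t + L / (- ln \<rho>))) \<longlongrightarrow> ereal t) (at_right 0)"
    by simp
  then have lim: "Limsup (at_right 0) (\<lambda>\<rho>. ereal (t + L / (- ln \<rho>))) = ereal t"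
    by (intro lim_imp_Limsup) auto
  have "upper_box_dim F \<le> Limsup (at_right 0) (\<lambda>\<rho>. ereal (t + L / (- ln \<rho>)))"
    unfolding upper_box_dim_def
  proof (rule Limsup_mono)
    show "\<forall>\<^sub>F \<rho> in at_right 0. ereal (ln (real (covering_number F \<rho>)) / - ln \<rho>)
      \<le> ereal (t + L / - ln \<rho>)"
      unfolding eventually_at_right_field
      by (rule exI[of _ "min \<rho>0 1"]) (use \<open>0 < \<rho>0\<close> le in auto)
  qed
  then show ?thesis unfolding lim .
qed

text \<open>A covering set U lies in a ball of radius 2 diam U, which the Assouad bound splits into
  a constant times (diam U / r)^a balls of the smallest radius r. Trading diam^a for \<delta>^(a -
  s) diam^s and summing leaves r^(-a) \<delta>^(a - s), and \<delta> = r^\<theta> gives the exponent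
  claimed. It is smaller than a as soon as s < a.\<close>

lemma upper_box_dim_le_of_has_cover:
  fixes F :: "'a::euclidean_space set"
  assumes "0 < s" "0 < \<theta>" "\<theta> < 1" "0 < \<delta>0"
    and cov: "\<And>\<delta>. 0 < \<delta> \<Longrightarrow> \<delta> \<le> \<delta>0 \<Longrightarrow>
        has_cover s 1 (\<delta> powr (1 / \<theta>)) \<delta> F"
    and a: "s \<le> a" "0 < C"
    and ass: "\<And>x R r. x \<in> F \<Longrightarrow> 0 < r \<Longrightarrow> r < R \<Longrightarrow>
       \<exists>Y\<subseteq>F. finite Y \<and> real (card Y) \<le> C * (R / r) powr a \<and> F \<inter> ball x R \<subseteq> (\<Union>y\<in>Y. F \<inter> ball y r)"
  shows "upper_box_dim F \<le> ereal (a - \<theta> * (a - s))"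
proof (rule upper_box_dim_leI)
  define t where "t = a - \<theta> * (a - s)"
  have "\<theta> * (a - s) \<le> 1 * (a - s)" using assms by (intro mult_right_mono) auto
  then show "0 \<le> a - \<theta> * (a - s)" using assms by simp
  show "0 < 2 * \<delta>0 powr (1 / \<theta>)" using assms by simp
  fix \<rho> :: real assume \<rho>: "0 < \<rho>" "\<rho> < 2 * \<delta>0 powr (1 / \<theta>)"
  define r where "r = \<rho> / 2"
  \<comment> \<open>With this scale the smallest admissible diameter \<delta>^(1/\<theta>) is
    exactly r.\<close>
  define \<delta> where "\<delta> = r powr \<theta>"
  have r: "0 < r" "r < \<delta>0 powr (1 / \<theta>)" using \<rho> by (auto simp: r_def)
  have \<delta>: "0 < \<delta>" using r by (simp add: \<delta>_def)
  have "\<delta> \<le> (\<delta>0 powr (1 / \<theta>)) powr \<theta>"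
    unfolding \<delta>_def using r assms by (intro powr_mono2) auto
  also have "\<dots> = \<delta>0" using assms by (simp add: powr_powr)
  finally have \<delta>le: "\<delta> \<le> \<delta>0" .
  have rd: "\<delta> powr (1 / \<theta>) = r" using r assms by (simp add: \<delta>_def powr_powr)
  obtain J :: "nat set" and U where U: "finite J" "F \<subseteq> (\<Union>i\<in>J. U i)"
    "\<And>i. i \<in> J \<Longrightarrow> bounded (U i)" "\<And>i. i \<in> J \<Longrightarrow> r \<le> diameter (U i)"
    "\<And>i. i \<in> J \<Longrightarrow> diameter (U i) \<le> \<delta>" "(\<Sum>i\<in>J. diameter (U i) powr s) < 1"
    using has_cover_finite_sum[OF cov[OF \<delta> \<delta>le]] r \<open>0 < s\<close> unfolding rd by metis
  have "\<exists>Y. finite Y \<and> real (card Y) \<le> C * (2 * diameter (U i) / r) powr a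
      \<and> F \<inter> U i \<subseteq> (\<Union>y\<in>Y. cball y r)" if i: "i \<in> J" for i
  proof (cases "F \<inter> U i = {}")
    case True
    then show ?thesis using \<open>0 < C\<close> by (intro exI[of _ "{}"]) auto
  next
    case False
    then obtain x where x: "x \<in> F" "x \<in> U i" by auto
    \<comment> \<open>The factor 2 is there because the Assouad bound speaks of open balls and of
      radii strictly above r.\<close>
    have dr: "r < 2 * diameter (U i)" using U(4)[OF i] r by linarith
    have "U i \<subseteq> ball x (2 * diameter (U i))"
    proof
      fix y assume "y \<in> U i"
      then have "dist x y \<le> diameter (U i)"
        using diameter_bounded_bound[OF U(3)[OF i]] x by blast
      then show "y \<in> ball x (2 * diameter (U i))"
        using U(4)[OF i] r by auto
    qed
    moreover obtain Z where "finite Z" "real (card Z) \<le> C * (2 * diameter (U i) / r) powr a"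
      "F \<inter> ball x (2 * diameter (U i)) \<subseteq> (\<Union>y\<in>Z. F \<inter> ball y r)"
      using ass[OF x(1) r(1) dr] by blast
    moreover have "(\<Union>y\<in>Z. F \<inter> ball y r) \<subseteq> (\<Union>y\<in>Z. cball y r)"
      using ball_subset_cball by blast
    ultimately show ?thesis
      by (intro exI[of _ Z] conjI) blast+
  qed
  then obtain Y where Y: "\<And>i. i \<in> J \<Longrightarrow> finite (Y i)"
    "\<And>i. i \<in> J \<Longrightarrow> real (card (Y i)) \<le> C * (2 * diameter (U i) / r) powr a"
    "\<And>i. i \<in> J \<Longrightarrow> F \<inter> U i \<subseteq> (\<Union>y\<in>Y i. cball y r)"
    by metis
  have "F \<subseteq> (\<Union>y\<in>(\<Union>i\<in>J. Y i). cball y r)"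
  proof
    fix z assume z: "z \<in> F"
    then obtain i where "i \<in> J" "z \<in> U i" using U(2) by auto
    moreover from this have "z \<in> (\<Union>y\<in>Y i. cball y r)" using Y(3)[of i] z by blast
    ultimately show "z \<in> (\<Union>y\<in>(\<Union>i\<in>J. Y i). cball y r)" by blast
  qed
  then have "covering_number F (2 * r) \<le> card (\<Union>i\<in>J. Y i)"
    using U(1) Y(1) r by (intro covering_number_le) auto
  also have "\<dots> \<le> (\<Sum>i\<in>J. card (Y i))"
    using U(1) by (rule card_UN_le)
  finally have "real (covering_number F \<rho>) \<le> (\<Sum>i\<in>J. real (card (Y i)))"
    by (simp add: r_def flip: of_nat_sum)
  also have "\<dots> \<le> (\<Sum>i\<in>J. C * 2 powr a * r powr (- a) * \<delta> powr (a - s) * diameter (U i) powr s)"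
  proof (rule sum_mono)
    fix i assume i: "i \<in> J"
    have d: "0 < diameter (U i)" using U(4)[OF i] r by linarith
    have "diameter (U i) powr a = diameter (U i) powr (a - s) * diameter (U i) powr s"
      by (simp flip: powr_add)
    also have "\<dots> \<le> \<delta> powr (a - s) * diameter (U i) powr s"
      using U(5)[OF i] d a by (intro mult_right_mono powr_mono2) auto
    finally have *: "diameter (U i) powr a \<le> \<delta> powr (a - s) * diameter (U i) powr s" .
    have "real (card (Y i)) \<le> C * (2 * diameter (U i) / r) powr a" using Y(2)[OF i] .
    also have "\<dots> = C * 2 powr a * r powr (- a) * diameter (U i) powr a"
      using d r by (simp add: powr_mult powr_divide powr_minus_divide)
    also have "\<dots> \<le> C * 2 powr a * r powr (- a) * (\<delta> powr (a - s) * diameter (U i) powr s)"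
      using * a by (intro mult_left_mono) auto
    finally show "real (card (Y i)) \<le> C * 2 powr a * r powr (- a) * \<delta> powr (a - s) * diameter (U i) powr s"
      by (simp add: mult_ac)
  qed
  also have "\<dots> = C * 2 powr a * r powr (- a) * \<delta> powr (a - s) * (\<Sum>i\<in>J. diameter (U i) powr s)"
    by (simp add: sum_distrib_left)
  also have "\<dots> \<le> C * 2 powr a * r powr (- a) * \<delta> powr (a - s) * 1"
    using U(6) a by (intro mult_left_mono) auto
  also have "\<dots> = C * 2 powr a * r powr (- t)"
    using r by (simp add: \<delta>_def powr_powr t_def mult.assoc flip: powr_add)
  also have "\<dots> = (C * 2 powr a * 2 powr t) * \<rho> powr (- t)"
    using \<rho> by (simp add: r_def powr_divide powr_minus field_simps)
  finally show "real (covering_number F \<rho>)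
     \<le> (C * 2 powr a * 2 powr t) * \<rho> powr (- (a - \<theta> * (a - s)))"
    by (simp add: t_def)
qed

text \<open>A crude count: all diameters are at least \<delta>^(1/\<theta>), so the cover has at
  most \<delta>^(-s/\<theta>) members. It guarantees that the upper box dimension is finite before
  it is compared with Assouad exponents.\<close>

lemma upper_box_dim_le_div_of_has_cover:
  fixes F :: "'a::euclidean_space set"
  assumes "0 < s" "0 < \<theta>" "\<theta> < 1" "0 < \<delta>0"
    and cov: "\<And>\<delta>. 0 < \<delta> \<Longrightarrow> \<delta> \<le> \<delta>0 \<Longrightarrow>
        has_cover s 1 (\<delta> powr (1 / \<theta>)) \<delta> F"
  shows "upper_box_dim F \<le> ereal (s / \<theta>)"
proof (rule upper_box_dim_leI)
  show "0 \<le> s / \<theta>" "0 < 2 * \<delta>0" using assms by auto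
  fix \<rho> :: real assume \<rho>: "0 < \<rho>" "\<rho> < 2 * \<delta>0"
  define \<delta> where "\<delta> = \<rho> / 2"
  have \<delta>: "0 < \<delta>" "\<delta> \<le> \<delta>0" using \<rho> by (auto simp: \<delta>_def)
  define r where "r = \<delta> powr (1 / \<theta>)"
  have r: "0 < r" using \<delta> by (simp add: r_def)
  obtain J :: "nat set" and U where U: "finite J" "F \<subseteq> (\<Union>i\<in>J. U i)"
    "\<And>i. i \<in> J \<Longrightarrow> bounded (U i)" "\<And>i. i \<in> J \<Longrightarrow> r \<le> diameter (U i)"
    "\<And>i. i \<in> J \<Longrightarrow> diameter (U i) \<le> \<delta>" "(\<Sum>i\<in>J. diameter (U i) powr s) < 1"
    using has_cover_finite_sum[OF cov[OF \<delta>]] r \<open>0 < s\<close> unfolding r_def by metis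
  define x where "x i = (SOME z. z \<in> U i)" for i
  have "F \<subseteq> (\<Union>y\<in>x ` J. cball y \<delta>)"
  proof
    fix z assume "z \<in> F"
    then obtain i where i: "i \<in> J" "z \<in> U i" using U(2) by auto
    then have "x i \<in> U i" unfolding x_def by (metis someI)
    then have "dist (x i) z \<le> \<delta>"
      using diameter_bounded_bound[OF U(3)] i U(5)[of i] by (meson order_trans)
    then show "z \<in> (\<Union>y\<in>x ` J. cball y \<delta>)" using i by auto
  qed
  then have "covering_number F (2 * \<delta>) \<le> card (x ` J)"
    using U(1) \<delta> by (intro covering_number_le) auto
  also have "\<dots> \<le> card J" using U(1) by (rule card_image_le)
  finally have "real (covering_number F \<rho>) \<le> card J" by (simp add: \<delta>_def)
  also have "real (card J) * r powr s \<le> 1"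
  proof -
    have "real (card J) * r powr s = (\<Sum>i\<in>J. r powr s)" by simp
    also have "\<dots> \<le> (\<Sum>i\<in>J. diameter (U i) powr s)"
      using U(4) r \<open>0 < s\<close> by (intro sum_mono powr_mono2) auto
    finally show ?thesis using U(6) by linarith
  qed
  then have "card J \<le> r powr (- s)"
    using r by (simp add: powr_minus field_simps)
  also have "\<dots> = 2 powr (s / \<theta>) * \<rho> powr (- (s / \<theta>))"
    using \<rho> by (simp add: r_def \<delta>_def powr_powr powr_divide powr_minus field_simps)
  finally show "real (covering_number F \<rho>) \<le> 2 powr (s / \<theta>) * \<rho> powr (- (s / \<theta>))" .
qed

text \<open>If the common dimension d exceeded s, an Assouad exponent a close to d would give d
  \<le> a - \<theta>(a - s) \<le> a - \<theta>(d - s), which is below d by the choice of a.\<close>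

lemma upper_box_dim_le_of_eq_assouad_dim:
  fixes F :: "'a::euclidean_space set"
  assumes "0 < s" "0 < \<theta>" "\<theta> < 1" "0 < \<delta>0"
    and cov: "\<And>\<delta>. 0 < \<delta> \<Longrightarrow> \<delta> \<le> \<delta>0 \<Longrightarrow>
        has_cover s 1 (\<delta> powr (1 / \<theta>)) \<delta> F"
    and eq: "upper_box_dim F = assouad_dim F"
  shows "upper_box_dim F \<le> ereal s"
proof (rule ccontr)
  assume "\<not> upper_box_dim F \<le> ereal s"
  then have gt: "ereal s < upper_box_dim F" by simp
  have "upper_box_dim F \<le> ereal (s / \<theta>)"
    using assms by (intro upper_box_dim_le_div_of_has_cover)
  then obtain d where d: "upper_box_dim F = ereal d" "s < d"
    using gt by (cases "upper_box_dim F") auto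
  \<comment> \<open>The margin \<theta>(d - s) is a lower bound for the gain \<theta>(a - s) of the
    counting argument, since a >= d.\<close>
  have "assouad_dim F < ereal (d + \<theta> * (d - s))"
    using d eq assms by simp
  then obtain a C where a: "a < d + \<theta> * (d - s)" "0 < C" and
    ass: "\<And>x R r. x \<in> F \<Longrightarrow> 0 < r \<Longrightarrow> r < R \<Longrightarrow>
       \<exists>Y\<subseteq>F. finite Y \<and> real (card Y) \<le> C * (R / r) powr a \<and> F \<inter> ball x R \<subseteq> (\<Union>y\<in>Y. F \<inter> ball y r)"
    and a0: "0 < a"
    unfolding assouad_dim_def INF_less_iff by (auto simp: Ball_def)
  have "assouad_dim F \<le> ereal a"
    unfolding assouad_dim_def by (rule INF_lower) (use a a0 ass in \<open>auto simp: Ball_def\<close>)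
  then have da: "d \<le> a" using d eq by simp
  have "ereal d \<le> ereal (a - \<theta> * (a - s))"
    unfolding d(1)[symmetric]
    by (rule upper_box_dim_le_of_has_cover[OF assms(1-4) cov _ a(2) ass]) (use da d in auto)
  moreover have "\<theta> * (d - s) \<le> \<theta> * (a - s)"
    using da assms by (intro mult_left_mono) auto
  ultimately show False using a by simp
qed

section \<open>Hoelder images of sets of quasi-Hausdorff dimension zero\<close>

text \<open>A Hoelder bound controls diameters of images only from above. Each image is therefore
  replaced by a closed ball whose diameter is a fixed multiple of diam^\<alpha>, and the exponent
  becomes s/\<alpha> because (diam^\<alpha>)^(s/\<alpha>) = diam^s.\<close>

lemma has_cover_holder_image:
  fixes E :: "'a::metric_space set" and f :: "'a \<Rightarrow> 'b::euclidean_space"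
  assumes hol: "\<And>x y. x \<in> E \<Longrightarrow> y \<in> E \<Longrightarrow>
      dist (f x) (f y) \<le> C * dist x y powr \<alpha>"
    and "0 < C" "0 < \<alpha>" "0 < s" "0 < a" "0 < b"
    and cov: "has_cover s \<epsilon> a b E"
  shows "has_cover (s / \<alpha>) ((2 * C) powr (s / \<alpha>) * \<epsilon>) (2 * C * a powr \<alpha>) (2 * C
      * b powr \<alpha>) (f ` E)"
proof -
  obtain J :: "nat set" and U where U: "finite J" "E \<subseteq> (\<Union>i\<in>J. U i)"
    "\<And>i. i \<in> J \<Longrightarrow> bounded (U i)" "\<And>i. i \<in> J \<Longrightarrow> a \<le> diameter (U i)"
    "\<And>i. i \<in> J \<Longrightarrow> diameter (U i) \<le> b" "(\<Sum>i\<in>J. diameter (U i) powr s) < \<epsilon>"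
    using has_cover_finite_sum[OF cov \<open>0 < a\<close> \<open>0 < s\<close>] by metis
  \<comment> \<open>If \<open>E \<inter> U i\<close> is empty the chosen point is arbitrary: the
    ball around its image still has the right diameter, and no point of E in \<open>U i\<close> has
    to be accounted for.\<close>
  define x where "x i = (SOME z. z \<in> E \<inter> U i)" for i
  define V where "V i = cball (f (x i)) (C * diameter (U i) powr \<alpha>)" for i
  have diam: "diameter (V i) = 2 * C * diameter (U i) powr \<alpha>" if "i \<in> J" for i
  proof -
    have "\<not> C * diameter (U i) powr \<alpha> < 0" using \<open>0 < C\<close> by (simp add: not_less)
    then show ?thesis unfolding V_def by (subst diameter_cball) simp
  qed
  have 1: "f ` E \<subseteq> (\<Union>i\<in>J. V i)"
  proof
    fix w assume "w \<in> f ` E"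
    then obtain z where z: "z \<in> E" "w = f z" by auto
    then obtain i where i: "i \<in> J" "z \<in> U i" using U(2) by auto
    then have x: "x i \<in> E" "x i \<in> U i" unfolding x_def using z by (metis IntI Int_iff someI)+
    have "dist (x i) z \<le> diameter (U i)"
      using diameter_bounded_bound[OF U(3)] i x by blast
    then have "C * dist (x i) z powr \<alpha> \<le> C * diameter (U i) powr \<alpha>"
      using \<open>0 < C\<close> \<open>0 < \<alpha>\<close> by (intro mult_left_mono powr_mono2) auto
    then have "dist (f (x i)) w \<le> C * diameter (U i) powr \<alpha>"
      using hol[OF x(1) z(1)] unfolding z(2) by linarith
    then show "w \<in> (\<Union>i\<in>J. V i)" using i by (auto simp: V_def)
  qed
  have dpos: "0 < diameter (U i)" if "i \<in> J" for i using U(4)[OF that] \<open>0 < a\<close> by linarith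
  have 2: "bounded (V i) \<and> 2 * C * a powr \<alpha> \<le> diameter (V i) \<and> diameter (V i)
      \<le> 2 * C * b powr \<alpha>"
    if i: "i \<in> J" for i
    unfolding diam[OF i] using U(4,5)[OF i] \<open>0 < C\<close> \<open>0 < \<alpha>\<close> \<open>0 < a\<close> dpos[OF i]
    by (auto simp: V_def intro!: powr_mono2)
  have "(\<Sum>i\<in>J. diameter (V i) powr (s / \<alpha>)) = (\<Sum>i\<in>J. (2 * C) powr (s / \<alpha>)
      * diameter (U i) powr s)"
    using dpos \<open>0 < C\<close> \<open>0 < \<alpha>\<close> by (intro sum.cong) (auto simp: diam powr_mult powr_powr)
  also have "\<dots> < (2 * C) powr (s / \<alpha>) * \<epsilon>"
    using U(6) \<open>0 < C\<close> by (simp flip: sum_distrib_left)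
  finally have "(\<Sum>i\<in>J. diameter (V i) powr (s / \<alpha>)) < (2 * C) powr (s / \<alpha>) * \<epsilon>" .
  then have 3: "(\<Sum>\<^sub>\<infinity>i\<in>J. ennreal (diameter (V i) powr (s / \<alpha>))) < ennreal ((2
      * C) powr (s / \<alpha>) * \<epsilon>)"
    using U(1) by (simp add: ennreal_less_iff sum_nonneg)
  show ?thesis
    unfolding has_cover_def using 1 2 3 by blast
qed

lemma has_cover_mono_exponent:
  assumes cov: "has_cover s \<epsilon> a b A" and "s \<le> t" "0 < a" "b \<le> 1"
  shows "has_cover t \<epsilon> a b A"
proof -
  obtain I :: "nat set" and U where U: "A \<subseteq> (\<Union>i\<in>I. U i)"
    "\<And>i. i \<in> I \<Longrightarrow> bounded (U i) \<and> a \<le> diameter (U i) \<and> diameter (U i) \<le> b"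
    and S: "(\<Sum>\<^sub>\<infinity>i\<in>I. ennreal (diameter (U i) powr s)) < ennreal \<epsilon>"
    using cov unfolding has_cover_def by blast
  have "(\<Sum>\<^sub>\<infinity>i\<in>I. ennreal (diameter (U i) powr t))
      \<le> (\<Sum>\<^sub>\<infinity>i\<in>I. ennreal (diameter (U i) powr s))"
  proof (rule infsum_mono)
    fix i assume "i \<in> I"
    then have "0 < diameter (U i)" "diameter (U i) \<le> 1" using U(2)[of i] assms by linarith+
    then show "ennreal (diameter (U i) powr t) \<le> ennreal (diameter (U i) powr s)"
      using \<open>s \<le> t\<close> by (intro ennreal_leI powr_mono') auto
  qed (auto intro: nonneg_summable_on_complete)
  then show ?thesis
    unfolding has_cover_def using U S by (meson le_less_trans)
qed

text \<open>Some intermediate dimension is below s, so an exponent t < s has the required covers,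
  and t can be raised to s because the diameters are at most 1. The point is that \<theta> is fixed
  before \<epsilon>.\<close>

lemma has_cover_of_quasi_hausdorff_dim:
  assumes "quasi_hausdorff_dim E = 0" "0 < s"
  obtains \<theta> where "0 < \<theta>" "\<theta> < 1"
    "\<And>\<epsilon>. 0 < \<epsilon> \<Longrightarrow> \<exists>\<delta>0>0. \<forall>\<delta>. 0 < \<delta>
        \<and> \<delta> \<le> \<delta>0 \<longrightarrow> has_cover s \<epsilon> (\<delta> powr (1 / \<theta>)) \<delta> E"
proof -
  have "\<forall>\<^sub>F \<theta> in at_right 0. upper_intermediate_dim \<theta> E < ereal s"
    using order_tendstoD(2)[OF quasi_hausdorff_dim_tendsto[of E], of "ereal s"] assms by simp
  then obtain b where b: "0 < b" "\<And>\<theta>. 0 < \<theta> \<Longrightarrow> \<theta> < b \<Longrightarrow>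
      upper_intermediate_dim \<theta> E < ereal s"
    unfolding eventually_at_right_field by auto
  define \<theta> where "\<theta> = min b 1 / 2"
  have \<theta>: "0 < \<theta>" "\<theta> < 1" "\<theta> < b" using b by (auto simp: \<theta>_def)
  obtain t where t: "t < s" and cov: "\<And>\<epsilon>. 0 < \<epsilon> \<Longrightarrow>
      \<exists>\<delta>0>0. \<forall>\<delta>. 0 < \<delta> \<and> \<delta> \<le> \<delta>0 \<longrightarrow> has_cover t \<epsilon> (\<delta> powr (1 / \<theta>)) \<delta> E"
    using b(2)[OF \<theta>(1,3)] unfolding upper_intermediate_dim_def INF_less_iff by auto
  have "\<exists>\<delta>0>0. \<forall>\<delta>. 0 < \<delta> \<and> \<delta> \<le> \<delta>0
      \<longrightarrow> has_cover s \<epsilon> (\<delta> powr (1 / \<theta>)) \<delta> E" if \<epsilon>: "0 < \<epsilon>" for \<epsilon>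
  proof -
    obtain \<delta>0 where "\<delta>0 > 0" and "\<And>\<delta>. 0 < \<delta> \<Longrightarrow>
        \<delta> \<le> \<delta>0 \<Longrightarrow> has_cover t \<epsilon> (\<delta> powr (1 / \<theta>)) \<delta> E"
      using cov[OF \<epsilon>] by auto
    then have "has_cover s \<epsilon> (\<delta> powr (1 / \<theta>)) \<delta> E" if "0 < \<delta>" "\<delta>
        \<le> min \<delta>0 1" for \<delta>
      using t that \<open>\<And>\<delta>. 0 < \<delta> \<Longrightarrow> \<delta> \<le> \<delta>0 \<Longrightarrow> has_cover t \<epsilon> (\<delta> powr (1 / \<theta>)) \<delta> E\<close>[of \<delta>]
      by (auto simp: has_cover_mono_exponent[where s = t and t = s])
    then show ?thesis
      using \<open>\<delta>0 > 0\<close> by (intro exI[of _ "min \<delta>0 1"]) auto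
  qed
  with \<theta> that show ?thesis by blast
qed

lemma upper_box_dim_holder_image_le_0:
  fixes E :: "'a::metric_space set" and f :: "'a \<Rightarrow> 'b::euclidean_space"
  assumes hol: "\<And>x y. x \<in> E \<Longrightarrow> y \<in> E \<Longrightarrow>
      dist (f x) (f y) \<le> C * dist x y powr \<alpha>"
    and C: "0 < C" and \<alpha>: "0 < \<alpha>"
    and qH: "quasi_hausdorff_dim E = 0"
    and eq: "upper_box_dim (f ` E) = assouad_dim (f ` E)"
  shows "upper_box_dim (f ` E) \<le> 0"
proof -
  have "upper_box_dim (f ` E) \<le> ereal \<sigma>" if \<sigma>: "0 < \<sigma>" for \<sigma>
  proof -
    define s where "s = \<alpha> * \<sigma>"
    have s: "0 < s" "s / \<alpha> = \<sigma>" using \<sigma> \<alpha> by (auto simp: s_def)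
    obtain \<theta> where \<theta>: "0 < \<theta>" "\<theta> < 1"
      "\<And>\<epsilon>. 0 < \<epsilon> \<Longrightarrow> \<exists>\<delta>0>0. \<forall>\<delta>. 0 < \<delta>
          \<and> \<delta> \<le> \<delta>0 \<longrightarrow> has_cover s \<epsilon> (\<delta> powr (1 / \<theta>)) \<delta> E"
      using has_cover_of_quasi_hausdorff_dim[OF qH s(1)] by blast
    \<comment> \<open>Compensates the factor by which the sum grows under the Hoelder map.\<close>
    define \<epsilon> where "\<epsilon> = 1 / (2 * C) powr \<sigma>"
    have \<epsilon>: "0 < \<epsilon>" "(2 * C) powr \<sigma> * \<epsilon> = 1" using C by (auto simp: \<epsilon>_def)
    obtain \<delta>0 where \<delta>0: "0 < \<delta>0" "\<And>\<delta>. 0 < \<delta> \<Longrightarrow>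
        \<delta> \<le> \<delta>0 \<Longrightarrow> has_cover s \<epsilon> (\<delta> powr (1 / \<theta>)) \<delta> E"
      using \<theta>(3)[OF \<epsilon>(1)] by blast
    \<comment> \<open>The first bound keeps the scale \<delta> in E below \<open>\<delta>0\<close>;
      the second is the inequality \<open>\<eta> powr (1 / \<theta>) \<le> (2 * C) powr (1 - 1 /
      \<theta>)\<close> solved for \<eta>.\<close>
    define \<eta>0 where "\<eta>0 = min (2 * C * \<delta>0 powr \<alpha>) ((2 * C) powr (\<theta>
        * (1 - 1 / \<theta>)))"
    have \<eta>0: "0 < \<eta>0" using C \<delta>0 by (simp add: \<eta>0_def)
    show "upper_box_dim (f ` E) \<le> ereal \<sigma>"
    proof (rule upper_box_dim_le_of_eq_assouad_dim[OF \<sigma> _ _ \<eta>0 _ eq])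
      \<comment> \<open>Halving \<theta> squares the lower bound
        \<open>\<eta> powr (1 / \<theta>)\<close>, and the additional small factor absorbs the
        constant that the Hoelder map puts in front of it.\<close>
      show "0 < \<theta> / 2" "\<theta> / 2 < 1" using \<theta> by auto
      fix \<eta> :: real assume \<eta>: "0 < \<eta>" "\<eta> \<le> \<eta>0"
      \<comment> \<open>The solution of 2C \<delta>^\<alpha> = \<eta>: sets of diameter at most
        \<delta> become balls of diameter at most \<eta>.\<close>
      define \<delta> where "\<delta> = (\<eta> / (2 * C)) powr (1 / \<alpha>)"
      have \<delta>: "0 < \<delta>" using \<eta> C by (simp add: \<delta>_def)
      have e1: "2 * C * \<delta> powr \<alpha> = \<eta>" using \<eta> C \<alpha> by (simp add: \<delta>_def powr_powr)
      have "\<eta> / (2 * C) \<le> \<delta>0 powr \<alpha>" using \<eta> C by (simp add: \<eta>0_def field_simps)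
      then have "\<delta> \<le> (\<delta>0 powr \<alpha>) powr (1 / \<alpha>)"
        unfolding \<delta>_def using \<eta> C \<alpha> by (intro powr_mono2) auto
      also have "\<dots> = \<delta>0" using \<delta>0 \<alpha> by (simp add: powr_powr)
      finally have "has_cover s \<epsilon> (\<delta> powr (1 / \<theta>)) \<delta> E" using \<delta>0 \<delta> by blast
      from has_cover_holder_image[OF hol C \<alpha> s(1) _ \<delta> this] \<delta>
      have "has_cover \<sigma> 1 (2 * C * (\<delta> powr (1 / \<theta>)) powr \<alpha>) (2 * C
          * \<delta> powr \<alpha>) (f ` E)"
        by (simp add: s \<epsilon>)
      then have hc: "has_cover \<sigma> 1 (2 * C * (\<delta> powr (1 / \<theta>)) powr \<alpha>) \<eta> (f ` E)"
        by (simp add: e1)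
      have "(\<delta> powr (1 / \<theta>)) powr \<alpha> = (\<delta> powr \<alpha>) powr (1 / \<theta>)"
        by (simp add: powr_powr mult.commute)
      also have "\<delta> powr \<alpha> = \<eta> / (2 * C)" using e1 C by (simp add: field_simps)
      finally have e2: "2 * C * (\<delta> powr (1 / \<theta>)) powr \<alpha>
          = (2 * C) powr (1 - 1 / \<theta>) * \<eta> powr (1 / \<theta>)"
        using C \<eta> by (simp add: powr_divide powr_diff)
      have "\<eta> powr (1 / (\<theta> / 2)) = \<eta> powr (1 / \<theta>) * \<eta> powr (1 / \<theta>)"
        by (simp flip: powr_add)
      also have "\<dots> \<le> (2 * C) powr (1 - 1 / \<theta>) * \<eta> powr (1 / \<theta>)"
      proof (rule mult_right_mono)
        have "\<eta> powr (1 / \<theta>) \<le> ((2 * C) powr (\<theta> * (1 - 1 / \<theta>))) powr (1 / \<theta>)"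
          using \<eta> \<theta> C by (intro powr_mono2) (auto simp: \<eta>0_def)
        also have "\<dots> = (2 * C) powr (1 - 1 / \<theta>)" using \<theta> by (simp add: powr_powr)
        finally show "\<eta> powr (1 / \<theta>) \<le> (2 * C) powr (1 - 1 / \<theta>)" .
      qed auto
      finally show "has_cover \<sigma> 1 (\<eta> powr (1 / (\<theta> / 2))) \<eta> (f ` E)"
        using has_cover_mono[OF hc] e2 by simp
    qed
  qed
  then have "upper_box_dim (f ` E) \<le> 0 + ereal \<sigma>" if "0 < \<sigma>" for \<sigma>
    using that by simp
  then show ?thesis
    by (rule ereal_le_epsilon2)
qed

section \<open>Smooth kernels and mollification\<close>

text \<open>A family closed under differentiation, which changes p and raises m by 2; p = 1 and m =
  0 give the standard bump. One derivative computation thus yields smoothness of every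
  order.\<close>

definition bumpf :: "real poly \<Rightarrow> nat \<Rightarrow> real \<Rightarrow> real" where
  "bumpf p m x = (if \<bar>x\<bar> < 1 then poly p x / (1 - x\<^sup>2) ^ m * exp (- 1 / (1 - x\<^sup>2)) else 0)"

text \<open>The inequality (1 + y/k)^k \<le> exp y at y = 1/w, inverted. It makes the exponential
  factor beat any power of w in a denominator.\<close>

lemma exp_neg_inverse_le_power:
  fixes w :: real
  assumes "0 < w" "0 < k"
  shows "exp (- 1 / w) \<le> (real k * w) ^ k"
proof -
  have "(1 / (real k * w)) ^ k \<le> (1 + (1 / w) / real k) ^ k"
    using assms by (intro power_mono) (auto simp: field_simps)
  also have "\<dots> \<le> exp (1 / w)"
    using assms by (intro exp_ge_one_plus_x_over_n_power_n) (auto simp: order_trans[of _ 0])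
  finally have "(1 / (real k * w)) ^ k \<le> exp (1 / w)" .
  then have "inverse (exp (1 / w)) \<le> inverse ((1 / (real k * w)) ^ k)"
    using assms by (intro le_imp_inverse_le) auto
  then show ?thesis
    by (simp add: exp_minus inverse_eq_divide power_divide)
qed

text \<open>The quadratic bound makes the derivative vanish at and beyond the endpoints.\<close>

lemma bumpf_le_square:
  obtains C where "0 \<le> C" "\<And>x x0. 1 \<le> \<bar>x0\<bar> \<Longrightarrow>
      \<bar>bumpf p m x\<bar> \<le> C * \<bar>x - x0\<bar>\<^sup>2"
proof -
  have "compact (poly p ` {-1..1})"
    by (intro compact_continuous_image continuous_intros) auto
  then obtain M where M: "\<And>x. x \<in> {-1..1} \<Longrightarrow> \<bar>poly p x\<bar> \<le> M"
    using compact_imp_bounded bounded_iff by (metis imageI real_norm_def)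
  have "0 \<le> \<bar>poly p 0\<bar>" by simp
  also have "\<dots> \<le> M" by (rule M) auto
  finally have M0: "0 \<le> M" .
  \<comment> \<open>Two more than the power of w in the denominator, so that a square of w survives
    the cancellation.\<close>
  define k where "k = m + 2"
  define C where "C = M * real k ^ k * 4"
  have "\<bar>bumpf p m x\<bar> \<le> C * \<bar>x - x0\<bar>\<^sup>2" if x0: "1 \<le> \<bar>x0\<bar>" for x x0
  proof (cases "\<bar>x\<bar> < 1")
    case False
    then show ?thesis using M0 by (simp add: bumpf_def C_def)
  next
    case True
    define w where "w = 1 - x\<^sup>2"
    have w: "0 < w" using True by (simp add: w_def abs_square_less_1)
    have "\<bar>bumpf p m x\<bar> = \<bar>poly p x\<bar> * (exp (- 1 / w) / w ^ m)"
      using True w by (simp add: bumpf_def w_def abs_mult)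
    also have "\<dots> \<le> M * ((real k * w) ^ k / w ^ m)"
      using True w M0 by (intro mult_mono M divide_right_mono exp_neg_inverse_le_power) (auto simp: k_def)
    also have "\<dots> = M * real k ^ k * w\<^sup>2"
      using w by (simp add: k_def power_mult_distrib power_add power2_eq_square)
    also have "\<dots> \<le> M * real k ^ k * (2 * \<bar>x - x0\<bar>)\<^sup>2"
    proof (intro mult_left_mono power_mono)
      have "w = (1 - \<bar>x\<bar>) * (1 + \<bar>x\<bar>)"
        by (simp add: w_def algebra_simps power2_eq_square)
      also have "\<dots> \<le> \<bar>x - x0\<bar> * 2"
        using True x0 by (intro mult_mono) auto
      finally show "w \<le> 2 * \<bar>x - x0\<bar>" by simp
    qed (use w M0 in auto)
    also have "\<dots> = C * \<bar>x - x0\<bar>\<^sup>2"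
      by (simp add: C_def power_mult_distrib)
    finally show ?thesis .
  qed
  moreover have "0 \<le> C" using M0 by (simp add: C_def)
  ultimately show ?thesis using that by blast
qed

text \<open>The numerator over (1 - x^2)^(m + 2). The polynomial \<open>[:1, 0, -1:]\<close> is 1 -
  x^2, and the three summands come from differentiating p, the power and the exponential.\<close>

definition bumpf_deriv :: "real poly \<Rightarrow> nat \<Rightarrow> real poly" where
  "bumpf_deriv p m = pderiv p * [:1, 0, -1:]\<^sup>2 + smult (2 * real m) ([:0, 1:] * p * [:1, 0, -1:])
     - smult 2 ([:0, 1:] * p)"

lemma bumpf_has_real_derivative:
  "(bumpf p m has_real_derivative bumpf (bumpf_deriv p m) (m + 2) x) (at x)"
proof (cases "\<bar>x\<bar> < 1")
  case True
  have ev: "\<forall>\<^sub>F y in nhds x. bumpf p m y = poly p y / (1 - y\<^sup>2) ^ m * exp (- 1 / (1 - y\<^sup>2))"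
  proof -
    have "\<forall>\<^sub>F y in nhds x. y \<in> {-1<..<1}"
      using True by (intro eventually_nhds_in_open) auto
    then show ?thesis
      by eventually_elim (auto simp: bumpf_def)
  qed
  define w where "w = 1 - x\<^sup>2"
  have w: "0 < w" using True by (simp add: w_def abs_square_less_1)
  have wne: "1 - x\<^sup>2 \<noteq> 0" using w by (simp add: w_def)
  have dv: "((\<lambda>y. inverse (1 - y\<^sup>2)) has_real_derivative inverse w ^ 2 * (2 * x)) (at x)"
  proof -
    have "((\<lambda>y. 1 - y\<^sup>2) has_real_derivative - (2 * x)) (at x)"
      by (auto intro!: derivative_eq_intros)
    from DERIV_inverse'[OF this wne] show ?thesis
      by (simp add: w_def power2_eq_square mult_ac)
  qed
  have "((\<lambda>y. poly p y * inverse (1 - y\<^sup>2) ^ m * exp (- inverse (1 - y\<^sup>2))) has_real_derivative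
     poly (pderiv p) x * inverse w ^ m * exp (- inverse w)
     + poly p x * (m * inverse w ^ (m - 1) * (inverse w ^ 2 * (2 * x))) * exp (- inverse w)
     + poly p x * inverse w ^ m * (exp (- inverse w) * (- (inverse w ^ 2 * (2 * x))))) (at x)"
    by (rule DERIV_cong[OF DERIV_mult[OF DERIV_mult[OF poly_DERIV DERIV_power[OF dv]]
          DERIV_fun_exp[OF DERIV_minus[OF dv]]]])
      (simp only: w_def[symmetric], simp add: algebra_simps)
  also have "(\<lambda>y. poly p y * inverse (1 - y\<^sup>2) ^ m * exp (- inverse (1 - y\<^sup>2)))
     = (\<lambda>y. poly p y / (1 - y\<^sup>2) ^ m * exp (- 1 / (1 - y\<^sup>2)))"
    by (auto simp: field_simps power_inverse)
  also have "poly (pderiv p) x * inverse w ^ m * exp (- inverse w)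
     + poly p x * (m * inverse w ^ (m - 1) * (inverse w ^ 2 * (2 * x))) * exp (- inverse w)
     + poly p x * inverse w ^ m * (exp (- inverse w) * (- (inverse w ^ 2 * (2 * x))))
    = poly (bumpf_deriv p m) x / w ^ (m + 2) * exp (- 1 / w)"
  proof -
    have W: "poly [:1, 0, -1:] x = w" by (simp add: w_def power2_eq_square)
    have q: "poly (bumpf_deriv p m) x = poly (pderiv p) x * w\<^sup>2 + 2 * real m * (x * poly p x * w) - 2 * (x
        * poly p x)"
      unfolding bumpf_deriv_def poly_diff poly_add poly_mult poly_power poly_smult W by simp
    \<comment> \<open>For m = 0 the truncated exponent m - 1 is harmless because of the factor
      m.\<close>
    have mm: "real m * inverse w ^ (m - 1) = real m * inverse w ^ m * w"
      using w by (cases m) auto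
    show ?thesis unfolding q
      using w mm by (simp add: field_simps power_inverse power_add power2_eq_square) blast
  qed
  also have "\<dots> = bumpf (bumpf_deriv p m) (m + 2) x"
    using True by (simp add: bumpf_def w_def)
  finally show ?thesis
    using DERIV_cong_ev[OF refl ev refl] by blast
next
  case False
  obtain C where C: "0 \<le> C" "\<And>x x0. 1 \<le> \<bar>x0\<bar> \<Longrightarrow>
      \<bar>bumpf p m x\<bar> \<le> C * \<bar>x - x0\<bar>\<^sup>2"
    using bumpf_le_square by blast
  have "((\<lambda>y. (bumpf p m y - bumpf p m x) / (y - x)) \<longlongrightarrow> 0) (at x)"
  proof (rule Lim_null_comparison)
    show "\<forall>\<^sub>F y in at x. norm ((bumpf p m y - bumpf p m x) / (y - x)) \<le> C * \<bar>y - x\<bar>"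
    proof (intro eventually_at_filter[THEN iffD2] always_eventually allI impI)
      fix y assume "y \<noteq> x"
      have "\<bar>bumpf p m y - bumpf p m x\<bar> \<le> C * \<bar>y - x\<bar>\<^sup>2"
        using C(2)[of x y] False by (simp add: bumpf_def)
      then show "norm ((bumpf p m y - bumpf p m x) / (y - x)) \<le> C * \<bar>y - x\<bar>"
        using \<open>y \<noteq> x\<close> by (simp add: field_simps power2_eq_square)
    qed
    show "((\<lambda>y. C * \<bar>y - x\<bar>) \<longlongrightarrow> 0) (at x)"
      by (auto intro!: tendsto_eq_intros)
  qed
  moreover have "bumpf (bumpf_deriv p m) (m + 2) x = 0" using False by (simp add: bumpf_def)
  ultimately show ?thesis by (simp add: has_field_derivative_iff)
qed

section \<open>Tensor products and smooth kernels\<close>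

definition tprod :: "('n \<Rightarrow> real \<Rightarrow> real) \<Rightarrow> real^'n::finite \<Rightarrow> real" where
  "tprod p x = (\<Prod>i\<in>UNIV. p i (x $ i))"

lemma tprod_upd: "tprod (p(i := q)) x = q (x $ i) * (\<Prod>j\<in>UNIV - {i}. p j (x $ j))"
  unfolding tprod_def by (subst prod.remove[of _ i]) auto

text \<open>A partial derivative replaces a single factor, so it is a tensor product again and the
  rule can be iterated.\<close>

lemma tprod_has_derivative:
  assumes "\<And>i t. (p i has_real_derivative p' i t) (at t)"
  shows "(tprod p has_derivative (\<lambda>h. \<Sum>i\<in>UNIV. h $ i * tprod (p(i := p' i)) x)) (at x)"
proof -
  have "((\<lambda>y. p i (y $ i)) has_derivative (\<lambda>h. h $ i * p' i (x $ i))) (at x)" for i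
    by (rule DERIV_compose_FDERIV[OF assms]) (rule bounded_linear_imp_has_derivative[OF bounded_linear_vec_nth])
  then have "((\<lambda>y. \<Prod>i\<in>UNIV. p i (y $ i)) has_derivative
     (\<lambda>h. \<Sum>i\<in>UNIV. h $ i * p' i (x $ i) * (\<Prod>j\<in>UNIV - {i}. p j (x $ j)))) (at x)"
    by (intro has_derivative_prod)
  moreover have "tprod p = (\<lambda>y. \<Prod>i\<in>UNIV. p i (y $ i))"
    by (simp add: fun_eq_iff tprod_def)
  ultimately show ?thesis
    by (simp add: tprod_upd mult.assoc)
qed

lemma continuous_on_tprod:
  assumes "\<And>i. continuous_on UNIV (p i)"
  shows "continuous_on A (tprod p)"
  unfolding tprod_def[abs_def]
  by (intro continuous_intros continuous_on_compose2[OF assms]) auto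

lemma partial_deriv_eq:
  assumes "(g has_derivative (\<lambda>h. \<Sum>i\<in>UNIV. h $ i * g' i)) (at x)"
  shows "partial_deriv j g x = g' j"
  unfolding partial_deriv_def frechet_derivative_at[OF assms, symmetric]
  by (simp add: axis_def if_distrib[of "\<lambda>c. c * _"] cong: if_cong)

text \<open>Differentiation exchanges one factor for another member of S, so the induction on k
  never leaves the class; it has to run over all families p at once.\<close>

lemma Ck_tprod:
  assumes S: "\<And>g. g \<in> S \<Longrightarrow> \<exists>g'\<in>S. \<forall>t. (g has_real_derivative g' t) (at t)"
    and p: "\<And>i. p i \<in> S"
  shows "Ck k (tprod p)"
  using p
proof (induction k arbitrary: p)
  case 0
  have "continuous_on UNIV (p i)" for i
    using S[OF 0] by (meson DERIV_isCont continuous_at_imp_continuous_on)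
  then show ?case by (simp add: continuous_on_tprod)
next
  case (Suc k)
  obtain p' where p': "\<And>i. p' i \<in> S" "\<And>i t. (p i has_real_derivative p' i t) (at t)"
    using S[OF Suc.prems] by metis
  have d: "(tprod p has_derivative (\<lambda>h. \<Sum>i\<in>UNIV. h $ i * tprod (p(i := p' i)) x)) (at x)" for x
    by (rule tprod_has_derivative) (rule p')
  have "partial_deriv j (tprod p) = tprod (p(j := p' j))" for j
    by (rule ext) (rule partial_deriv_eq[OF d])
  moreover have "Ck k (tprod (p(j := p' j)))" for j
    by (rule Suc.IH) (simp add: p' Suc.prems)
  ultimately show ?case
    using d by (auto simp: differentiable_def)
qed

lemma tprod_support:
  assumes "tprod p x \<noteq> 0" "\<And>t. p i t \<noteq> 0 \<Longrightarrow> P t"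
  shows "P (x $ i)"
  using assms unfolding tprod_def by (metis UNIV_I finite prod_zero)

lemma bump_scaled_has_real_derivative:
  "((\<lambda>t. c * bumpf p m (a * t + b)) has_real_derivative
     (c * a) * bumpf (bumpf_deriv p m) (m + 2) (a * t + b)) (at t)"
proof -
  have "((\<lambda>t. bumpf p m (a * t + b)) has_real_derivative
     bumpf (bumpf_deriv p m) (m + 2) (a * t + b) * a) (at t)"
    by (rule DERIV_chain2[OF bumpf_has_real_derivative]) (auto intro!: derivative_eq_intros)
  from DERIV_cmult[OF this, of c] show ?thesis by (simp add: mult_ac)
qed

text \<open>Second derivatives and their symmetry are included because the null Lagrangian identity
  will be applied to mollified maps.\<close>

lemma mollifier_exists:
  assumes \<epsilon>: "0 < \<epsilon>"
  obtains K :: "real^'n::finite \<Rightarrow> real" and K1 K2 where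
    "continuous_on UNIV K" "\<And>j. continuous_on UNIV (K1 j)" "\<And>i j. continuous_on UNIV (K2 i j)"
    "\<And>x. 0 \<le> K x" "0 < K 0"
    "\<And>x i. K x \<noteq> 0 \<Longrightarrow> \<bar>x $ i\<bar> \<le> \<epsilon>"
    "\<And>x i j. K1 j x \<noteq> 0 \<Longrightarrow> \<bar>x $ i\<bar> \<le> \<epsilon>"
    "\<And>x. (K has_derivative (\<lambda>h. \<Sum>j\<in>UNIV. h $ j * K1 j x)) (at x)"
    "\<And>x j. (K1 j has_derivative (\<lambda>h. \<Sum>k\<in>UNIV. h $ k * K2 j k x)) (at x)"
    "\<And>j k. K2 j k = K2 k j"
    "\<And>x. test_function UNIV (\<lambda>y. K (x - y))"
proof -
  define S where "S = {(\<lambda>t. c * bumpf p m (a * t + b)) | c p m a b. True}"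
  have S: "\<exists>g'\<in>S. \<forall>t. (g has_real_derivative g' t) (at t)" if "g \<in> S" for g
  proof -
    obtain c p m a b where g: "g = (\<lambda>t. c * bumpf p m (a * t + b))"
      using \<open>g \<in> S\<close> unfolding S_def by blast
    show ?thesis
      unfolding g
    proof (rule bexI[of _ "\<lambda>t. (c * a) * bumpf (bumpf_deriv p m) (m + 2) (a * t + b)"])
      show "(\<lambda>t. (c * a) * bumpf (bumpf_deriv p m) (m + 2) (a * t + b)) \<in> S"
        unfolding S_def by blast
    qed (simp add: bump_scaled_has_real_derivative del: add_2_eq_Suc')
  qed
  define g0 where "g0 = (\<lambda>t. 1 * bumpf 1 0 ((1 / \<epsilon>) * t + 0))"
  define g1 where "g1 = (\<lambda>t. 1 * (1 / \<epsilon>) * bumpf (bumpf_deriv 1 0) (0 + 2) ((1 / \<epsilon>) * t + 0))"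
  define g2 where "g2 = (\<lambda>t. 1 * (1 / \<epsilon>) * (1 / \<epsilon>) *
     bumpf (bumpf_deriv (bumpf_deriv 1 0) (0 + 2)) (0 + 2 + 2) ((1 / \<epsilon>) * t + 0))"
  have d0: "(g0 has_real_derivative g1 t) (at t)" for t
    unfolding g0_def g1_def by (rule bump_scaled_has_real_derivative)
  have d1: "(g1 has_real_derivative g2 t) (at t)" for t
    unfolding g1_def g2_def by (rule bump_scaled_has_real_derivative)
  have d2: "\<exists>g3. \<forall>t. (g2 has_real_derivative g3 t) (at t)"
    unfolding g2_def by (rule exI, rule allI, rule bump_scaled_has_real_derivative)
  have c: "continuous_on UNIV g0" "continuous_on UNIV g1" "continuous_on UNIV g2"
    using d0 d1 d2 by (meson DERIV_isCont continuous_at_imp_continuous_on)+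
  have s: "g0 t \<noteq> 0 \<Longrightarrow> \<bar>t\<bar> \<le> \<epsilon>" "g1 t \<noteq> 0 \<Longrightarrow>
      \<bar>t\<bar> \<le> \<epsilon>" for t
    using \<epsilon> by (auto simp: g0_def g1_def bumpf_def field_simps split: if_splits)
  define K where "K = tprod (\<lambda>_::'n. g0)"
  define K1 where "K1 j = tprod ((\<lambda>_::'n. g0)(j := g1))" for j
  \<comment> \<open>Two derivatives in one coordinate give \<open>g2\<close> there; in different
    coordinates they update two factors by \<open>g1\<close>, and the order of the updates is
    immaterial, whence the symmetry.\<close>
  define K2 where "K2 j k = (if j = k then tprod ((\<lambda>_::'n. g0)(j := g2))
     else tprod ((\<lambda>_. g0)(j := g1, k := g1)))" for j k
  show ?thesis
  proof (rule that[of K K1 K2])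
    show "continuous_on UNIV K" unfolding K_def by (intro continuous_on_tprod c)
    show "continuous_on UNIV (K1 j)" for j
      unfolding K1_def by (intro continuous_on_tprod) (simp add: c)
    show "continuous_on UNIV (K2 i j)" for i j
      unfolding K2_def by (auto intro!: continuous_on_tprod simp: c)
    show "0 \<le> K x" for x
      unfolding K_def tprod_def by (intro prod_nonneg) (auto simp: g0_def bumpf_def)
    show "0 < K 0"
      unfolding K_def tprod_def by (intro prod_pos) (auto simp: g0_def bumpf_def)
    show "\<bar>x $ i\<bar> \<le> \<epsilon>" if "K x \<noteq> 0" for x i
      by (rule tprod_support[OF that[unfolded K_def]]) (rule s)
    show "\<bar>x $ i\<bar> \<le> \<epsilon>" if "K1 j x \<noteq> 0" for x i j
      by (rule tprod_support[OF that[unfolded K1_def]]) (auto split: if_splits simp: s)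
    show "(K has_derivative (\<lambda>h. \<Sum>j\<in>UNIV. h $ j * K1 j x)) (at x)" for x
      unfolding K_def K1_def by (rule tprod_has_derivative) (rule d0)
    show "(K1 j has_derivative (\<lambda>h. \<Sum>k\<in>UNIV. h $ k * K2 j k x)) (at x)" for x j
    proof -
      have "(K1 j has_derivative (\<lambda>h. \<Sum>k\<in>UNIV. h $ k *
         tprod (((\<lambda>_. g0)(j := g1))(k := ((\<lambda>_. g1)(j := g2)) k)) x)) (at x)"
        unfolding K1_def by (rule tprod_has_derivative) (simp add: d0 d1)
      also have "(\<lambda>k. tprod (((\<lambda>_. g0)(j := g1))(k := ((\<lambda>_. g1)(j := g2)) k)) x)
          = (\<lambda>k. K2 j k x)"
        by (auto simp: K2_def fun_eq_iff)
      finally show ?thesis .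
    qed
    show "K2 j k = K2 k j" for j k
      by (auto simp: K2_def fun_upd_twist)
    show "test_function UNIV (\<lambda>y. K (x - y))" for x
    proof -
      have eq: "(\<lambda>y. K (x - y)) = tprod (\<lambda>i t. 1 * bumpf 1 0 ((- 1 / \<epsilon>) * t
          + x $ i / \<epsilon>))"
        by (auto simp: fun_eq_iff K_def tprod_def g0_def diff_divide_distrib)
      have "(\<lambda>t. 1 * bumpf 1 0 ((- 1 / \<epsilon>) * t + x $ i / \<epsilon>)) \<in> S" for i
        unfolding S_def by (rule CollectI, intro exI conjI) (rule refl, rule TrueI)
      then have "Ck k (\<lambda>y. K (x - y))" for k
        unfolding eq by (intro Ck_tprod[OF S])
      moreover have "{y. K (x - y) \<noteq> 0} \<subseteq> cbox (x - (\<chi> i. \<epsilon>)) (x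
          + (\<chi> i. \<epsilon>))"
      proof
        fix y assume "y \<in> {y. K (x - y) \<noteq> 0}"
        then have "tprod (\<lambda>_::'n. g0) (x - y) \<noteq> 0" by (simp add: K_def)
        then have "\<bar>(x - y) $ i\<bar> \<le> \<epsilon>" for i
          by (rule tprod_support) (rule s)
        then show "y \<in> cbox (x - (\<chi> i. \<epsilon>)) (x + (\<chi> i. \<epsilon>))"
          by (simp add: mem_box_cart abs_le_iff) (smt (verit))
      qed
      then have "bounded {y. K (x - y) \<noteq> 0}" using bounded_cbox bounded_subset by blast
      ultimately show ?thesis
        unfolding test_function_def by (simp add: compact_closure)
    qed
  qed
qed

text \<open>Reduces the continuity of translations in \<open>L\<^sup>p\<close> to the case of \<open>L\<^sup>1\<close>, applied to \<open>|g|\<^sup>p\<^sup>-\<^sup>1 g\<close>.\<close>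

lemma norm_diff_power_le:
  fixes a b :: "'a::real_inner"
  shows "norm (a - b) ^ Suc m \<le> 2 ^ Suc m * norm (norm a ^ m *\<^sub>R a - norm b ^ m *\<^sub>R b)"
proof (cases "a = b")
  case False
  define p q where "p = norm a ^ m" and "q = norm b ^ m"
  have pq: "0 \<le> p" "0 \<le> q" by (auto simp: p_def q_def)
  \<comment> \<open>Twice the inner product of pa - qb with a - b equals (p + q)|a - b|^2 plus this
    term. It is nonnegative since t^m is increasing, and may be dropped.\<close>
  have "0 \<le> (p - q) * ((norm a)\<^sup>2 - (norm b)\<^sup>2)"
  proof (cases "norm a \<le> norm b")
    case True
    then show ?thesis by (intro mult_nonpos_nonpos) (auto simp: p_def q_def power_mono)
  next
    case False
    then show ?thesis by (intro mult_nonneg_nonneg) (auto simp: p_def q_def power_mono)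
  qed
  also have "(p - q) * ((norm a)\<^sup>2 - (norm b)\<^sup>2) + (p + q) * (norm (a - b))\<^sup>2
     = 2 * ((p *\<^sub>R a - q *\<^sub>R b) \<bullet> (a - b))"
    by (simp add: power2_norm_eq_inner inner_diff algebra_simps inner_commute)
  ultimately have "(p + q) * (norm (a - b))\<^sup>2 \<le> 2 * ((p *\<^sub>R a - q *\<^sub>R b) \<bullet> (a - b))"
    by linarith
  also have "\<dots> \<le> 2 * (norm (p *\<^sub>R a - q *\<^sub>R b) * norm (a - b))"
    by (intro mult_left_mono norm_cauchy_schwarz) auto
  finally have *: "(p + q) * norm (a - b) \<le> 2 * norm (p *\<^sub>R a - q *\<^sub>R b)"
    using False by (simp add: power2_eq_square mult.assoc[symmetric])
  have "norm (a - b) ^ m \<le> (2 * max (norm a) (norm b)) ^ m"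
    using norm_triangle_ineq4[of a b] by (intro power_mono) auto
  also have "\<dots> = 2 ^ m * max p q"
    by (simp add: power_mult_distrib p_def q_def max_def power_mono_iff)
      (metis linorder_not_le norm_ge_zero order_antisym power_mono nle_le)
  also have "\<dots> \<le> 2 ^ m * (p + q)" using pq by (intro mult_left_mono) auto
  finally have "norm (a - b) ^ Suc m \<le> 2 ^ m * (p + q) * norm (a - b)"
    by (simp add: mult.commute mult_left_mono)
  also have "\<dots> \<le> 2 ^ m * (2 * norm (p *\<^sub>R a - q *\<^sub>R b))"
    using * by (simp add: mult.assoc)
  finally show ?thesis by (simp add: p_def q_def)
qed simp

section \<open>Continuity of translations in the mean\<close>

lemma nn_integral_lborel_shift:
  fixes f :: "'a::euclidean_space \<Rightarrow> ennreal"
  assumes [measurable]: "f \<in> borel_measurable borel"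
  shows "(\<integral>\<^sup>+x. f (c + x) \<partial>lborel) = (\<integral>\<^sup>+x. f x \<partial>lborel)"
  by (subst (2) lborel_distr_plus[of c, symmetric]) (simp add: nn_integral_distr)

text \<open>As A has finite measure, Lebesgue measure restricted to A is a finite Borel measure and
  hence inner regular.\<close>

lemma compact_inner_approx:
  fixes A :: "'a::euclidean_space set"
  assumes A: "A \<in> sets borel" "emeasure lborel A < \<infinity>" and e: "0 < (e::real)"
  obtains K where "compact K" "K \<subseteq> A" "emeasure lborel (A - K) \<le> ennreal e"
proof -
  let ?M = "density lborel (indicator A :: 'a \<Rightarrow> ennreal)"
  have em: "emeasure ?M B = emeasure lborel (A \<inter> B)" if "B \<in> sets borel" for B
    using A that by (subst emeasure_density) (auto simp: indicator_inter_arith[symmetric])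
  have sup: "emeasure ?M A = (SUP K\<in>{K. K \<subseteq> A \<and> compact K}. emeasure ?M K)"
    by (rule inner_regular) (use A em[of UNIV] in auto)
  have "\<exists>K\<in>{K. K \<subseteq> A \<and> compact K}. emeasure ?M A < emeasure ?M K + ennreal e"
    by (rule SUP_approx_ennreal[where f = "emeasure ?M"]) (rule e, blast, rule sup, use A em[of A] in auto)
  then obtain K where K: "K \<subseteq> A" "compact K" "emeasure ?M A < emeasure ?M K + ennreal e" by auto
  have [simp]: "K \<in> sets borel" using K by (simp add: borel_compact)
  have "A \<inter> K = K" using K by auto
  then have "emeasure lborel A < emeasure lborel K + ennreal e"
    using K A em[of A] em[of K] by simp
  moreover have "emeasure lborel A = emeasure lborel K + emeasure lborel (A - K)"
    using K A by (subst plus_emeasure) (auto simp: Un_absorb1)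
  moreover have "emeasure lborel K < \<infinity>"
    using K emeasure_compact_finite by (auto simp: top.not_eq_extremum)
  ultimately have "emeasure lborel (A - K) \<le> ennreal e"
    by (simp add: ennreal_add_left_cancel_less less_imp_le)
  then show ?thesis using K that by blast
qed

text \<open>Induction over integrable functions. An indicator of A is squeezed between a compact K
  and an open U; a shift shorter than the distance from K to the complement of U can change the
  value at x only if x or its translate lies in U - K.\<close>

lemma L1_translation_continuous:
  fixes f :: "'a::euclidean_space \<Rightarrow> 'b::{banach, second_countable_topology}"
  assumes "integrable lborel f"
  shows "\<forall>e>0. \<exists>d>0. \<forall>h. norm h < d \<longrightarrow> (\<integral>\<^sup>+x. norm (f (h
      + x) - f x) \<partial>lborel) \<le> ennreal e"
  using assms
proof induction
  case (base A c)
  then have A[measurable]: "A \<in> sets borel" "emeasure lborel A < \<infinity>" by auto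
  show ?case
  proof (intro allI impI)
    fix e :: real assume e: "0 < e"
    \<comment> \<open>The set U - K has measure at most 2e' and is counted twice; adding 1 to the
      norm avoids a division by zero.\<close>
    define e' where "e' = e / (4 * (norm c + 1))"
    have e': "0 < e'" "norm c * (4 * e') \<le> e"
    proof -
      have n: "0 < norm c + 1" by (smt (verit) norm_ge_zero)
      show "0 < e'" using e n by (simp add: e'_def)
      have "norm c * (4 * e') = e * (norm c / (norm c + 1))" using n by (simp add: e'_def field_simps)
      also have "\<dots> \<le> e * 1" using e n by (intro mult_left_mono) auto
      finally show "norm c * (4 * e') \<le> e" by simp
    qed
    obtain K where K: "compact K" "K \<subseteq> A" "emeasure lborel (A - K) \<le> ennreal e'"
      using compact_inner_approx[OF A, of e'] e' by auto
    obtain U where U: "open U" "A \<subseteq> U" "emeasure lborel (U - A) < ennreal e'"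
      using outer_regular_lborel[OF A(1), of e'] e' by auto
    have [measurable]: "K \<in> sets borel" "U \<in> sets borel" using K U by (auto simp: borel_compact)
    have "emeasure lborel (U - K) = emeasure lborel ((U - A) \<union> (A - K))"
      using K U by (intro arg_cong[where f = "emeasure lborel"]) auto
    also have "\<dots> \<le> emeasure lborel (U - A) + emeasure lborel (A - K)"
      by (intro emeasure_subadditive) auto
    also have "\<dots> \<le> ennreal e' + ennreal e'"
      using K U by (intro add_mono) auto
    finally have UK: "emeasure lborel (U - K) \<le> ennreal (2 * e')"
      using e' by (simp flip: ennreal_plus)
    obtain d where d: "0 < d" "\<And>x y. x \<in> K \<Longrightarrow> y \<in> - U \<Longrightarrow> d \<le> dist x y"
    proof -
      have "closed (- U)" "K \<inter> - U = {}" using K U by auto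
      from separate_compact_closed[OF K(1) this] show ?thesis using that by blast
    qed
    have "(\<integral>\<^sup>+x. norm (indicator A (h + x) *\<^sub>R c - indicator A x *\<^sub>R c) \<partial>lborel) \<le> ennreal e"
      if h: "norm h < d" for h
    proof -
      have in1: "h + x \<in> U" if "x \<in> K" for x
        using d(2)[OF that, of "h + x"] h by (auto simp: dist_norm)
      have in2: "x \<in> U" if "h + x \<in> K" for x
        using d(2)[OF that, of x] h by (auto simp: dist_norm)
      have "(\<integral>\<^sup>+x. norm (indicator A (h + x) *\<^sub>R c - indicator A x *\<^sub>R c) \<partial>lborel)
         \<le> (\<integral>\<^sup>+x. ennreal (norm c) * (indicator (U - K) (h + x) + indicator (U - K) x) \<partial>lborel)"
        using in1 in2 K U mult_left_mono[of 1 2 "ennreal (norm c)"]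
        by (intro nn_integral_mono) (auto simp: indicator_def ennreal_mult'[symmetric])
      also have "\<dots> = ennreal (norm c) * ((\<integral>\<^sup>+x. indicator (U - K) (h + x) \<partial>lborel)
          + (\<integral>\<^sup>+x. indicator (U - K) x \<partial>lborel))"
        by (subst nn_integral_cmult, measurable) (subst nn_integral_add, auto)
      also have "\<dots> = ennreal (norm c) * (emeasure lborel (U - K) + emeasure lborel (U - K))"
        by (subst nn_integral_lborel_shift) auto
      also have "\<dots> \<le> ennreal (norm c) * (ennreal (2 * e') + ennreal (2 * e'))"
        by (intro mult_left_mono add_mono UK) auto
      also have "ennreal (2 * e') + ennreal (2 * e') = ennreal (4 * e')"
        using e' by (subst ennreal_plus[symmetric]) auto
      also have "ennreal (norm c) * ennreal (4 * e') = ennreal (norm c * (4 * e'))"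
        using e' by (subst ennreal_mult) auto
      also have "\<dots> \<le> ennreal e" using e' by (intro ennreal_leI)
      finally show ?thesis .
    qed
    then show "\<exists>d>0. \<forall>h. norm h < d \<longrightarrow>
      (\<integral>\<^sup>+x. norm (indicator A (h + x) *\<^sub>R c - indicator A x *\<^sub>R c) \<partial>lborel) \<le> ennreal e"
      using d(1) by blast
  qed
next
  case (add f g)
  have [measurable]: "f \<in> borel_measurable borel" "g \<in> borel_measurable borel"
    using borel_measurable_integrable[OF add(1)] borel_measurable_integrable[OF add(2)] by simp_all
  show ?case
  proof (intro allI impI)
    fix e :: real assume e: "0 < e"
    obtain d1 where d1: "0 < d1" "\<And>h. norm h < d1 \<Longrightarrow> (\<integral>\<^sup>+x. norm (f (h
        + x) - f x) \<partial>lborel) \<le> ennreal (e / 2)"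
      using add(3) e by (meson half_gt_zero)
    obtain d2 where d2: "0 < d2" "\<And>h. norm h < d2 \<Longrightarrow> (\<integral>\<^sup>+x. norm (g (h
        + x) - g x) \<partial>lborel) \<le> ennreal (e / 2)"
      using add(4) e by (meson half_gt_zero)
    have "(\<integral>\<^sup>+x. norm (f (h + x) + g (h + x) - (f x + g x)) \<partial>lborel) \<le> ennreal e"
      if h: "norm h < min d1 d2" for h
    proof -
      have "(\<integral>\<^sup>+x. norm (f (h + x) + g (h + x) - (f x + g x)) \<partial>lborel)
         \<le> (\<integral>\<^sup>+x. ennreal (norm (f (h + x) - f x)) + ennreal (norm (g (h + x) - g x)) \<partial>lborel)"
        by (intro nn_integral_mono) (simp add: norm_diff_triangle_ineq flip: ennreal_plus)
      also have "\<dots> = (\<integral>\<^sup>+x. norm (f (h + x) - f x) \<partial>lborel)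
          + (\<integral>\<^sup>+x. norm (g (h + x) - g x) \<partial>lborel)"
        by (rule nn_integral_add) auto
      also have "\<dots> \<le> ennreal (e / 2) + ennreal (e / 2)"
        using d1 d2 h by (intro add_mono) auto
      also have "\<dots> = ennreal e" using e by (simp flip: ennreal_plus)
      finally show ?thesis .
    qed
    then show "\<exists>d>0. \<forall>h. norm h < d \<longrightarrow>
      (\<integral>\<^sup>+x. norm (f (h + x) + g (h + x) - (f x + g x)) \<partial>lborel) \<le> ennreal e"
      using d1(1) d2(1) by (intro exI[of _ "min d1 d2"]) auto
  qed
next
  case (lim f s)
  have [measurable]: "f \<in> borel_measurable borel" "\<And>i. s i \<in> borel_measurable borel"
    using borel_measurable_integrable[OF lim.hyps(4)] borel_measurable_integrable[OF lim.hyps(1)] by simp_all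
  show ?case
  proof (intro allI impI)
    fix e :: real assume e: "0 < e"
    have "(\<lambda>i. (\<integral>\<^sup>+x. norm (f x - s i x) \<partial>lborel)) \<longlonglongrightarrow> 0"
    proof (rule nn_integral_dominated_convergence_norm[where w = "\<lambda>x. 2 * norm (f x)"])
      show "(\<integral>\<^sup>+ x. ennreal (2 * norm (f x)) \<partial>lborel) < \<infinity>"
        using lim.hyps(4) unfolding integrable_iff_bounded
        by (simp add: ennreal_mult nn_integral_cmult ennreal_mult_less_top)
    qed (use lim in auto)
    then have "\<forall>\<^sub>F i in sequentially. (\<integral>\<^sup>+x. norm (f x - s i x) \<partial>lborel) < ennreal (e / 3)"
      using e by (intro order_tendstoD) auto
    then obtain i where "(\<integral>\<^sup>+x. norm (f x - s i x) \<partial>lborel) < ennreal (e / 3)"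
      unfolding eventually_sequentially by blast
    then have i: "(\<integral>\<^sup>+x. norm (f x - s i x) \<partial>lborel) \<le> ennreal (e / 3)"
      by (rule less_imp_le)
    have "0 < e / 3" using e by simp
    then obtain d where d: "0 < d" "\<And>h. norm h < d \<Longrightarrow> (\<integral>\<^sup>+x. norm (s i (h
        + x) - s i x) \<partial>lborel) \<le> ennreal (e / 3)"
      using lim.IH by meson
    have "(\<integral>\<^sup>+x. norm (f (h + x) - f x) \<partial>lborel) \<le> ennreal e" if h: "norm h < d" for h
    proof -
      have "(\<integral>\<^sup>+x. norm (f (h + x) - f x) \<partial>lborel)
         \<le> (\<integral>\<^sup>+x. ennreal (norm (f (h + x) - s i (h + x))) + (ennreal (norm (s i (h + x) - s i x))
            + ennreal (norm (f x - s i x))) \<partial>lborel)"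
      proof (intro nn_integral_mono)
        fix x
        have "norm (f (h + x) - f x) \<le> norm (f (h + x) - s i (h + x)) + (norm (s i (h + x) - s i x)
            + norm (f x - s i x))"
          using norm_triangle_ineq[of "f (h + x) - s i (h + x)" "(s i (h + x) - s i x) - (f x - s i x)"]
            norm_triangle_ineq4[of "s i (h + x) - s i x" "f x - s i x"] by simp
        then show "ennreal (norm (f (h + x) - f x)) \<le> ennreal (norm (f (h + x) - s i (h + x)))
            + (ennreal (norm (s i (h + x) - s i x)) + ennreal (norm (f x - s i x)))"
          by (simp flip: ennreal_plus)
      qed
      also have "\<dots> = (\<integral>\<^sup>+x. norm (f (h + x) - s i (h + x)) \<partial>lborel)
          + ((\<integral>\<^sup>+x. norm (s i (h + x) - s i x) \<partial>lborel) + (\<integral>\<^sup>+x. norm (f x - s i x) \<partial>lborel))"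
        by (subst nn_integral_add, simp, simp) (subst nn_integral_add, auto)
      also have "(\<integral>\<^sup>+x. norm (f (h + x) - s i (h + x)) \<partial>lborel)
          = (\<integral>\<^sup>+x. norm (f x - s i x) \<partial>lborel)"
        by (rule nn_integral_lborel_shift[of "\<lambda>x. ennreal (norm (f x - s i x))"]) simp
      also have "(\<integral>\<^sup>+x. norm (f x - s i x) \<partial>lborel)
          + ((\<integral>\<^sup>+x. norm (s i (h + x) - s i x) \<partial>lborel)
            + (\<integral>\<^sup>+x. norm (f x - s i x) \<partial>lborel)) \<le> ennreal (e / 3) + (ennreal (e / 3) + ennreal (e / 3))"
        using i d(2)[OF h] by (intro add_mono)
      also have "\<dots> = ennreal e" using e by (simp flip: ennreal_plus)
      finally show ?thesis .
    qed
    then show "\<exists>d>0. \<forall>h. norm h < d \<longrightarrow> (\<integral>\<^sup>+x. norm (f (h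
        + x) - f x) \<partial>lborel) \<le> ennreal e"
      using d(1) by blast
  qed
qed

lemma nn_integral_lborel_affine:
  fixes f :: "'a::euclidean_space \<Rightarrow> ennreal"
  assumes [measurable]: "f \<in> borel_measurable borel" and "c \<noteq> 0"
  shows "(\<integral>\<^sup>+x. f x \<partial>lborel) = ennreal (\<bar>c\<bar> ^ DIM('a))
      * (\<integral>\<^sup>+x. f (t + c *\<^sub>R x) \<partial>lborel)"
proof -
  have "(\<integral>\<^sup>+x. f x \<partial>lborel) = (\<integral>\<^sup>+x. f x \<partial>density (distr lborel borel (\<lambda>x. t + c *\<^sub>R x)) (\<lambda>_. \<bar>c\<bar> ^ DIM('a)))"
    using lborel_affine[OF \<open>c \<noteq> 0\<close>, of t] by simp
  also have "\<dots> = (\<integral>\<^sup>+x. ennreal (\<bar>c\<bar> ^ DIM('a))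
      * f x \<partial>distr lborel borel (\<lambda>x. t + c *\<^sub>R x))"
    by (subst nn_integral_density) auto
  also have "\<dots> = (\<integral>\<^sup>+x. ennreal (\<bar>c\<bar> ^ DIM('a)) * f (t
      + c *\<^sub>R x) \<partial>lborel)"
    by (subst nn_integral_distr) auto
  also have "\<dots> = ennreal (\<bar>c\<bar> ^ DIM('a)) * (\<integral>\<^sup>+x. f (t
      + c *\<^sub>R x) \<partial>lborel)"
    by (rule nn_integral_cmult) auto
  finally show ?thesis .
qed

lemma nn_integral_lborel_reflect:
  fixes f :: "'a::euclidean_space \<Rightarrow> ennreal"
  assumes "f \<in> borel_measurable borel"
  shows "(\<integral>\<^sup>+x. f (t - x) \<partial>lborel) = (\<integral>\<^sup>+x. f x \<partial>lborel)"
  using nn_integral_lborel_affine[OF assms, of "-1" t] by simp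

section \<open>Jensen's inequality and integrals of powers\<close>

text \<open>Convexity in tangent form, which is Bernoulli's inequality for t / m.\<close>

lemma power_ge_tangent:
  fixes t m :: real
  assumes "0 \<le> t" "0 \<le> m"
  shows "m ^ n + real n * m ^ (n - 1) * (t - m) \<le> t ^ n"
proof (cases "m = 0")
  case True
  then show ?thesis using assms by (cases n) (auto simp: power_0_left)
next
  case False
  then have m: "0 < m" using assms by simp
  have "1 + real n * (t / m - 1) \<le> (1 + (t / m - 1)) ^ n"
    using assms m by (intro Bernoulli_inequality) simp
  then have "m ^ n * (1 + real n * (t / m - 1)) \<le> m ^ n * (t / m) ^ n"
    using m by (intro mult_left_mono) auto
  also have "\<dots> = t ^ n" using m by (simp add: power_divide)
  also have "m ^ n * (1 + real n * (t / m - 1)) = m ^ n + real n * m ^ (n - 1) * (t - m)"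
    using m by (cases n) (auto simp: field_simps)
  finally show ?thesis .
qed

text \<open>The tangent inequality is taken at the weighted mean m of \<open>norm (g x)\<close> and
  integrated against w; the linear term integrates to zero.\<close>

lemma jensen_norm_power:
  fixes g :: "'a \<Rightarrow> 'b::{banach, second_countable_topology}"
  assumes [measurable]: "w \<in> borel_measurable M" "g \<in> borel_measurable M"
    and w: "\<And>x. 0 \<le> w x" "(\<integral>\<^sup>+x. ennreal (w x) \<partial>M) = 1" and n: "0 < n"
  shows "ennreal (norm (\<integral>x. w x *\<^sub>R g x \<partial>M) ^ n)
      \<le> (\<integral>\<^sup>+x. ennreal (w x * norm (g x) ^ n) \<partial>M)"
proof (cases "integrable M (\<lambda>x. w x *\<^sub>R g x) \<and> (\<integral>\<^sup>+x. ennreal (w x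
    * norm (g x) ^ n) \<partial>M) < \<infinity>")
  \<comment> \<open>If the left integrand is not integrable, its Bochner integral is 0 by
    convention, and n > 0 makes the power 0; if the right-hand side is infinite there is nothing to
    show.\<close>
  case False
  then show ?thesis
    using n by (auto simp: not_integrable_integral_eq less_top[symmetric] zero_power)
next
  case True
  have iw: "integrable M w" "(\<integral>x. w x \<partial>M) = 1"
    using w by (auto intro!: integrableI_nonneg simp: integral_eq_nn_integral)
  have i1: "integrable M (\<lambda>x. w x * norm (g x))"
    using integrable_norm[OF conjunct1[OF True]] w by simp
  have i2: "integrable M (\<lambda>x. w x * norm (g x) ^ n)"
    using True w by (intro integrableI_nonneg) auto
  define m where "m = (\<integral>x. w x * norm (g x) \<partial>M)"
  have m: "0 \<le> m" unfolding m_def using w by (intro integral_nonneg_AE) auto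
  have "norm (\<integral>x. w x *\<^sub>R g x \<partial>M) \<le> m"
    using integral_norm_bound[of M "\<lambda>x. w x *\<^sub>R g x"] w by (simp add: m_def)
  then have "norm (\<integral>x. w x *\<^sub>R g x \<partial>M) ^ n \<le> m ^ n" by (intro power_mono) auto
  also have "m ^ n = (\<integral>x. m ^ n * w x + real n * m ^ (n - 1) * (w x * norm (g x) - m * w x) \<partial>M)"
    using iw i1 by (simp add: m_def[symmetric])
  also have "\<dots> \<le> (\<integral>x. w x * norm (g x) ^ n \<partial>M)"
  proof (rule integral_mono)
    fix x
    have "w x * (m ^ n + real n * m ^ (n - 1) * (norm (g x) - m)) \<le> w x * norm (g x) ^ n"
      using w m by (intro mult_left_mono power_ge_tangent) auto
    then show "m ^ n * w x + real n * m ^ (n - 1) * (w x * norm (g x) - m * w x) \<le> w x * norm (g x) ^ n"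
      by (simp add: algebra_simps)
  qed (use iw i1 i2 in auto)
  finally have "ennreal (norm (\<integral>x. w x *\<^sub>R g x \<partial>M) ^ n)
      \<le> ennreal (\<integral>x. w x * norm (g x) ^ n \<partial>M)"
    by (rule ennreal_leI)
  also have "\<dots> = (\<integral>\<^sup>+x. ennreal (w x * norm (g x) ^ n) \<partial>M)"
    using i2 w by (intro nn_integral_eq_integral[symmetric]) auto
  finally show ?thesis .
qed

abbreviation pintegral :: "nat \<Rightarrow> 'a::euclidean_space set \<Rightarrow> ('a \<Rightarrow> 'b::real_normed_vector) \<Rightarrow> ennreal" where
  "pintegral p S u \<equiv> (\<integral>\<^sup>+x. indicator S x * ennreal (norm (u x) ^ p) \<partial>lborel)"

lemma pintegral_mono: "S \<subseteq> T \<Longrightarrow> pintegral p S u \<le> pintegral p T u"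
  by (intro nn_integral_mono mult_right_mono) (auto simp: indicator_def)

lemma pintegral_const: "S \<in> sets borel \<Longrightarrow> pintegral p S (\<lambda>_. c)
    = ennreal (norm c ^ p) * emeasure lborel S"
  by (subst nn_integral_multc) (auto simp: mult.commute)

lemma power_add_le: "(a + b) ^ p \<le> 2 ^ p * (a ^ p + b ^ p)" if "0 \<le> a" "0 \<le> b" for a b :: real
proof -
  have "(a + b) ^ p \<le> (2 * max a b) ^ p" using that by (intro power_mono) auto
  also have "\<dots> = 2 ^ p * max a b ^ p" by (rule power_mult_distrib)
  also have "max a b ^ p \<le> a ^ p + b ^ p" using that by (auto simp: max_def)
  finally show ?thesis by simp
qed

lemma pintegral_triangle:
  fixes u v :: "'a::euclidean_space \<Rightarrow> 'b::euclidean_space"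
  assumes [measurable]: "S \<in> sets borel" "u \<in> borel_measurable borel" "v \<in> borel_measurable borel"
  shows "pintegral p S u \<le> ennreal (2 ^ p) * (pintegral p S v + pintegral p S (\<lambda>x. u x - v x))"
proof -
  have "pintegral p S u \<le> (\<integral>\<^sup>+x. ennreal (2 ^ p) * (indicator S x * ennreal (norm (v x) ^ p)
      + indicator S x * ennreal (norm (u x - v x) ^ p)) \<partial>lborel)"
  proof (rule nn_integral_mono)
    fix x
    have "norm (u x) ^ p \<le> (norm (v x) + norm (u x - v x)) ^ p"
      by (intro power_mono norm_triangle_sub) auto
    also have "\<dots> \<le> 2 ^ p * (norm (v x) ^ p + norm (u x - v x) ^ p)"
      by (rule power_add_le) auto
    finally have "ennreal (norm (u x) ^ p) \<le> ennreal (2 ^ p) * (ennreal (norm (v x) ^ p)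
        + ennreal (norm (u x - v x) ^ p))"
      by (subst ennreal_plus[symmetric], simp, simp, subst ennreal_mult[symmetric]) (auto intro!: ennreal_leI)
    then show "indicator S x * ennreal (norm (u x) ^ p) \<le> ennreal (2 ^ p) * (indicator S x
        * ennreal (norm (v x) ^ p)
      + indicator S x * ennreal (norm (u x - v x) ^ p))"
      by (cases "x \<in> S") auto
  qed
  also have "\<dots> = ennreal (2 ^ p) * (pintegral p S v + pintegral p S (\<lambda>x. u x - v x))"
    by (subst nn_integral_cmult, simp) (subst nn_integral_add, auto)
  finally show ?thesis .
qed

lemma Lp_translation_continuous:
  fixes g :: "'a::euclidean_space \<Rightarrow> 'b::euclidean_space"
  assumes [measurable]: "g \<in> borel_measurable borel"
    and int: "\<And>C. compact C \<Longrightarrow> set_integrable lborel C (\<lambda>x. norm (g x) ^ Suc m)"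
    and Q: "compact Q" and e: "0 < e"
  obtains d where "0 < d"
    "\<And>h. norm h < d \<Longrightarrow> pintegral (Suc m) Q (\<lambda>x. g (h + x) - g x) \<le> ennreal e"
proof -
  obtain R where R: "Q \<subseteq> cball 0 R" 
  proof -
    obtain R where "\<forall>x\<in>Q. norm x \<le> R" using compact_imp_bounded[OF Q] bounded_iff by blast
    then show ?thesis by (intro that[of R]) auto
  qed
  \<comment> \<open>The additional 1 keeps both x and h + x in C when x is in Q and |h| < 1, so the
    cutoff in \<open>G\<close> affects neither value.\<close>
  define C where "C = (cball 0 (R + 1) :: 'a set)"
  have [measurable]: "C \<in> sets borel" "Q \<in> sets borel" using Q by (auto simp: C_def borel_compact)
  define G where "G x = indicator C x *\<^sub>R (norm (g x) ^ m *\<^sub>R g x)" for x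
  have [measurable]: "G \<in> borel_measurable borel" unfolding G_def by measurable
  have iG: "integrable lborel G"
  proof (rule Bochner_Integration.integrable_bound)
    show "integrable lborel (\<lambda>x. indicator C x *\<^sub>R (norm (g x) ^ Suc m))"
      using int[of C] by (simp add: set_integrable_def C_def)
    show "AE x in lborel. norm (G x) \<le> norm (indicator C x *\<^sub>R (norm (g x) ^ Suc m))"
      by (auto simp: G_def indicator_def)
  qed simp
  have pos: "0 < e / 2 ^ Suc m" using e by simp
  obtain d where d: "0 < d"
    "\<And>h. norm h < d \<Longrightarrow> (\<integral>\<^sup>+x. norm (G (h + x) - G x) \<partial>lborel)
        \<le> ennreal (e / 2 ^ Suc m)"
    using L1_translation_continuous[OF iG, rule_format, OF pos] by blast
  have "pintegral (Suc m) Q (\<lambda>x. g (h + x) - g x) \<le> ennreal e"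
    if h: "norm h < min d 1" for h
  proof -
    have "pintegral (Suc m) Q (\<lambda>x. g (h + x) - g x)
      \<le> (\<integral>\<^sup>+x. ennreal (2 ^ Suc m) * ennreal (norm (G (h + x) - G x)) \<partial>lborel)"
    proof (rule nn_integral_mono)
      fix x
      show "indicator Q x * ennreal (norm (g (h + x) - g x) ^ Suc m)
         \<le> ennreal (2 ^ Suc m) * ennreal (norm (G (h + x) - G x))"
      proof (cases "x \<in> Q")
        case True
        then have "norm x \<le> R" using R by auto
        then have "x \<in> C" "h + x \<in> C"
          using h norm_triangle_ineq[of h x] by (auto simp: C_def)
        then have "norm (g (h + x) - g x) ^ Suc m \<le> 2 ^ Suc m * norm (G (h + x) - G x)"
          using norm_diff_power_le[of "g (h + x)" "g x" m] by (simp add: G_def)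
        then show ?thesis
          using True by (subst ennreal_mult[symmetric]) (auto intro!: ennreal_leI)
      qed simp
    qed
    also have "\<dots> = ennreal (2 ^ Suc m) * (\<integral>\<^sup>+x. ennreal (norm (G (h
        + x) - G x)) \<partial>lborel)"
      by (rule nn_integral_cmult) simp
    also have "\<dots> \<le> ennreal (2 ^ Suc m) * ennreal (e / 2 ^ Suc m)"
      using d h by (intro mult_left_mono) auto
    also have "\<dots> = ennreal e" using e by (subst ennreal_mult[symmetric]) auto
    finally show ?thesis .
  qed
  then show ?thesis using that[of "min d 1"] d by simp
qed

section \<open>Mollification and its derivatives\<close>

definition mollify :: "('a::euclidean_space \<Rightarrow> real) \<Rightarrow> ('a \<Rightarrow> 'b::euclidean_space) \<Rightarrow> 'a \<Rightarrow> 'b" where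
  "mollify K g x = (\<integral>y. K (x - y) *\<^sub>R g y \<partial>lborel)"

lemma integrable_continuous_scaleR:
  fixes K :: "'a::euclidean_space \<Rightarrow> real" and g :: "'a \<Rightarrow> 'b::euclidean_space"
  assumes K: "continuous_on UNIV K" "\<And>x. K x \<noteq> 0 \<Longrightarrow> x \<in> C" and C: "compact C"
    and [measurable]: "g \<in> borel_measurable borel" and g: "set_integrable lborel C g"
  shows "integrable lborel (\<lambda>y. K y *\<^sub>R g y)"
proof -
  have "compact (K ` C)" using K(1) C by (meson compact_continuous_image continuous_on_subset subset_UNIV)
  then obtain B where B: "\<And>x. x \<in> C \<Longrightarrow> \<bar>K x\<bar> \<le> B"
    using compact_imp_bounded bounded_iff by (metis imageI real_norm_def)
  have [measurable]: "K \<in> borel_measurable borel" using K(1) by (rule borel_measurable_continuous_onI)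
  show ?thesis
  proof (rule Bochner_Integration.integrable_bound)
    show "integrable lborel (\<lambda>x. B *\<^sub>R (indicator C x *\<^sub>R g x))"
      using g unfolding set_integrable_def by (rule integrable_scaleR_right)
    show "AE x in lborel. norm (K x *\<^sub>R g x) \<le> norm (B *\<^sub>R (indicator C x *\<^sub>R g x))"
    proof (rule AE_I2)
      fix x
      show "norm (K x *\<^sub>R g x) \<le> norm (B *\<^sub>R (indicator C x *\<^sub>R g x))"
      proof (cases "x \<in> C")
        case True
        then have "\<bar>K x\<bar> \<le> \<bar>B\<bar>" using B[of x] by linarith
        then show ?thesis using True by (auto intro!: mult_right_mono)
      next
        case False
        then have "K x = 0" using K(2) by blast
        then show ?thesis by simp
      qed
    qed
  qed simp
qed

lemma set_integrable_continuous:
  fixes f :: "'a::euclidean_space \<Rightarrow> 'b::euclidean_space"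
  assumes "continuous_on UNIV f" "compact C"
  shows "set_integrable lborel C f"
  unfolding set_integrable_def
  by (intro borel_integrable_compact assms continuous_on_subset[OF assms(1)]) auto

lemma integrable_mollify:
  fixes g :: "'a::euclidean_space \<Rightarrow> 'b::euclidean_space"
  assumes K: "continuous_on UNIV K" "\<And>z. K z \<noteq> 0 \<Longrightarrow> norm z \<le> r"
    and g: "g \<in> borel_measurable borel" "\<And>C. compact C \<Longrightarrow> set_integrable lborel C g"
  shows "integrable lborel (\<lambda>y. K (x - y) *\<^sub>R g y)"
proof (rule integrable_continuous_scaleR[where C = "cball x r"])
  show "continuous_on UNIV (\<lambda>y. K (x - y))"
    by (intro continuous_on_compose2[OF K(1)] continuous_intros) auto
  show "y \<in> cball x r" if "K (x - y) \<noteq> 0" for y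
    using K(2)[OF that] by (simp add: dist_norm)
qed (auto intro: g)

text \<open>Exactly the properties behind the approximation estimates; derivatives of the kernel are
  supplied separately by \<open>normalized_mollifier_exists\<close>.\<close>

definition mollifier :: "real \<Rightarrow> ('a::euclidean_space \<Rightarrow> real) \<Rightarrow> bool" where
  "mollifier d K \<longleftrightarrow> continuous_on UNIV K \<and> (\<forall>x. 0 \<le> K x)
      \<and> (\<integral>\<^sup>+x. ennreal (K x) \<partial>lborel) = 1 \<and>
     (\<forall>x. K x \<noteq> 0 \<longrightarrow> norm x < d)"

lemma mollifierD:
  assumes "mollifier d K"
  shows "continuous_on UNIV K" "0 \<le> K x" "(\<integral>\<^sup>+x. ennreal (K x) \<partial>lborel)
      = 1" "K x \<noteq> 0 \<Longrightarrow> norm x < d"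
    "K \<in> borel_measurable borel" "(\<integral>\<^sup>+y. ennreal (K (x - y)) \<partial>lborel) = 1"
proof -
  show c: "continuous_on UNIV K" and "0 \<le> K x" and 1: "(\<integral>\<^sup>+x. ennreal (K x) \<partial>lborel) = 1"
    and "K x \<noteq> 0 \<Longrightarrow> norm x < d"
    using assms by (auto simp: mollifier_def)
  show m: "K \<in> borel_measurable borel" using c by (rule borel_measurable_continuous_onI)
  show "(\<integral>\<^sup>+y. ennreal (K (x - y)) \<partial>lborel) = 1"
    using nn_integral_lborel_reflect[of "\<lambda>y. ennreal (K y)" x] m 1 by simp
qed

lemma mollifier_mono: "mollifier d K \<Longrightarrow> d \<le> d' \<Longrightarrow> mollifier d' K"
  unfolding mollifier_def by (meson less_le_trans)

text \<open>As K has unit mass, the value g x is an average of itself and can be moved under the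
  integral.\<close>

lemma mollify_diff:
  fixes g :: "'a::euclidean_space \<Rightarrow> 'b::euclidean_space"
  assumes g: "g \<in> borel_measurable borel" "\<And>C. compact C \<Longrightarrow> set_integrable lborel C g"
    and K: "mollifier d K"
  shows "mollify K g x - g x = (\<integral>y. K (x - y) *\<^sub>R (g y - g x) \<partial>lborel)"
proof -
  have [measurable]: "K \<in> borel_measurable borel" by (rule mollifierD[OF K])
  have "integrable lborel (\<lambda>y. K (x - y))" "(\<integral>y. K (x - y) \<partial>lborel) = 1"
    using mollifierD(2,6)[OF K] by (auto intro!: integrableI_nonneg simp: integral_eq_nn_integral)
  moreover have "integrable lborel (\<lambda>y. K (x - y) *\<^sub>R g y)"
    using mollifierD(4)[OF K] by (intro integrable_mollify[where r = d] mollifierD[OF K] g) (auto simp: less_imp_le)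
  ultimately show ?thesis
    unfolding mollify_def scaleR_diff_right by (subst Bochner_Integration.integral_diff) auto
qed

text \<open>Jensen's inequality for the probability density K (x - y) bounds the error by an
  average, over shifts z in the support of K, of the error caused by translating by -z. Tonelli's
  theorem then reduces the claim to continuity of translations.\<close>

lemma mollify_Lp_close:
  fixes g :: "'a::euclidean_space \<Rightarrow> 'b::euclidean_space"
  assumes [measurable]: "g \<in> borel_measurable borel"
    and int1: "\<And>C. compact C \<Longrightarrow> set_integrable lborel C g"
    and int: "\<And>C. compact C \<Longrightarrow> set_integrable lborel C (\<lambda>x. norm (g x) ^ Suc m)"
    and Q: "compact Q" and e: "0 < e"
  obtains d where "0 < d"
    "\<And>K. mollifier d K \<Longrightarrow> pintegral (Suc m) Q (\<lambda>x. mollify K g x - g x) \<le> ennreal e"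
proof -
  obtain d where d: "0 < d"
    "\<And>h. norm h < d \<Longrightarrow> pintegral (Suc m) Q (\<lambda>x. g (h + x) - g x) \<le> ennreal e"
    using Lp_translation_continuous[OF assms(1) int Q e] by metis
  have [measurable]: "Q \<in> sets borel" using Q by (simp add: borel_compact)
  have "pintegral (Suc m) Q (\<lambda>x. mollify K g x - g x) \<le> ennreal e"
    if moll: "mollifier d K" for K
  proof -
    note K = mollifierD[OF moll]
    have [measurable]: "K \<in> borel_measurable borel" by (rule K)
    have pt: "ennreal (norm (mollify K g x - g x) ^ Suc m)
      \<le> (\<integral>\<^sup>+z. ennreal (K z) * ennreal (norm (g (x - z) - g x) ^ Suc m) \<partial>lborel)" for x
    proof -
      have md: "mollify K g x - g x = (\<integral>y. K (x - y) *\<^sub>R (g y - g x) \<partial>lborel)"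
        by (rule mollify_diff[OF assms(1) int1 moll])
      have "ennreal (norm (mollify K g x - g x) ^ Suc m)
        \<le> (\<integral>\<^sup>+y. ennreal (K (x - y) * norm (g y - g x) ^ Suc m) \<partial>lborel)"
        unfolding md using K(2) K(6)[of x] by (intro jensen_norm_power) auto
      also have "\<dots> = (\<integral>\<^sup>+z. ennreal (K (x - (x - z))
          * norm (g (x - z) - g x) ^ Suc m) \<partial>lborel)"
        by (rule nn_integral_lborel_reflect[symmetric]) simp
      also have "\<dots> = (\<integral>\<^sup>+z. ennreal (K z)
          * ennreal (norm (g (x - z) - g x) ^ Suc m) \<partial>lborel)"
        using K(2) by (simp add: ennreal_mult)
      finally show ?thesis .
    qed
    have "pintegral (Suc m) Q (\<lambda>x. mollify K g x - g x)
      \<le> (\<integral>\<^sup>+x. \<integral>\<^sup>+z. indicator Q x * (ennreal (K z) * ennreal (norm (g (x - z) - g x) ^ Suc m)) \<partial>lborel \<partial>lborel)"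
      by (intro nn_integral_mono) (subst nn_integral_cmult, simp, intro mult_left_mono pt, simp)
    also have "\<dots> = (\<integral>\<^sup>+z. \<integral>\<^sup>+x. indicator Q x * (ennreal (K z)
        * ennreal (norm (g (x - z) - g x) ^ Suc m)) \<partial>lborel \<partial>lborel)"
      by (rule lborel_pair.Fubini'[symmetric]) measurable
    also have "\<dots> \<le> (\<integral>\<^sup>+z. ennreal (K z) * ennreal e \<partial>lborel)"
    proof (rule nn_integral_mono)
      fix z
      have "(\<integral>\<^sup>+x. indicator Q x * (ennreal (K z)
          * ennreal (norm (g (x - z) - g x) ^ Suc m)) \<partial>lborel)
        = (\<integral>\<^sup>+x. ennreal (K z) * (indicator Q x * ennreal (norm (g (- z + x) - g x) ^ Suc m)) \<partial>lborel)"
        by (simp add: mult_ac)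
      also have "\<dots> = ennreal (K z) * pintegral (Suc m) Q (\<lambda>x. g (- z + x) - g x)"
        by (rule nn_integral_cmult) simp
      also have "\<dots> \<le> ennreal (K z) * ennreal e"
        using d(2)[of "- z"] K(4)[of z] by (cases "K z = 0") (auto intro!: mult_left_mono)
      finally show "(\<integral>\<^sup>+x. indicator Q x * (ennreal (K z)
          * ennreal (norm (g (x - z) - g x) ^ Suc m)) \<partial>lborel)
        \<le> ennreal (K z) * ennreal e" .
    qed
    also have "\<dots> = ennreal e" using K(3) by (simp add: nn_integral_multc)
    finally show ?thesis .
  qed
  then show ?thesis using that d(1) by blast
qed

text \<open>The box may be the same for all points near x, which opens the way to continuity in a
  parameter and to differentiation under the integral sign.\<close>

lemma mollify_eq_integral_cbox:
  fixes F :: "'a::euclidean_space \<Rightarrow> 'b::euclidean_space"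
  assumes K: "continuous_on UNIV K" and F: "continuous_on UNIV F"
    and supp: "\<And>z. K z \<noteq> 0 \<Longrightarrow> norm z \<le> r" and sub: "cball x r \<subseteq> cbox a b"
  shows "mollify K F x = integral (cbox a b) (\<lambda>y. K (x - y) *\<^sub>R F y)"
proof -
  have "K (x - y) *\<^sub>R F y = indicator (cbox a b) y *\<^sub>R (K (x - y) *\<^sub>R F y)" for y
  proof (cases "K (x - y) = 0")
    case False
    then have "y \<in> cbox a b" using supp[OF False] sub by (auto simp: dist_norm)
    then show ?thesis by simp
  qed simp
  then have "mollify K F x = (\<integral>y. indicator (cbox a b) y *\<^sub>R (K (x - y) *\<^sub>R F y) \<partial>lborel)"
    unfolding mollify_def by (rule Bochner_Integration.integral_cong[OF refl])
  also have "\<dots> = integral (cbox a b) (\<lambda>y. K (x - y) *\<^sub>R F y)"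
  proof -
    have "continuous_on (cbox a b) (\<lambda>y. K (x - y) *\<^sub>R F y)"
      by (intro continuous_intros continuous_on_compose2[OF K] continuous_on_subset[OF F]) auto
    then have "set_integrable lborel (cbox a b) (\<lambda>y. K (x - y) *\<^sub>R F y)"
      unfolding set_integrable_def by (intro borel_integrable_compact) auto
    from set_borel_integral_eq_integral(2)[OF this] show ?thesis
      by (simp add: set_lebesgue_integral_def)
  qed
  finally show ?thesis .
qed

lemma continuous_on_mollify:
  fixes F :: "'a::euclidean_space \<Rightarrow> 'b::euclidean_space"
  assumes K: "continuous_on UNIV K" and F: "continuous_on UNIV F"
    and supp: "\<And>z. K z \<noteq> 0 \<Longrightarrow> norm z \<le> r"
  shows "continuous_on UNIV (mollify K F)"
proof -
  have "isCont (mollify K F) x0" for x0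
  proof -
    obtain a b where ab: "cball x0 (\<bar>r\<bar> + 1) \<subseteq> cbox a b"
      using bounded_subset_cbox_symmetric[OF bounded_cball] by metis
    have sub: "cball x r \<subseteq> cbox a b" if "x \<in> ball x0 1" for x
    proof -
      have "cball x r \<subseteq> cball x0 (\<bar>r\<bar> + 1)"
      proof
        fix y assume "y \<in> cball x r"
        then show "y \<in> cball x0 (\<bar>r\<bar> + 1)"
          using that dist_triangle[of x0 y x] by auto
      qed
      then show ?thesis using ab by blast
    qed
    have "continuous_on (ball x0 1) (\<lambda>x. integral (cbox a b) (\<lambda>y. K (x - y) *\<^sub>R F y))"
      by (rule integral_continuous_on_param)
        (auto simp: case_prod_beta intro!: continuous_intros continuous_on_compose2[OF K] continuous_on_compose2[OF F])
    then have "continuous_on (ball x0 1) (mollify K F)"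
      using mollify_eq_integral_cbox[OF K F supp sub]
      by (subst continuous_on_cong[OF refl]) auto
    then show ?thesis by (simp add: continuous_on_eq_continuous_at)
  qed
  then show ?thesis by (simp add: continuous_at_imp_continuous_on)
qed

text \<open>The derivative falls on the kernel, so F need only be continuous. One box contains the
  shifted supports for all |s| < 1, and Leibniz' rule applies on it.\<close>

lemma mollify_has_vector_derivative:
  fixes F :: "'a::euclidean_space \<Rightarrow> 'b::euclidean_space"
  assumes K: "continuous_on UNIV K" and K': "continuous_on UNIV K'" and F: "continuous_on UNIV F"
    and supp: "\<And>z. K z \<noteq> 0 \<Longrightarrow> norm z \<le> r" "\<And>z. K' z \<noteq> 0 \<Longrightarrow>
        norm z \<le> r"
    and der: "\<And>z. ((\<lambda>s. K (z + s *\<^sub>R v)) has_real_derivative K' z) (at 0)"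
  shows "((\<lambda>s. mollify K F (x + s *\<^sub>R v)) has_vector_derivative mollify K' F x) (at 0)"
proof -
  \<comment> \<open>The hypothesis concerns parameter 0 but every base point, so shifting the base
    point gives every parameter s.\<close>
  have der': "((\<lambda>s. K (z + s *\<^sub>R v)) has_real_derivative K' (z + s *\<^sub>R v)) (at s)" for z s
    using der[of "z + s *\<^sub>R v"] DERIV_shift[of "\<lambda>s. K (z + s *\<^sub>R v)" _ 0 s]
    by (simp add: algebra_simps)
  obtain a b where ab: "cball x (\<bar>r\<bar> + norm v) \<subseteq> cbox a b"
    using bounded_subset_cbox_symmetric[OF bounded_cball] by metis
  have sub: "cball (x + s *\<^sub>R v) r \<subseteq> cbox a b" if "s \<in> ball 0 1" for s
  proof -
    have "cball (x + s *\<^sub>R v) r \<subseteq> cball x (\<bar>r\<bar> + norm v)"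
    proof
      fix y assume y: "y \<in> cball (x + s *\<^sub>R v) r"
      have "dist x (x + s *\<^sub>R v) \<le> norm v"
        using that by (simp add: dist_norm mult_left_le_one_le)
      then show "y \<in> cball x (\<bar>r\<bar> + norm v)"
        using y dist_triangle[of x y "x + s *\<^sub>R v"] by auto
    qed
    then show ?thesis using ab by blast
  qed
  have "((\<lambda>s. integral (cbox a b) (\<lambda>y. K (x + s *\<^sub>R v - y) *\<^sub>R F y)) has_vector_derivative
     integral (cbox a b) (\<lambda>y. K' (x + 0 *\<^sub>R v - y) *\<^sub>R F y)) (at 0 within ball 0 1)"
  proof (rule leibniz_rule_vector_derivative)
    fix s :: real and y
    have "((\<lambda>s. K (x - y + s *\<^sub>R v)) has_real_derivative K' (x - y
        + s *\<^sub>R v)) (at s within ball 0 1)"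
      using der' by (rule has_field_derivative_at_within)
    then have "((\<lambda>s. K (x + s *\<^sub>R v - y)) has_real_derivative K' (x
        + s *\<^sub>R v - y)) (at s within ball 0 1)"
      by (simp add: algebra_simps)
    then show "((\<lambda>s. K (x + s *\<^sub>R v - y) *\<^sub>R F y) has_vector_derivative K' (x
        + s *\<^sub>R v - y) *\<^sub>R F y)
        (at s within ball 0 1)"
      by (auto intro!: derivative_eq_intros simp: has_vector_derivative_def has_field_derivative_def
          mult.commute)
  next
    fix s :: real
    show "(\<lambda>y. K (x + s *\<^sub>R v - y) *\<^sub>R F y) integrable_on cbox a b"
      by (intro integrable_continuous continuous_intros continuous_on_compose2[OF K]
          continuous_on_subset[OF F]) auto
  next
    show "continuous_on (ball 0 1 \<times> cbox a b) (\<lambda>(s, y). K' (x + s *\<^sub>R v - y) *\<^sub>R F y)"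
      by (auto simp: case_prod_beta intro!: continuous_intros continuous_on_compose2[OF K'] continuous_on_compose2[OF F])
  qed auto
  then have *: "((\<lambda>s. integral (cbox a b) (\<lambda>y. K (x
      + s *\<^sub>R v - y) *\<^sub>R F y)) has_vector_derivative
     integral (cbox a b) (\<lambda>y. K' (x - y) *\<^sub>R F y)) (at 0)"
    by (simp add: at_within_open[of 0 "ball 0 1"])
  have "mollify K' F x = integral (cbox a b) (\<lambda>y. K' (x - y) *\<^sub>R F y)"
    using sub[of 0] by (intro mollify_eq_integral_cbox[OF K' F supp(2)]) auto
  moreover have "mollify K F (x + s *\<^sub>R v) = integral (cbox a b) (\<lambda>y. K (x
      + s *\<^sub>R v - y) *\<^sub>R F y)"
    if "s \<in> ball 0 1" for s
    by (intro mollify_eq_integral_cbox[OF K F supp(1) sub[OF that]])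
  ultimately show ?thesis
    using has_vector_derivative_transform_within_open[OF *, of "ball 0 1" "\<lambda>s. mollify K F (x + s *\<^sub>R v)"]
    by simp
qed

lemma has_derivative_imp_directional:
  fixes K :: "real^'n::finite \<Rightarrow> real"
  assumes "(K has_derivative (\<lambda>h. \<Sum>j\<in>UNIV. h $ j * K1 j x)) (at x)"
  shows "((\<lambda>s. K (x + s *\<^sub>R v)) has_real_derivative (\<Sum>j\<in>UNIV. v $ j * K1 j x)) (at 0)"
proof -
  have "((\<lambda>s. K (x + s *\<^sub>R v)) has_derivative (\<lambda>s. \<Sum>j\<in>UNIV. (s *\<^sub>R v) $ j
      * K1 j x)) (at 0)"
  proof (rule has_derivative_compose[of "\<lambda>s. x + s *\<^sub>R v" "\<lambda>s. s *\<^sub>R v"])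
    show "((\<lambda>s. x + s *\<^sub>R v) has_derivative (\<lambda>s. s *\<^sub>R v)) (at 0)"
      by (auto intro!: derivative_eq_intros)
  qed (use assms in simp)
  moreover have "(\<lambda>s. \<Sum>j\<in>UNIV. (s *\<^sub>R v) $ j * K1 j x) = (*) (\<Sum>j\<in>UNIV. v $ j * K1 j x)"
    by (simp add: fun_eq_iff sum_distrib_left mult_ac)
  ultimately show ?thesis
    by (simp only: has_field_derivative_def)
qed

section \<open>Weak derivatives\<close>

text \<open>A borel version of the weak derivative, so that Tonelli's theorem applies to it.\<close>

definition borel_weak_derivative :: "(real^'n::finite \<Rightarrow> real^'n) \<Rightarrow> (real^'n \<Rightarrow> real^'n^'n) \<Rightarrow> bool" where
  "borel_weak_derivative f D \<longleftrightarrow> continuous_on UNIV f \<and> D \<in> borel_measurable borel \<and>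
     (\<forall>C. compact C \<longrightarrow> set_integrable lborel C D) \<and>
     (\<forall>\<phi> i j. test_function UNIV \<phi> \<longrightarrow>
        (\<integral>x. f x $ i * partial_deriv j \<phi> x \<partial>lborel) = - (\<integral>x. D x $ i $ j * \<phi> x \<partial>lborel))"

text \<open>The function y -> K (x - y) is an admissible test function, and the minus sign from
  differentiating it in y cancels the one from integration by parts.\<close>

lemma mollify_borel_weak_derivative:
  fixes f :: "real^'n::finite \<Rightarrow> real^'n"
  assumes wd: "borel_weak_derivative f D"
    and K: "continuous_on UNIV K" "\<And>j. continuous_on UNIV (K1 j)"
    and supp: "\<And>z. K z \<noteq> 0 \<Longrightarrow> norm z \<le> r" "\<And>z j. K1 j z \<noteq> 0 \<Longrightarrow>
        norm z \<le> r"
    and der: "\<And>x. (K has_derivative (\<lambda>h. \<Sum>j\<in>UNIV. h $ j * K1 j x)) (at x)"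
    and test: "\<And>x. test_function UNIV (\<lambda>y. K (x - y))"
  shows "mollify K D x $ i $ j = mollify (K1 j) f x $ i"
proof -
  have f: "continuous_on UNIV f" and [measurable]: "D \<in> borel_measurable borel"
    and D: "\<And>C. compact C \<Longrightarrow> set_integrable lborel C D"
    using wd by (auto simp: borel_weak_derivative_def)
  have [measurable]: "f \<in> borel_measurable borel" using f by (rule borel_measurable_continuous_onI)
  have iD: "integrable lborel (\<lambda>y. K (x - y) *\<^sub>R D y)"
    by (rule integrable_mollify[OF K(1) supp(1)]) (auto intro: D)
  have if': "integrable lborel (\<lambda>y. K1 j (x - y) *\<^sub>R f y)"
    by (rule integrable_mollify[OF K(2) supp(2)]) (auto intro: set_integrable_continuous f)
  have pd: "partial_deriv j (\<lambda>y. K (x - y)) y = - K1 j (x - y)" for y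
  proof (rule partial_deriv_eq[of _ "\<lambda>j. - K1 j (x - y)"])
    have "((\<lambda>y. K (x - y)) has_derivative (\<lambda>h. \<Sum>j\<in>UNIV. (- h) $ j * K1 j (x - y))) (at y)"
      by (rule has_derivative_compose[of "\<lambda>y. x - y" "\<lambda>h. - h", OF _ der])
        (auto intro!: derivative_eq_intros)
    then show "((\<lambda>y. K (x - y)) has_derivative (\<lambda>h. \<Sum>j\<in>UNIV. h $ j * - K1 j (x - y))) (at y)"
      by simp
  qed
  have "mollify K D x $ i $ j = (\<integral>y. (K (x - y) *\<^sub>R D y) $ i $ j \<partial>lborel)"
    unfolding mollify_def
    by (rule integral_bounded_linear[OF bounded_linear_compose[OF bounded_linear_vec_nth bounded_linear_vec_nth] iD, symmetric])
  also have "\<dots> = (\<integral>y. D y $ i $ j * K (x - y) \<partial>lborel)" by (simp add: mult.commute)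
  also have "\<dots> = - (\<integral>y. f y $ i * partial_deriv j (\<lambda>y. K (x - y)) y \<partial>lborel)"
    using wd test unfolding borel_weak_derivative_def by simp
  also have "\<dots> = (\<integral>y. (K1 j (x - y) *\<^sub>R f y) $ i \<partial>lborel)"
    by (simp add: pd mult.commute)
  also have "\<dots> = mollify (K1 j) f x $ i"
    unfolding mollify_def by (rule integral_bounded_linear[OF bounded_linear_vec_nth if'])
  finally show ?thesis .
qed

lemma mollify_uniformly_close:
  fixes f :: "'a::euclidean_space \<Rightarrow> 'b::euclidean_space"
  assumes f: "continuous_on UNIV f" and Q: "compact Q" and e: "0 < e"
  obtains d where "0 < d"
    "\<And>K x. mollifier d K \<Longrightarrow> x \<in> Q \<Longrightarrow> norm (mollify K f x - f x) \<le> e"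
proof -
  obtain R where R: "\<forall>x\<in>Q. norm x \<le> R" using compact_imp_bounded[OF Q] bounded_iff by blast
  have "uniformly_continuous_on (cball 0 (R + 1)) f"
    by (intro compact_uniformly_continuous continuous_on_subset[OF f]) auto
  then obtain d0 where d0: "0 < d0" "\<And>x y. x \<in> cball 0 (R + 1) \<Longrightarrow>
      y \<in> cball 0 (R + 1) \<Longrightarrow>
      dist y x < d0 \<Longrightarrow> dist (f y) (f x) < e"
    unfolding uniformly_continuous_on_def using e by metis
  have [measurable]: "f \<in> borel_measurable borel" using f by (rule borel_measurable_continuous_onI)
  show ?thesis
  proof (rule that[of "min d0 1"])
    fix K :: "'a \<Rightarrow> real" and x
    assume moll: "mollifier (min d0 1) K" and x: "x \<in> Q"
    note K = mollifierD[OF moll]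
    have [measurable]: "K \<in> borel_measurable borel" by (rule K)
    have md: "mollify K f x - f x = (\<integral>y. K (x - y) *\<^sub>R (f y - f x) \<partial>lborel)"
      by (rule mollify_diff[OF \<open>f \<in> borel_measurable borel\<close> set_integrable_continuous[OF f] moll])
    have "ennreal (norm (mollify K f x - f x) ^ 1)
        \<le> (\<integral>\<^sup>+y. ennreal (K (x - y) * norm (f y - f x) ^ 1) \<partial>lborel)"
      unfolding md using K(2) K(6)[of x] by (intro jensen_norm_power) auto
    also have "\<dots> \<le> (\<integral>\<^sup>+y. ennreal (K (x - y)) * ennreal e \<partial>lborel)"
    proof (rule nn_integral_mono)
      fix y
      have "K (x - y) * norm (f y - f x) ^ 1 \<le> K (x - y) * e"
      proof (cases "K (x - y) = 0")
        case False
        have xy: "norm (x - y) < d0" "norm (x - y) < 1" using K(4)[OF False] by auto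
        have "norm y \<le> norm x + norm (x - y)" using norm_triangle_ineq4[of x "x - y"] by simp
        then have "norm y \<le> R + 1" "norm x \<le> R + 1" using R x xy by force+
        then have "dist (f y) (f x) < e" using d0(2)[of x y] xy by (simp add: dist_norm norm_minus_commute)
        then show ?thesis using K(2) by (intro mult_left_mono) (auto simp: dist_norm)
      qed simp
      then show "ennreal (K (x - y) * norm (f y - f x) ^ 1) \<le> ennreal (K (x - y)) * ennreal e"
        using K(2) e by (subst ennreal_mult[symmetric]) (auto intro!: ennreal_leI)
    qed
    also have "\<dots> = ennreal e" using K(6)[of x] by (simp add: nn_integral_multc)
    finally show "norm (mollify K f x - f x) \<le> e" using e by simp
  qed (use d0 in auto)
qed

lemma mollify_mult_kernel:
  "mollify (\<lambda>x. a * K x) g = (\<lambda>x. a *\<^sub>R mollify K g x)"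
  by (rule ext) (simp only: mollify_def scaleR_scaleR[symmetric] integral_scaleR_right)

lemma mollify_sum_kernel:
  fixes f :: "'a::euclidean_space \<Rightarrow> 'b::euclidean_space"
  assumes f: "continuous_on UNIV f" and K: "\<And>j. continuous_on UNIV (K j)"
    and supp: "\<And>j z. K j z \<noteq> 0 \<Longrightarrow> norm z \<le> r" and J: "finite J"
  shows "mollify (\<lambda>x. \<Sum>j\<in>J. v j * K j x) f x = (\<Sum>j\<in>J. v j *\<^sub>R mollify (K j) f x)"
proof -
  have [measurable]: "f \<in> borel_measurable borel" using f by (rule borel_measurable_continuous_onI)
  have "integrable lborel (\<lambda>y. K j (x - y) *\<^sub>R f y)" for j
    by (rule integrable_mollify[OF K supp]) (auto intro: set_integrable_continuous f)
  then show ?thesis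
    unfolding mollify_def scaleR_sum_left scaleR_scaleR[symmetric]
    by (subst Bochner_Integration.integral_sum) (auto simp del: scaleR_scaleR)
qed

text \<open>The last clause ranges over all pairs \<open>f\<close> and \<open>D\<close>, so that one
  kernel can be applied to two weak derivatives of the same map when uniqueness is proved.\<close>

lemma normalized_mollifier_exists:
  assumes d: "0 < d"
  obtains K :: "real^'n::finite \<Rightarrow> real" and K1 K2 where
    "mollifier d K" "\<And>j. continuous_on UNIV (K1 j)" "\<And>i j. continuous_on UNIV (K2 i j)"
    "\<And>x j. K1 j x \<noteq> 0 \<Longrightarrow> norm x < d"
    "\<And>x i j. K2 i j x \<noteq> 0 \<Longrightarrow> norm x < d"
    "\<And>x v. ((\<lambda>s. K (x + s *\<^sub>R v)) has_real_derivative (\<Sum>j\<in>UNIV. v $ j * K1 j x)) (at 0)"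
    "\<And>x j v. ((\<lambda>s. K1 j (x + s *\<^sub>R v)) has_real_derivative (\<Sum>k\<in>UNIV. v $ k
        * K2 j k x)) (at 0)"
    "\<And>j k. K2 j k = K2 k j"
    "\<And>f D x i j. borel_weak_derivative f D \<Longrightarrow> mollify K D x $ i $ j = mollify (K1 j) f x $ i"
proof -
  \<comment> \<open>If all coordinates are at most \<epsilon> in absolute value, the sum of their
    absolute values is at most d / 2, so the norm is below d.\<close>
  define \<epsilon> where "\<epsilon> = d / (2 * CARD('n))"
  have \<epsilon>: "0 < \<epsilon>" using d by (simp add: \<epsilon>_def)
  obtain K :: "real^'n \<Rightarrow> real" and K1 K2 where
    c: "continuous_on UNIV K" "\<And>j. continuous_on UNIV (K1 j)" "\<And>i j. continuous_on UNIV (K2 i j)" and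
    p: "\<And>x. 0 \<le> K x" "0 < K 0" and
    s: "\<And>x i. K x \<noteq> 0 \<Longrightarrow> \<bar>x $ i\<bar>
        \<le> \<epsilon>" "\<And>x i j. K1 j x \<noteq> 0 \<Longrightarrow> \<bar>x $ i\<bar> \<le> \<epsilon>" and
    d1: "\<And>x. (K has_derivative (\<lambda>h. \<Sum>j\<in>UNIV. h $ j * K1 j x)) (at x)" and
    d2: "\<And>x j. (K1 j has_derivative (\<lambda>h. \<Sum>k\<in>UNIV. h $ k * K2 j k x)) (at x)" and
    sym: "\<And>j k. K2 j k = K2 k j" and
    test: "\<And>x. test_function UNIV (\<lambda>y. K (x - y))"
    by (rule mollifier_exists[OF \<epsilon>]) blast
  have small: "norm x < d" if "\<And>i. \<bar>x $ i\<bar> \<le> \<epsilon>" for x :: "real^'n"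
  proof -
    have "norm x \<le> (\<Sum>i\<in>UNIV. \<bar>x $ i\<bar>)" by (rule norm_le_l1_cart)
    also have "\<dots> \<le> (\<Sum>i\<in>(UNIV::'n set). \<epsilon>)" by (intro sum_mono that)
    also have "\<dots> = d / 2" by (simp add: \<epsilon>_def)
    finally show ?thesis using d by simp
  qed
  \<comment> \<open>Outside the ball some coordinate exceeds \<epsilon>; there \<open>K1 j\<close>
    vanishes on a whole neighbourhood, and so do its derivatives.\<close>
  have s2: "K2 j k x = 0" if far: "\<not> norm x < d" for j k x
  proof -
    obtain i where i: "\<epsilon> < \<bar>x $ i\<bar>"
    proof (rule ccontr)
      assume "\<not> thesis"
      then have "\<bar>x $ i\<bar> \<le> \<epsilon>" for i using that by (meson not_less)
      from small[OF this] far show False by simp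
    qed
    have "open {y :: real^'n. \<epsilon> < \<bar>y $ i\<bar>}" by (intro open_Collect_less continuous_intros)
    moreover have "K1 j y = 0" if "y \<in> {y. \<epsilon> < \<bar>y $ i\<bar>}" for y using s(2)[of j y i] that by force
    ultimately have "((\<lambda>_. 0) has_derivative (\<lambda>h. \<Sum>k\<in>UNIV. h $ k * K2 j k x)) (at x)"
      using i has_derivative_transform_within_open[OF d2[of j x]] by (metis (no_types, lifting) mem_Collect_eq)
    then have "(\<lambda>h. \<Sum>k\<in>UNIV. h $ k * K2 j k x) = (\<lambda>h. 0)"
      using has_derivative_unique has_derivative_const by blast
    then have "(\<Sum>l\<in>UNIV. axis k 1 $ l * K2 j l x) = 0" by metis
    then show ?thesis by (simp add: axis_def if_distrib[of "\<lambda>c. c * _"] cong: if_cong)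
  qed
  have [measurable]: "K \<in> borel_measurable borel" using c(1) by (rule borel_measurable_continuous_onI)
  have "set_integrable lborel (cball 0 d :: (real^'n) set) (\<lambda>_. 1 :: real)"
    unfolding set_integrable_def by (intro borel_integrable_compact) auto
  then have iK: "integrable lborel K"
    using integrable_continuous_scaleR[of K "cball 0 d" "\<lambda>_. 1 :: real"] c(1) s(1) small
    by (auto simp: less_imp_le)
  define a where "a = (\<integral>x. K x \<partial>lborel)"
  have a: "ennreal a = (\<integral>\<^sup>+x. ennreal (K x) \<partial>lborel)"
    unfolding a_def using nn_integral_eq_integral[OF iK] p by simp
  \<comment> \<open>With mass 0 the set where K is positive would be null, but it is open and
    contains the origin.\<close>
  have "0 < a"
  proof (rule ccontr)
    assume "\<not> 0 < a"
    then have "(\<integral>\<^sup>+x. ennreal (K x) \<partial>lborel) = 0" using a by (simp add: ennreal_neg)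
    then have "AE x in lborel. ennreal (K x) = 0" by (subst (asm) nn_integral_0_iff_AE) auto
    then have "AE x in lborel. x \<notin> {x. 0 < K x}" by eventually_elim (use p in force)
    moreover have op: "open {x. 0 < K x}"
      using c(1) by (intro open_Collect_less continuous_intros) auto
    ultimately have "{x. 0 < K x} \<in> null_sets lborel" by (subst AE_iff_null_sets) auto
    then have "negligible {x. 0 < K x}"
      using negligible_iff_null_sets null_sets_completionI by blast
    then show False using open_not_negligible[OF op] p(2) by blast
  qed
  show ?thesis
  proof (rule that[of "\<lambda>x. 1 / a * K x" "\<lambda>j x. 1 / a * K1 j x" "\<lambda>i j x. 1 / a * K2 i j x"])
    show "mollifier d (\<lambda>x. 1 / a * K x)"
    proof -
      have "(\<integral>\<^sup>+x. ennreal (1 / a * K x) \<partial>lborel)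
          = (\<integral>\<^sup>+x. ennreal (1 / a) * ennreal (K x) \<partial>lborel)"
        using \<open>0 < a\<close> p(1) by (intro nn_integral_cong ennreal_mult) auto
      also have "\<dots> = ennreal (1 / a) * ennreal a" by (subst nn_integral_cmult) (auto simp: a)
      also have "\<dots> = 1" using \<open>0 < a\<close> by (subst ennreal_mult[symmetric]) auto
      finally show ?thesis
        using c(1) p(1) s(1) small \<open>0 < a\<close> by (auto simp: mollifier_def intro!: continuous_intros)
    qed
    show "((\<lambda>s. 1 / a * K (x + s *\<^sub>R v)) has_real_derivative (\<Sum>j\<in>UNIV. v $ j * (1 / a
        * K1 j x))) (at 0)" for x v
      using DERIV_cmult[OF has_derivative_imp_directional[of K K1 x v, OF d1[of x]], of "1 / a"]
      by (simp add: sum_distrib_left mult_ac)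
    show "((\<lambda>s. 1 / a * K1 j (x + s *\<^sub>R v)) has_real_derivative (\<Sum>k\<in>UNIV. v $ k * (1 / a
        * K2 j k x))) (at 0)" for x j v
      using DERIV_cmult[OF has_derivative_imp_directional[of "K1 j" "K2 j" x v, OF d2[of j x]], of "1 / a"]
      by (simp add: sum_distrib_left mult_ac)
    show "mollify (\<lambda>x. 1 / a * K x) D x $ i $ j = mollify (\<lambda>x. 1 / a * K1 j x) f x $ i"
      if "borel_weak_derivative f D" for f D x i j
      unfolding mollify_mult_kernel
      using mollify_borel_weak_derivative[where r = d, OF that c(1,2) _ _ d1 test] s small
      by (simp add: less_imp_le)
    show "norm x < d" if "1 / a * K2 i j x \<noteq> 0" for x i j
      using s2[of x i j] that by (cases "norm x < d") auto
  qed (use c p \<open>0 < a\<close> s small sym in \<open>auto intro!: continuous_intros\<close>)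
qed

text \<open>\<open>G\<close> has two descriptions. As the mollified \<open>D\<close> it is close to
  \<open>D\<close> in mean; as the convolution of \<open>f\<close> with the gradient of the kernel
  it is the classical derivative of \<open>g\<close> and can be differentiated once more. Symmetry
  of \<open>H\<close> is inherited from the kernel.\<close>

lemma smooth_approximation:
  fixes f :: "real^'n::finite \<Rightarrow> real^'n"
  assumes wd: "borel_weak_derivative f D"
    and int: "\<And>C. compact C \<Longrightarrow> set_integrable lborel C (\<lambda>x. norm (D x) ^ Suc m)"
    and Q: "compact Q" and e: "0 < e"
  obtains g :: "real^'n \<Rightarrow> real^'n" and G :: "real^'n \<Rightarrow> real^'n^'n" and H where
    "continuous_on UNIV g" "continuous_on UNIV G" "\<And>i j k. continuous_on UNIV (H i j k)"
    "\<And>x. x \<in> Q \<Longrightarrow> norm (g x - f x) \<le> e"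
    "pintegral (Suc m) Q (\<lambda>x. G x - D x) \<le> ennreal e"
    "\<And>x v. ((\<lambda>s. g (x + s *\<^sub>R v)) has_vector_derivative G x *v v) (at 0)"
    "\<And>x i j k. ((\<lambda>s. G (x + s *\<^sub>R axis k 1) $ i $ j) has_real_derivative H i j k x) (at 0)"
    "\<And>i j k. H i j k = H i k j"
proof -
  have f: "continuous_on UNIV f" and D: "D \<in> borel_measurable borel" "\<And>C. compact C \<Longrightarrow>
      set_integrable lborel C D"
    using wd by (auto simp: borel_weak_derivative_def)
  obtain d1 where d1: "0 < d1"
    "\<And>K x. mollifier d1 K \<Longrightarrow> x \<in> Q \<Longrightarrow> norm (mollify K f x - f x) \<le> e"
    using mollify_uniformly_close[OF f Q e] by blast
  obtain d2 where d2: "0 < d2"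
    "\<And>K. mollifier d2 K \<Longrightarrow> pintegral (Suc m) Q (\<lambda>x. mollify K D x - D x) \<le> ennreal e"
    using mollify_Lp_close[OF D int Q e] by blast
  define d where "d = min d1 d2"
  have d: "0 < d" using d1 d2 by (simp add: d_def)
  obtain K :: "real^'n \<Rightarrow> real" and K1 K2 where
    moll: "mollifier d K" and
    c1: "\<And>j. continuous_on UNIV (K1 j)" and c2: "\<And>i j. continuous_on UNIV (K2 i j)" and
    s1: "\<And>x j. K1 j x \<noteq> 0 \<Longrightarrow> norm x < d"
    and s2: "\<And>x i j. K2 i j x \<noteq> 0 \<Longrightarrow> norm x < d" and
    der: "\<And>x v. ((\<lambda>s. K (x + s *\<^sub>R v)) has_real_derivative (\<Sum>j\<in>UNIV. v $ j
        * K1 j x)) (at 0)"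
      "\<And>x j v. ((\<lambda>s. K1 j (x + s *\<^sub>R v)) has_real_derivative (\<Sum>k\<in>UNIV. v $ k
          * K2 j k x)) (at 0)" and
    sym: "\<And>j k. K2 j k = K2 k j" and
    wk: "\<And>f D x i j. borel_weak_derivative f D \<Longrightarrow> mollify K D x $ i $ j = mollify (K1 j) f x $ i"
    by (rule normalized_mollifier_exists[OF d]) blast
  note c = mollifierD(1)[OF moll] c1 c2 and s = mollifierD(4)[OF moll] s1 s2
  define G :: "real^'n \<Rightarrow> real^'n^'n" where "G x = (\<chi> i j. mollify (K1 j) f x $ i)" for x
  define H where "H i j k x = mollify (K2 j k) f x $ i" for i j k x
  have GD: "G x = mollify K D x" for x
    using wk[OF wd] by (simp add: G_def vec_eq_iff)
  have cm: "continuous_on UNIV (mollify L f)" if "continuous_on UNIV L" "\<And>x. L x \<noteq> 0 \<Longrightarrow>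
      norm x < d" for L
    using that by (intro continuous_on_mollify[where r = d] f) (auto simp: less_imp_le)
  show ?thesis
  proof (rule that[of "mollify K f" G H])
    show "continuous_on UNIV (mollify K f)" by (rule cm[OF c(1) s(1)])
    show "continuous_on UNIV G"
      unfolding G_def by (intro continuous_intros cm[OF c(2) s(2)])
    show "continuous_on UNIV (H i j k)" for i j k
      unfolding H_def[abs_def] by (intro continuous_intros cm[OF c(3) s(3)])
    show "norm (mollify K f x - f x) \<le> e" if "x \<in> Q" for x
      using d1(2)[OF mollifier_mono[OF moll] that] by (simp add: d_def)
    show "pintegral (Suc m) Q (\<lambda>x. G x - D x) \<le> ennreal e"
      unfolding GD using d2(2)[OF mollifier_mono[OF moll]] by (simp add: d_def)
    show "((\<lambda>s. mollify K f (x + s *\<^sub>R v)) has_vector_derivative G x *v v) (at 0)" for x v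
    proof -
      have supp: "norm z \<le> d" if "(\<Sum>j\<in>UNIV. v $ j * K1 j z) \<noteq> 0" for z
      proof (rule ccontr)
        assume "\<not> norm z \<le> d"
        then have "K1 j z = 0" for j using s(2)[of j z] by fastforce
        then show False using that by simp
      qed
      have "((\<lambda>s. mollify K f (x + s *\<^sub>R v)) has_vector_derivative
          mollify (\<lambda>z. \<Sum>j\<in>UNIV. v $ j * K1 j z) f x) (at 0)"
        by (rule mollify_has_vector_derivative[where r = d, OF c(1) _ f _ supp der(1)])
          (use c s in \<open>auto intro!: continuous_intros simp: less_imp_le\<close>)
      also have "mollify (\<lambda>z. \<Sum>j\<in>UNIV. v $ j * K1 j z) f x
          = (\<Sum>j\<in>UNIV. v $ j *\<^sub>R mollify (K1 j) f x)"
        by (rule mollify_sum_kernel[where r = d, OF f c(2)]) (use s in \<open>auto simp: less_imp_le\<close>)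
      also have "\<dots> = G x *v v"
        by (simp add: vec_eq_iff G_def matrix_vector_mult_def mult.commute)
      finally show ?thesis .
    qed
    show "((\<lambda>s. G (x + s *\<^sub>R axis k 1) $ i $ j) has_real_derivative H i j k x) (at 0)" for x i j k
    proof -
      have "(\<Sum>l\<in>UNIV. axis k 1 $ l * K2 j l z) = K2 j k z" for z
        by (simp add: axis_def if_distrib[of "\<lambda>c. c * _"] cong: if_cong)
      then have "((\<lambda>s. K1 j (z + s *\<^sub>R axis k 1)) has_real_derivative K2 j k z) (at 0)" for z
        using der(2)[of j z "axis k 1"] by simp
      then have "((\<lambda>s. mollify (K1 j) f (x + s *\<^sub>R axis k 1)) has_vector_derivative mollify (K2 j k) f x) (at 0)"
        by (intro mollify_has_vector_derivative[where r = d, OF c(2) c(3) f]) (use s in \<open>auto simp: less_imp_le\<close>)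
      from bounded_linear.has_vector_derivative[OF bounded_linear_vec_nth this, of i]
      show ?thesis
        by (simp add: G_def H_def has_real_derivative_iff_has_vector_derivative)
    qed
    show "H i j k = H i k j" for i j k
      by (rule ext, unfold H_def, subst sym, rule refl)
  qed
qed

text \<open>The mollification of a weak derivative is determined by \<open>f\<close>. Hence all
  mollifications of the difference vanish, while they converge to the difference in mean on every
  ball.\<close>

lemma borel_weak_derivative_unique:
  fixes f :: "real^'n::finite \<Rightarrow> real^'n"
  assumes D1: "borel_weak_derivative f D1" and D2: "borel_weak_derivative f D2"
  shows "AE x in lborel. D1 x = D2 x"
proof -
  define g where "g x = D1 x - D2 x" for x
  have [measurable]: "D1 \<in> borel_measurable borel" "D2 \<in> borel_measurable borel"
    and sD: "\<And>C. compact C \<Longrightarrow> set_integrable lborel C D1" "\<And>C. compact C \<Longrightarrow>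
        set_integrable lborel C D2"
    using D1 D2 by (auto simp: borel_weak_derivative_def)
  have [measurable]: "g \<in> borel_measurable borel" unfolding g_def by measurable
  have sg: "set_integrable lborel C g" if "compact C" for C
    unfolding g_def by (intro set_integral_diff sD that)
  have sg1: "set_integrable lborel C (\<lambda>x. norm (g x) ^ Suc 0)" if "compact C" for C
    using set_integrable_norm[OF sg[OF that]] by simp
  have *: "AE x in lborel. x \<in> cball 0 (real N) \<longrightarrow> g x = 0" for N
  proof -
    have [measurable]: "cball 0 (real N) \<in> sets (borel :: (real^'n) measure)" by simp
    have eps: "(\<integral>\<^sup>+x. indicator (cball 0 (real N)) x * ennreal (norm (g x)) \<partial>lborel)
        \<le> 0 + ennreal e" if e: "0 < e" for e
    proof -
      obtain d where d: "0 < d" 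
        "\<And>K. mollifier d K \<Longrightarrow> pintegral (Suc 0) (cball 0 (real N)) (\<lambda>x. mollify K g x - g x) \<le> ennreal e"
        using mollify_Lp_close[OF \<open>g \<in> borel_measurable borel\<close> sg sg1 compact_cball e] by blast
      obtain K :: "real^'n \<Rightarrow> real" and K1 where
        moll: "mollifier d K" and
        wk: "\<And>f D x i j. borel_weak_derivative f D \<Longrightarrow> mollify K D x $ i $ j
            = mollify (K1 j) f x $ i"
        by (rule normalized_mollifier_exists[OF d(1)]) blast
      have "mollify K g x = 0" for x
      proof -
        have ig: "integrable lborel (\<lambda>y. K (x - y) *\<^sub>R D y)"
          if "D \<in> borel_measurable borel" "\<And>C. compact C \<Longrightarrow>
              set_integrable lborel C D" for D :: "real^'n \<Rightarrow> real^'n^'n"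
          using mollifierD(4)[OF moll]
          by (intro integrable_mollify[where r = d] mollifierD[OF moll] that) (auto simp: less_imp_le)
        have "mollify K g x = mollify K D1 x - mollify K D2 x"
          unfolding mollify_def g_def scaleR_diff_right
          by (intro Bochner_Integration.integral_diff ig sD) auto
        also have "mollify K D1 x = mollify K D2 x"
          using wk[OF D1] wk[OF D2] by (simp add: vec_eq_iff)
        finally show ?thesis by simp
      qed
      then show ?thesis using d(2)[OF moll] by simp
    qed
    have "(\<integral>\<^sup>+x. indicator (cball 0 (real N)) x * ennreal (norm (g x)) \<partial>lborel) \<le> 0"
      by (rule ennreal_le_epsilon, rule eps)
    then have "AE x in lborel. indicator (cball 0 (real N)) x * ennreal (norm (g x)) = 0"
      by (subst (asm) le_zero_eq, subst (asm) nn_integral_0_iff_AE) auto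
    then show ?thesis by eventually_elim (auto simp: indicator_def split: if_splits)
  qed
  then have "AE x in lborel. \<forall>N. x \<in> cball 0 (real N) \<longrightarrow> g x = 0"
    unfolding AE_all_countable by blast
  then show ?thesis
  proof eventually_elim
    case (elim x)
    obtain N where "norm x \<le> real N" using real_arch_simple by blast
    then show ?case using elim by (auto simp: g_def)
  qed
qed

lemma borel_version_of_lebesgue_measurable:
  fixes D :: "real^'n::finite \<Rightarrow> real^'n^'n"
  assumes D: "D \<in> borel_measurable lebesgue"
  obtains D' where "D' \<in> borel_measurable borel" "AE x in lebesgue. D x = D' x"
proof -
  have "(\<lambda>x. D x $ i $ j) \<in> borel_measurable lebesgue" for i j
    using D by (intro borel_measurable_continuous_on[where f = "\<lambda>A. A $ i $ j"] continuous_intros) auto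
  then have ex: "\<exists>g. g \<in> borel_measurable lborel \<and> (AE x in lborel. D x $ i $ j = g x)" for i j
    using completion_ex_borel_measurable_real[of "\<lambda>x. D x $ i $ j" lborel] by blast
  define g where "g i j = (SOME g. g \<in> borel_measurable lborel \<and> (AE x in lborel. D x $ i $ j = g x))" for i j
  have g: "g i j \<in> borel_measurable lborel" "AE x in lborel. D x $ i $ j = g i j x" for i j
    using someI_ex[OF ex[of i j]] unfolding g_def by blast+
  define D' :: "real^'n \<Rightarrow> real^'n^'n" where "D' x = (\<chi> i j. g i j x)" for x
  have "D' \<in> borel_measurable borel"
    by (subst borel_measurable_euclidean_space) (use g(1) in \<open>auto simp: Basis_vec_def inner_axis D'_def\<close>)
  moreover have "AE x in lborel. \<forall>i j. D x $ i $ j = g i j x"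
    using g(2) by (simp add: AE_all_countable)
  then have "AE x in lborel. D x = D' x"
    by eventually_elim (simp add: D'_def vec_eq_iff)
  then have "AE x in lebesgue. D x = D' x" by (rule AE_completion)
  ultimately show ?thesis using that by blast
qed

lemma set_integrable_of_Lp_loc:
  fixes D :: "real^'n::finite \<Rightarrow> 'b::euclidean_space"
  assumes D: "Lp_loc (real p) UNIV D" and p: "0 < p"
    and [measurable]: "D' \<in> borel_measurable borel" and ae: "AE x in lebesgue. D x = D' x"
    and C: "compact C"
  shows "set_integrable lborel C (\<lambda>x. norm (D' x) ^ p)"
proof -
  have [measurable]: "C \<in> sets borel" "C \<in> sets lebesgue" using C by (auto simp: borel_compact)
  have [measurable]: "D \<in> borel_measurable lebesgue" "D' \<in> borel_measurable lebesgue"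
    using D by (auto simp: Lp_loc_def measurable_completion)
  have "integrable (lebesgue_on C) (\<lambda>x. norm (D x) powr real p)"
    using D C by (simp add: Lp_loc_def)
  then have "integrable lebesgue (\<lambda>x. indicator C x *\<^sub>R (norm (D x) powr real p))"
    by (subst (asm) integrable_restrict_space) auto
  also have "?this \<longleftrightarrow> integrable lebesgue (\<lambda>x. indicator C x *\<^sub>R (norm (D' x) ^ p))"
  proof (rule integrable_cong_AE)
    show "AE x in lebesgue. indicator C x *\<^sub>R (norm (D x) powr real p)
        = indicator C x *\<^sub>R (norm (D' x) ^ p)"
      using ae
    proof eventually_elim
      case (elim x)
      \<comment> \<open>At zeros of \<open>D'\<close> both \<open>0 powr p\<close> and
        \<open>0 ^ p\<close> are 0 because p > 0.\<close>
      then show ?case using p by (cases "D' x = 0") (auto simp: powr_realpow)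
    qed
  qed auto
  also have "\<dots> \<longleftrightarrow> integrable lborel (\<lambda>x. indicator C x *\<^sub>R (norm (D' x) ^ p))"
    by (rule integrable_completion) simp
  finally show ?thesis by (simp add: set_integrable_def)
qed

lemma borel_weak_derivative_of_weak_derivative:
  fixes f :: "real^'n::finite \<Rightarrow> real^'n"
  assumes f: "continuous_on UNIV f" and wd: "weak_derivative UNIV f D"
    and D'[measurable]: "D' \<in> borel_measurable borel" and ae: "AE x in lebesgue. D x = D' x"
  shows "borel_weak_derivative f D'"
  unfolding borel_weak_derivative_def
proof (intro conjI allI impI)
  have [measurable]: "f \<in> borel_measurable borel" using f by (rule borel_measurable_continuous_onI)
  have [measurable]: "D \<in> borel_measurable lebesgue" "D' \<in> borel_measurable lebesgue"
    using wd by (auto simp: Lp_loc_def weak_derivative_def measurable_completion)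
  show "set_integrable lborel C D'" if "compact C" for C
  proof -
    have "Lp_loc (real 1) UNIV D" using wd by (simp add: weak_derivative_def)
    from set_integrable_of_Lp_loc[OF this _ D' ae that]
    have "set_integrable lborel C (\<lambda>x. norm (D' x))" by simp
    moreover have [measurable]: "C \<in> sets borel" using that by (rule borel_compact)
    ultimately show ?thesis
      unfolding set_integrable_def
      by (elim Bochner_Integration.integrable_bound) (simp, auto simp: indicator_def)
  qed
  show "(\<integral>x. f x $ i * partial_deriv j \<phi> x \<partial>lborel)
      = - (\<integral>x. D' x $ i $ j * \<phi> x \<partial>lborel)"
    if \<phi>: "test_function UNIV \<phi>" for \<phi> i j
  proof -
    have c: "Ck k \<phi>" for k using \<phi> by (simp add: test_function_def)
    have c0: "continuous_on UNIV \<phi>" using c[of 0] by simp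
    have c1: "continuous_on UNIV (partial_deriv j \<phi>)" using c[of 1] by simp
    have [measurable]: "\<phi> \<in> borel_measurable borel" "partial_deriv j \<phi> \<in> borel_measurable borel"
      using c0 c1 by (auto intro: borel_measurable_continuous_onI)
    have comp: "(\<lambda>x. A x $ i $ j) \<in> borel_measurable M" if "A \<in> borel_measurable M"
      for A :: "real^'n \<Rightarrow> real^'n^'n" and M
      using that by (intro borel_measurable_continuous_on[where f = "\<lambda>A. A $ i $ j"] continuous_intros) auto
    have [measurable]: "(\<lambda>x. f x $ i) \<in> borel_measurable borel"
      by (intro borel_measurable_continuous_onI continuous_intros f)
    have [measurable]: "(\<lambda>x. D' x $ i $ j) \<in> borel_measurable borel"
      "(\<lambda>x. D' x $ i $ j) \<in> borel_measurable lebesgue" "(\<lambda>x. D x $ i $ j) \<in> borel_measurable lebesgue"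
      by (intro comp; simp)+
    have [measurable]: "\<phi> \<in> borel_measurable lebesgue" by (simp add: measurable_completion)
    have "(\<integral>x. f x $ i * partial_deriv j \<phi> x \<partial>lborel)
        = (\<integral>x. f x $ i * partial_deriv j \<phi> x \<partial>lebesgue)"
      by (rule integral_completion[symmetric]) simp
    also have "\<dots> = - (\<integral>x. D x $ i $ j * \<phi> x \<partial>lebesgue)"
      using wd \<phi> by (simp add: weak_derivative_def lebesgue_on_UNIV_eq)
    also have "(\<integral>x. D x $ i $ j * \<phi> x \<partial>lebesgue)
        = (\<integral>x. D' x $ i $ j * \<phi> x \<partial>lebesgue)"
      by (rule integral_cong_AE) (use ae in auto)
    also have "\<dots> = (\<integral>x. D' x $ i $ j * \<phi> x \<partial>lborel)"
      by (rule integral_completion) simp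
    finally show ?thesis .
  qed
qed (use f D' in auto)

section \<open>The Jacobian as a null Lagrangian\<close>

lemma integral_lborel_reflect:
  fixes f :: "'a::euclidean_space \<Rightarrow> 'b::{banach, second_countable_topology}"
  assumes [measurable]: "f \<in> borel_measurable borel"
  shows "(\<integral>x. f (t - x) \<partial>lborel) = (\<integral>x. f x \<partial>lborel)"
proof -
  have "(lborel :: 'a measure) = distr lborel borel (\<lambda>x. t - x)"
    using lborel_affine[of "-1" t] by (simp add: density_1)
  then have "(\<integral>x. f x \<partial>lborel) = (\<integral>x. f x \<partial>distr lborel borel (\<lambda>x. t - x))" by simp
  also have "\<dots> = (\<integral>x. f (t - x) \<partial>lborel)" by (rule integral_distr) auto
  finally show ?thesis by simp
qed

text \<open>The convolution of \<open>h\<close> with the constant \<open>1\<close> is constant, and its derivative is the integral of \<open>h'\<close>.\<close>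

lemma integral_directional_derivative_eq_0:
  fixes h :: "'a::euclidean_space \<Rightarrow> real"
  assumes h: "continuous_on UNIV h" "continuous_on UNIV h'"
    and supp: "\<And>x. h x \<noteq> 0 \<Longrightarrow> norm x \<le> r" "\<And>x. h' x \<noteq> 0 \<Longrightarrow>
        norm x \<le> r"
    and der: "\<And>x. ((\<lambda>s. h (x + s *\<^sub>R v)) has_real_derivative h' x) (at 0)"
  shows "(\<integral>x. h' x \<partial>lborel) = 0"
proof -
  have [measurable]: "h \<in> borel_measurable borel" "h' \<in> borel_measurable borel"
    using h by (auto intro: borel_measurable_continuous_onI)
  have m: "mollify h (\<lambda>_. 1 :: real) x = (\<integral>y. h y \<partial>lborel)" for x
    unfolding mollify_def using integral_lborel_reflect[of h x] by simp
  have m': "mollify h' (\<lambda>_. 1 :: real) 0 = (\<integral>y. h' y \<partial>lborel)"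
    unfolding mollify_def using integral_lborel_reflect[of h' 0] by simp
  have "((\<lambda>s. mollify h (\<lambda>_. 1 :: real) (0 + s *\<^sub>R v)) has_vector_derivative mollify h' (\<lambda>_. 1) 0) (at 0)"
    by (rule mollify_has_vector_derivative[OF h _ supp der]) auto
  then have "((\<lambda>s :: real. \<integral>y. h y \<partial>lborel) has_vector_derivative (\<integral>y. h' y \<partial>lborel)) (at 0)"
    by (simp only: m m')
  then show ?thesis
    using vector_derivative_unique_at has_vector_derivative_const by blast
qed

text \<open>Swapping the indices \<open>i0\<close> and \<open>k\<close> pairs off equal terms with opposite signs.\<close>

lemma sum_sign_symmetric_eq_0:
  fixes T :: "('n::finite \<Rightarrow> 'n) \<Rightarrow> real"
  assumes k: "k \<noteq> i0" and T: "\<And>p. T (p \<circ> Transposition.transpose i0 k) = T p"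
  shows "(\<Sum>p | p permutes (UNIV :: 'n set). of_int (sign p) * T p) = 0"
proof -
  let ?\<tau> = "Transposition.transpose i0 k"
  have \<tau>: "?\<tau> permutes (UNIV :: 'n set)" by (rule permutes_swap_id) auto
  have "(\<Sum>p | p permutes (UNIV :: 'n set). of_int (sign p) * T p)
     = (\<Sum>p | p permutes (UNIV :: 'n set). of_int (sign (p \<circ> ?\<tau>)) * T (p \<circ> ?\<tau>))"
    by (rule sum_permutations_compose_right[OF \<tau>])
  also have "\<dots> = (\<Sum>p | p permutes (UNIV :: 'n set). - (of_int (sign p) * T p))"
  proof (rule sum.cong[OF refl])
    fix p assume "p \<in> {p. p permutes (UNIV :: 'n set)}"
    then have "permutation p" "permutation ?\<tau>"
      using \<tau> by (auto simp: permutation_permutes)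
    then have "sign (p \<circ> ?\<tau>) = - sign p"
      using k by (simp add: sign_compose sign_swap_id)
    then show "of_int (sign (p \<circ> ?\<tau>)) * T (p \<circ> ?\<tau>) = - (of_int (sign p) * T p)"
      by (simp add: T)
  qed
  finally show ?thesis by (simp add: sum_negf)
qed

text \<open>The integrand is the determinant of \<open>G\<close> with row \<open>i0\<close> replaced
  by the gradient of u. For each p, the directional derivative of u times the remaining factors
  integrates to zero; the surplus terms of the product rule contain second derivatives and cancel in
  the signed sum.\<close>

lemma integral_null_lagrangian_eq_0:
  fixes u :: "real^'n::finite \<Rightarrow> real" and du :: "'n \<Rightarrow> real^'n \<Rightarrow> real" and G :: "real^'n \<Rightarrow> real^'n^'n"
  assumes u: "continuous_on UNIV u" "\<And>j. continuous_on UNIV (du j)"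
    and G: "continuous_on UNIV G" "\<And>i j k. continuous_on UNIV (H i j k)"
    and supp: "\<And>x. u x \<noteq> 0 \<Longrightarrow> norm x \<le> r" "\<And>x j. du j x \<noteq> 0 \<Longrightarrow>
        norm x \<le> r"
    and der: "\<And>x j. ((\<lambda>s. u (x + s *\<^sub>R axis j 1)) has_real_derivative du j x) (at 0)"
      "\<And>x i j k. ((\<lambda>s. G (x + s *\<^sub>R axis k 1) $ i $ j) has_real_derivative H i j k x) (at 0)"
    and sym: "\<And>i j k. H i j k = H i k j"
  shows "(\<integral>x. (\<Sum>p | p permutes (UNIV :: 'n set). of_int (sign p) *
      (du (p i0) x * (\<Prod>i\<in>UNIV - {i0}. G x $ i $ p i))) \<partial>lborel) = 0"
proof -
  \<comment> \<open>The derivative, in coordinate direction \<open>p i0\<close>, of u times the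
    product over the rows other than \<open>i0\<close>.\<close>
  define h' where "h' p x = du (p i0) x * (\<Prod>i\<in>UNIV - {i0}. G x $ i $ p i)
    + u x * (\<Sum>k\<in>UNIV - {i0}. H k (p k) (p i0) x * (\<Prod>i\<in>UNIV - {i0} - {k}. G x $ i $ p i))" for p x
  have ch: "continuous_on UNIV (h' p)" for p
    unfolding h'_def[abs_def] by (intro continuous_intros u G)
  have sh: "norm x \<le> r" if "h' p x \<noteq> 0" for p x
    using that supp(1)[of x] supp(2)[of "p i0" x]
    by (cases "u x = 0"; cases "du (p i0) x = 0") (auto simp: h'_def)
  have int: "(\<integral>x. h' p x \<partial>lborel) = 0" for p
  proof (rule integral_directional_derivative_eq_0[where h = "\<lambda>x. u x
      * (\<Prod>i\<in>UNIV - {i0}. G x $ i $ p i)"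
        and v = "axis (p i0) 1" and r = r])
    show "continuous_on UNIV (\<lambda>x. u x * (\<Prod>i\<in>UNIV - {i0}. G x $ i $ p i))"
      by (intro continuous_intros u G)
    show "((\<lambda>s. u (x + s *\<^sub>R axis (p i0) 1) * (\<Prod>i\<in>UNIV - {i0}. G (x
        + s *\<^sub>R axis (p i0) 1) $ i $ p i))
        has_real_derivative h' p x) (at 0)" for x
    proof -
      have "((\<lambda>s. \<Prod>i\<in>UNIV - {i0}. G (x + s *\<^sub>R axis (p i0) 1) $ i $ p i) has_real_derivative
         (\<Sum>k\<in>UNIV - {i0}. H k (p k) (p i0) x * (\<Prod>i\<in>UNIV - {i0} - {k}. G (x + 0 *\<^sub>R axis (p i0) 1) $ i $ p i))) (at 0)"
        by (rule has_field_derivative_prod) (rule der)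
      from DERIV_mult[OF der(1)[of x "p i0"] this]
      show ?thesis by (simp add: h'_def mult.commute)
    qed
  qed (use ch sh supp(1) in \<open>auto\<close>)
  have ih: "integrable lborel (h' p)" for p
  proof -
    have "set_integrable lborel (cball 0 r :: (real^'n) set) (\<lambda>_. 1 :: real)"
      unfolding set_integrable_def by (intro borel_integrable_compact) auto
    then show ?thesis
      using integrable_continuous_scaleR[of "h' p" "cball 0 r" "\<lambda>_. 1 :: real"] ch sh by simp
  qed
  have "(\<Sum>p | p permutes (UNIV :: 'n set). of_int (sign p) * (du (p i0) x
      * (\<Prod>i\<in>UNIV - {i0}. G x $ i $ p i)))
    = (\<Sum>p | p permutes (UNIV :: 'n set). of_int (sign p) * h' p x)" for x
  proof -
    \<comment> \<open>Composing p with the transposition of \<open>i0\<close> and k only swaps the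
      last two indices of \<open>H\<close>, under which \<open>H\<close> is symmetric.\<close>
    have z: "(\<Sum>p | p permutes (UNIV :: 'n set). of_int (sign p) *
        (H k (p k) (p i0) x * (\<Prod>i\<in>UNIV - {i0} - {k}. G x $ i $ p i))) = 0" if k: "k \<in> UNIV - {i0}" for k
    proof (rule sum_sign_symmetric_eq_0[of k i0])
      show "k \<noteq> i0" using k by simp
      fix p :: "'n \<Rightarrow> 'n"
      have "(\<Prod>i\<in>UNIV - {i0} - {k}. G x $ i $ (p \<circ> Transposition.transpose i0 k) i)
          = (\<Prod>i\<in>UNIV - {i0} - {k}. G x $ i $ p i)"
        by (intro prod.cong) (auto simp: Transposition.transpose_def)
      then show "H k ((p \<circ> Transposition.transpose i0 k) k) ((p \<circ> Transposition.transpose i0 k) i0) x *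
          (\<Prod>i\<in>UNIV - {i0} - {k}. G x $ i $ (p \<circ> Transposition.transpose i0 k) i)
        = H k (p k) (p i0) x * (\<Prod>i\<in>UNIV - {i0} - {k}. G x $ i $ p i)"
        using sym[of k "p k" "p i0"] by simp
    qed
    have "(\<Sum>p | p permutes (UNIV :: 'n set). of_int (sign p) *
        (u x * (\<Sum>k\<in>UNIV - {i0}. H k (p k) (p i0) x * (\<Prod>i\<in>UNIV - {i0} - {k}. G x $ i $ p i))))
      = u x * (\<Sum>k\<in>UNIV - {i0}. \<Sum>p | p permutes (UNIV :: 'n set). of_int (sign p) *
        (H k (p k) (p i0) x * (\<Prod>i\<in>UNIV - {i0} - {k}. G x $ i $ p i)))"
      by (subst sum.swap) (simp add: sum_distrib_left mult_ac)
    also have "\<dots> = 0" using z by simp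
    finally show ?thesis by (simp add: h'_def distrib_left sum.distrib)
  qed
  then have "(\<integral>x. (\<Sum>p | p permutes (UNIV :: 'n set). of_int (sign p) *
      (du (p i0) x * (\<Prod>i\<in>UNIV - {i0}. G x $ i $ p i))) \<partial>lborel)
     = (\<Sum>p | p permutes (UNIV :: 'n set). of_int (sign p) * (\<integral>x. h' p x \<partial>lborel))"
    using ih by simp
  also have "\<dots> = 0" by (simp add: int)
  finally show ?thesis .
qed

section \<open>Cubes and cutoff functions\<close>

text \<open>Cubes are preferred to balls because the region between two concentric cubes is a union
  of slabs cut out by half-spaces, hence of convex sets.\<close>

definition cube :: "real^'n::finite \<Rightarrow> real \<Rightarrow> (real^'n) set" where
  "cube a R = {x. \<forall>i. \<bar>x $ i - a $ i\<bar> \<le> R}"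

lemma cube_eq_cbox: "cube a R = cbox (a - (\<chi> i. R)) (a + (\<chi> i. R))"
  by (auto simp: cube_def mem_box_cart abs_le_iff) (smt (verit))+

lemma compact_cube [simp]: "compact (cube a R)" and convex_cube [simp]: "convex (cube a R)"
  by (simp_all add: cube_eq_cbox)

lemma cube_in_borel [measurable]: "cube a R \<in> sets borel"
  by (simp add: borel_compact)

lemma square_ramp_has_real_derivative:
  "((\<lambda>t. (max 0 t)\<^sup>2) has_real_derivative 2 * max 0 t) (at (t :: real))"
proof -
  consider "t > 0" | "t < 0" | "t = 0" by linarith
  then show ?thesis
  proof cases
    case 1
    have d: "((\<lambda>t. t\<^sup>2) has_real_derivative 2 * max 0 t) (at t)"
      using 1 by (auto intro!: derivative_eq_intros)
    have "\<forall>\<^sub>F s in nhds t. s \<in> {0<..}" using 1 by (intro eventually_nhds_in_open) auto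
    then have ev: "\<forall>\<^sub>F s in nhds t. (max 0 s)\<^sup>2 = s\<^sup>2" by eventually_elim auto
    show ?thesis using DERIV_cong_ev[OF refl ev refl] d by blast
  next
    case 2
    have d: "((\<lambda>t. 0) has_real_derivative 2 * max 0 t) (at t)"
      using 2 by auto
    have "\<forall>\<^sub>F s in nhds t. s \<in> {..<0}" using 2 by (intro eventually_nhds_in_open) auto
    then have ev: "\<forall>\<^sub>F s in nhds t. (max 0 s)\<^sup>2 = 0" by eventually_elim auto
    show ?thesis using DERIV_cong_ev[OF refl ev refl] d by blast
  next
    case 3
    have "((\<lambda>s. ((max 0 s)\<^sup>2 - (max 0 t)\<^sup>2) / (s - t)) \<longlongrightarrow> 0) (at t)"
    proof (rule Lim_null_comparison)
      show "\<forall>\<^sub>F s in at t. norm (((max 0 s)\<^sup>2 - (max 0 t)\<^sup>2) / (s - t)) \<le> \<bar>s\<bar>"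
        using 3 by (intro always_eventually) (auto simp: max_def power2_eq_square)
      show "((\<lambda>s. \<bar>s\<bar>) \<longlongrightarrow> 0) (at t)" unfolding 3 by (auto intro!: tendsto_eq_intros)
    qed
    then show ?thesis using 3 by (simp add: has_field_derivative_iff)
  qed
qed

lemma cutoff_exists:
  assumes R: "0 < R"
  obtains \<phi> :: "real^'n::finite \<Rightarrow> real" and \<phi>1 where
    "continuous_on UNIV \<phi>" "\<And>j. continuous_on UNIV (\<phi>1 j)"
    "\<And>x. 0 \<le> \<phi> x" "\<And>x. \<phi> x \<le> 1" "\<And>x. x \<in> cube a R \<Longrightarrow> \<phi> x = 1"
    "\<And>x. \<phi> x \<noteq> 0 \<Longrightarrow> x \<in> cube a (2 * R)"
    "\<And>x j. \<phi>1 j x \<noteq> 0 \<Longrightarrow> x \<in> cube a (2 * R) \<and> R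
        \<le> \<bar>x $ j - a $ j\<bar>"
    "\<And>x j. \<bar>\<phi>1 j x\<bar> \<le> 4 / R"
    "\<And>x j. ((\<lambda>s. \<phi> (x + s *\<^sub>R axis j 1)) has_real_derivative \<phi>1 j x) (at 0)"
proof -
  \<comment> \<open>A continuously differentiable profile, equal to 1 on [-1, 1] and at most 0 where
    |t| >= 2. Squaring its positive part keeps one continuous derivative and gives values in [0, 1];
    the slope is at most 2 * 1 * 2 = 4, which is the constant in the bound 4 / R.\<close>
  define q where "q t = 1 - (max 0 (t - 1))\<^sup>2 - (max 0 (- t - 1))\<^sup>2" for t :: real
  define q' where "q' t = - (2 * max 0 (t - 1)) + 2 * max 0 (- t - 1)" for t :: real
  define \<chi>0 where "\<chi>0 t = (max 0 (q t))\<^sup>2" for t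
  define \<chi>1 where "\<chi>1 t = 2 * max 0 (q t) * q' t" for t
  have dq: "(q has_real_derivative q' t) (at t)" for t
    unfolding q_def[abs_def] q'_def
    by (rule derivative_eq_intros DERIV_chain2[OF square_ramp_has_real_derivative] refl | simp)+
  have d\<chi>: "(\<chi>0 has_real_derivative \<chi>1 t) (at t)" for t
    unfolding \<chi>0_def[abs_def] \<chi>1_def
    by (rule DERIV_chain2[OF square_ramp_has_real_derivative dq])
  have q1: "q t \<le> 1" for t unfolding q_def by (simp add: add_nonneg_nonneg)
  have qpos: "\<bar>t\<bar> < 2" if "0 < q t" for t
  proof (rule ccontr)
    assume "\<not> \<bar>t\<bar> < 2"
    then have "1 \<le> max 0 (t - 1) \<or> 1 \<le> max 0 (- t - 1)" by auto
    then have "1 \<le> (max 0 (t - 1))\<^sup>2 \<or> 1 \<le> (max 0 (- t - 1))\<^sup>2"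
      by (auto simp: one_le_power)
    then have "q t \<le> 0" unfolding q_def
      using zero_le_power2[of "max 0 (t - 1)"] zero_le_power2[of "max 0 (- t - 1)"] by linarith
    then show False using that by simp
  qed
  have \<chi>b: "0 \<le> \<chi>0 t" "\<chi>0 t \<le> 1" for t
    unfolding \<chi>0_def using q1[of t] by (auto simp: power_le_one)
  have \<chi>in: "\<chi>0 t = 1" "\<chi>1 t = 0" if "\<bar>t\<bar> \<le> 1" for t
    using that by (auto simp: \<chi>0_def \<chi>1_def q_def q'_def)
  have \<chi>out: "\<bar>t\<bar> \<le> 2" if "\<chi>0 t \<noteq> 0 \<or> \<chi>1 t \<noteq> 0" for t
    using that qpos[of t] by (auto simp: \<chi>0_def \<chi>1_def max_def split: if_splits)
  have \<chi>1b: "\<bar>\<chi>1 t\<bar> \<le> 4" for t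
  proof (cases "0 < q t")
    case True
    have "\<bar>q' t\<bar> \<le> 2" using qpos[OF True] by (auto simp: q'_def max_def)
    then have "\<bar>2 * max 0 (q t)\<bar> * \<bar>q' t\<bar> \<le> 2 * 2" using q1[of t] by (intro mult_mono) auto
    then show ?thesis by (simp add: \<chi>1_def abs_mult)
  qed (simp add: \<chi>1_def)
  have c\<chi>0: "continuous_on UNIV \<chi>0"
    using d\<chi> by (meson DERIV_isCont continuous_at_imp_continuous_on)
  have c\<chi>1: "continuous_on UNIV \<chi>1"
    unfolding \<chi>1_def[abs_def] q_def q'_def by (intro continuous_intros)
  define p where "p i t = \<chi>0 ((t - a $ i) / R)" for i t
  define p' where "p' i t = \<chi>1 ((t - a $ i) / R) / R" for i t
  have dp: "(p i has_real_derivative p' i t) (at t)" for i t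
  proof -
    have "((\<lambda>t. (t - a $ i) / R) has_real_derivative 1 / R) (at t)"
      using R by (auto intro!: derivative_eq_intros)
    from DERIV_chain2[OF d\<chi> this] show ?thesis by (simp add: p_def[abs_def] p'_def)
  qed
  have cp: "continuous_on UNIV (p i)" "continuous_on UNIV (p' i)" for i
    unfolding p_def[abs_def] p'_def[abs_def] using R
    by (auto intro!: continuous_intros continuous_on_compose2[OF c\<chi>0] continuous_on_compose2[OF c\<chi>1])
  define \<phi>1 where "\<phi>1 j = tprod (p(j := p' j))" for j
  have far: "\<bar>t - a $ i\<bar> \<le> 2 * R" if "p i t \<noteq> 0 \<or> p' i t \<noteq> 0" for i t
    using that \<chi>out[of "(t - a $ i) / R"] R by (auto simp: p_def p'_def field_simps)
  have comp: "p i (x $ i) \<noteq> 0" if "tprod p x \<noteq> 0" for x i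
    using that by (auto simp: tprod_def)
  have comp1: "(if i = j then p' j (x $ j) else p i (x $ i)) \<noteq> 0" if "\<phi>1 j x \<noteq> 0" for x i j
  proof -
    have "(p(j := p' j)) i (x $ i) \<noteq> 0" using that by (auto simp: \<phi>1_def tprod_def)
    then show ?thesis by (auto split: if_splits)
  qed
  show ?thesis
  proof (rule that[of "tprod p" \<phi>1])
    show "continuous_on UNIV (tprod p)" by (intro continuous_on_tprod cp)
    show "continuous_on UNIV (\<phi>1 j)" for j
      unfolding \<phi>1_def by (intro continuous_on_tprod) (simp add: cp)
    show "0 \<le> tprod p x" "tprod p x \<le> 1" for x
      unfolding tprod_def using \<chi>b by (auto simp: p_def intro!: prod_nonneg prod_le_1)
    show "tprod p x = 1" if "x \<in> cube a R" for x
      unfolding tprod_def using that R by (intro prod.neutral) (auto simp: p_def cube_def intro!: \<chi>in)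
    show "x \<in> cube a (2 * R)" if "tprod p x \<noteq> 0" for x
      using comp[OF that] far by (auto simp: cube_def)
    show "x \<in> cube a (2 * R) \<and> R \<le> \<bar>x $ j - a $ j\<bar>" if nz: "\<phi>1 j x \<noteq> 0" for x j
    proof
      show "x \<in> cube a (2 * R)"
        unfolding cube_def
      proof (intro CollectI allI)
        fix i show "\<bar>x $ i - a $ i\<bar> \<le> 2 * R"
          using comp1[OF nz, of i] far[of i "x $ i"] by (auto split: if_splits)
      qed
      have "\<chi>1 ((x $ j - a $ j) / R) \<noteq> 0" using comp1[OF nz, of j] R by (simp add: p'_def)
      then have "1 < \<bar>(x $ j - a $ j) / R\<bar>" using \<chi>in(2) by (meson not_le)
      then show "R \<le> \<bar>x $ j - a $ j\<bar>" using R by (simp add: field_simps)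
    qed
    show "\<bar>\<phi>1 j x\<bar> \<le> 4 / R" for j x
    proof -
      have "\<bar>\<phi>1 j x\<bar> = \<bar>p' j (x $ j)\<bar> * (\<Prod>i\<in>UNIV - {j}. \<bar>p i (x $ i)\<bar>)"
        by (simp add: \<phi>1_def tprod_upd abs_mult abs_prod)
      also have "\<dots> \<le> 4 / R * 1"
        using R \<chi>1b \<chi>b by (intro mult_mono prod_le_1) (auto simp: p'_def p_def divide_right_mono prod_nonneg)
      finally show ?thesis by simp
    qed
    show "((\<lambda>s. tprod p (x + s *\<^sub>R axis j 1)) has_real_derivative \<phi>1 j x) (at 0)" for x j
    proof -
      have "(tprod p has_derivative (\<lambda>h. \<Sum>i\<in>UNIV. h $ i * \<phi>1 i x)) (at x)"
        unfolding \<phi>1_def by (rule tprod_has_derivative) (rule dp)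
      from has_derivative_imp_directional[of "tprod p" \<phi>1, OF this, of "axis j 1"]
      show ?thesis
        by (simp add: axis_def if_distrib[of "\<lambda>c. c * _"] cong: if_cong)
    qed
  qed
qed

section \<open>Determinant estimates\<close>

lemma norm_matrix_entry_le: "\<bar>A $ i $ j\<bar> \<le> norm (A :: real^'n::finite^'m::finite)"
  using Finite_Cartesian_Product.norm_nth_le[of "A $ i" j] Finite_Cartesian_Product.norm_nth_le[of A i]
  by simp

lemma abs_det_le: "\<bar>det A\<bar> \<le> fact CARD('n) * norm A ^ CARD('n)" for A :: "real^'n::finite^'n"
proof -
  have "\<bar>det A\<bar> \<le> (\<Sum>p | p permutes (UNIV :: 'n set). \<bar>of_int (sign p)
      * (\<Prod>i\<in>UNIV. A $ i $ p i)\<bar>)"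
    unfolding det_def by (rule sum_abs)
  also have "\<dots> \<le> (\<Sum>p | p permutes (UNIV :: 'n set). norm A ^ CARD('n))"
  proof (rule sum_mono)
    fix p
    have "(\<Prod>i\<in>(UNIV::'n set). \<bar>A $ i $ p i\<bar>) \<le> (\<Prod>i\<in>(UNIV::'n set). norm A)"
      by (intro prod_mono) (auto simp: norm_matrix_entry_le)
    then show "\<bar>of_int (sign p) * (\<Prod>i\<in>UNIV. A $ i $ p i)\<bar> \<le> norm A ^ CARD('n)"
      by (simp add: abs_mult abs_prod sign_def)
  qed
  also have "\<dots> = fact CARD('n) * norm A ^ CARD('n)"
    by (simp add: card_permutations)
  finally show ?thesis .
qed

lemma det_scaleR: "det (c *\<^sub>R A) = c ^ CARD('n) * det A" for A :: "real^'n::finite^'n"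
  by (simp add: det_def prod.distrib sum_distrib_left mult_ac)

text \<open>By homogeneity it suffices to use uniform continuity of the determinant on a ball.\<close>

lemma det_diff_le:
  assumes \<kappa>: "0 < \<kappa>"
  obtains C where "0 \<le> C"
    "\<And>A B :: real^'n::finite^'n. \<bar>det A - det B\<bar>
        \<le> \<kappa> * norm A ^ CARD('n) + C * norm (A - B) ^ CARD('n)"
proof -
  let ?n = "CARD('n)"
  have "continuous_on (cball 0 2) (det :: real^'n^'n \<Rightarrow> real)"
    unfolding det_def[abs_def] by (intro continuous_intros)
  then have "uniformly_continuous_on (cball 0 2) (det :: real^'n^'n \<Rightarrow> real)"
    by (intro compact_uniformly_continuous) auto
  then obtain d0 where d0: "0 < d0" "\<And>A B :: real^'n^'n. A \<in> cball 0 2 \<Longrightarrow>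
      B \<in> cball 0 2 \<Longrightarrow>
      dist B A < d0 \<Longrightarrow> dist (det B) (det A) < \<kappa>"
    unfolding uniformly_continuous_on_def using \<kappa> by metis
  \<comment> \<open>At most 1, so that the normalised \<open>B\<close> stays in the ball of radius 2
    on which uniform continuity holds.\<close>
  define d where "d = min (d0 / 2) 1"
  have d: "0 < d" "d < d0" "d \<le> 1" using d0 by (auto simp: d_def)
  define C where "C = fact ?n * (1 / d) ^ ?n + fact ?n * (1 / d + 1) ^ ?n"
  have "\<bar>det A - det B\<bar> \<le> \<kappa> * norm A ^ ?n + C * norm (A - B) ^ ?n" for A B :: "real^'n^'n"
  proof (cases "norm (A - B) \<le> d * norm A \<and> A \<noteq> 0")
    case True
    define a where "a = norm A"
    have a: "0 < a" using True by (simp add: a_def)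
    define A' B' where "A' = (1 / a) *\<^sub>R A" and "B' = (1 / a) *\<^sub>R B"
    have nA: "norm A' = 1" using a by (simp add: a_def A'_def)
    have nAB: "norm (A' - B') \<le> d"
      unfolding A'_def B'_def scaleR_diff_right[symmetric] using True a by (simp add: a_def divide_le_eq)
    then have "norm B' \<le> 2"
      using norm_triangle_sub[of B' A'] nA d norm_minus_commute[of B' A'] by linarith
    then have "\<bar>det A' - det B'\<bar> < \<kappa>"
      using d0(2)[of B' A'] nA nAB d by (simp add: dist_norm)
    then have "\<bar>(1 / a) ^ ?n * (det A - det B)\<bar> < \<kappa>"
      by (simp only: det_scaleR right_diff_distrib A'_def B'_def)
    then have "\<bar>det A - det B\<bar> \<le> \<kappa> * a ^ ?n"
      using a by (simp add: abs_mult power_one_over field_simps)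
    moreover have "0 \<le> C" using d by (simp add: C_def)
    ultimately show ?thesis by (simp add: a_def add_increasing2)
  next
    \<comment> \<open>Now the norms of \<open>A\<close> and \<open>B\<close> are both at most a
      multiple of the norm of \<open>A - B\<close>, which bounds the two determinants
      separately.\<close>
    case False
    then have A: "norm A \<le> 1 / d * norm (A - B)"
      using d by (cases "A = 0") (auto simp: field_simps)
    have B: "norm B \<le> (1 / d + 1) * norm (A - B)"
      using A norm_triangle_ineq2[of B A] by (simp add: distrib_right norm_minus_commute)
    have "\<bar>det A - det B\<bar> \<le> \<bar>det A\<bar> + \<bar>det B\<bar>" by simp
    also have "\<dots> \<le> fact ?n * norm A ^ ?n + fact ?n * norm B ^ ?n"
      by (intro add_mono abs_det_le)
    also have "\<dots> \<le> fact ?n * (1 / d * norm (A - B)) ^ ?n + fact ?n * ((1 / d + 1) * norm (A - B)) ^ ?n"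
      using A B by (intro add_mono mult_left_mono power_mono) auto
    also have "\<dots> = C * norm (A - B) ^ ?n"
      unfolding C_def power_mult_distrib by (simp add: distrib_right)
    also have "\<dots> \<le> \<kappa> * norm A ^ ?n + C * norm (A - B) ^ ?n" using \<kappa> by simp
    finally show ?thesis .
  qed
  moreover have "0 \<le> C" using d by (simp add: C_def)
  ultimately show ?thesis using that by blast
qed

text \<open>A crude form of Young's inequality: the product is at most the n-th power of the larger
  number.\<close>

lemma mult_power_le_sum_powers:
  fixes x y :: real
  assumes "0 \<le> x" "0 \<le> y" "0 < n"
  shows "x * y ^ (n - 1) \<le> x ^ n + y ^ n"
proof -
  obtain m where n: "n = Suc m" using \<open>0 < n\<close> gr0_conv_Suc by blast
  show ?thesis
  proof (cases "x \<le> y")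
    case True
    then have "x * y ^ m \<le> y * y ^ m" using assms by (intro mult_right_mono) auto
    also have "\<dots> \<le> x * x ^ m + y * y ^ m" using assms by simp
    finally show ?thesis by (simp add: n)
  next
    case False
    then have "x * y ^ m \<le> x * x ^ m" using assms by (intro mult_left_mono power_mono) auto
    also have "\<dots> \<le> x * x ^ m + y * y ^ m" using assms by simp
    finally show ?thesis by (simp add: n)
  qed
qed

section \<open>The Caccioppoli inequality for smooth maps\<close>

text \<open>The null Lagrangian identity is applied with u = \<phi> (g - c) in one coordinate. The
  part of the gradient of u carrying the gradient of \<open>g\<close> reproduces \<phi> det G; the
  part carrying the gradient of \<phi> lives on \<open>A\<close> and is estimated by M, by Young's
  inequality and by the number n! of permutations.\<close>

lemma caccioppoli_smooth:
  fixes g :: "real^'n::finite \<Rightarrow> real^'n" and G :: "real^'n \<Rightarrow> real^'n^'n"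
  assumes cont: "continuous_on UNIV g" "continuous_on UNIV G" "\<And>i j k. continuous_on UNIV (H i j k)"
    and derg: "\<And>x v. ((\<lambda>s. g (x + s *\<^sub>R v)) has_vector_derivative G x *v v) (at 0)"
    and derG: "\<And>x i j k. ((\<lambda>s. G (x + s *\<^sub>R axis k 1) $ i $ j) has_real_derivative H i j k x) (at 0)"
    and sym: "\<And>i j k. H i j k = H i k j"
    and \<phi>: "continuous_on UNIV \<phi>" "\<And>j. continuous_on UNIV (\<phi>1 j)" "\<And>x. \<phi> x \<noteq> 0 \<Longrightarrow> norm x \<le> r"
      "\<And>x j. \<phi>1 j x \<noteq> 0 \<Longrightarrow> x \<in> A" "\<And>x j. \<bar>\<phi>1 j x\<bar> \<le> M"
      "\<And>x j. ((\<lambda>s. \<phi> (x + s *\<^sub>R axis j 1)) has_real_derivative \<phi>1 j x) (at 0)"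
    and A: "compact A" "A \<subseteq> cball 0 r"
  shows "\<bar>\<integral>x. \<phi> x * det (G x) \<partial>lborel\<bar> \<le> fact CARD('n) *
    (\<integral>x. indicator A x * ((M * norm (g x - c)) ^ CARD('n) + norm (G x) ^ CARD('n)) \<partial>lborel)"
proof -
  let ?n = "CARD('n)"
  \<comment> \<open>Any row of the matrix would do.\<close>
  obtain i0 :: 'n where True by blast
  define w where "w x = g x $ i0 - c $ i0" for x
  define u where "u x = \<phi> x * w x" for x
  define du where "du j x = \<phi>1 j x * w x + \<phi> x * G x $ i0 $ j" for j x
  have cw: "continuous_on UNIV w" unfolding w_def by (intro continuous_intros cont)
  have sA: "norm x \<le> r" if "\<phi>1 j x \<noteq> 0" for j x using \<phi>(4)[OF that] A by auto
  have M: "0 \<le> M" using \<phi>(5)[of undefined undefined] by simp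
  have dw: "((\<lambda>s. w (x + s *\<^sub>R axis j 1)) has_real_derivative G x $ i0 $ j) (at 0)" for x j
  proof -
    have "((\<lambda>s. g (x + s *\<^sub>R axis j 1) $ i0) has_vector_derivative (G x *v axis j 1) $ i0) (at 0)"
      by (rule bounded_linear.has_vector_derivative[OF bounded_linear_vec_nth derg])
    moreover have "(G x *v axis j 1) $ i0 = G x $ i0 $ j"
      by (simp add: matrix_vector_mult_basis column_def)
    ultimately have "((\<lambda>s. g (x + s *\<^sub>R axis j 1) $ i0) has_real_derivative G x $ i0 $ j) (at 0)"
      by (simp add: has_real_derivative_iff_has_vector_derivative)
    from DERIV_diff[OF this DERIV_const[of "c $ i0"]] show ?thesis by (simp add: w_def)
  qed
  have null: "(\<integral>x. (\<Sum>p | p permutes (UNIV :: 'n set). of_int (sign p) *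
      (du (p i0) x * (\<Prod>i\<in>UNIV - {i0}. G x $ i $ p i))) \<partial>lborel) = 0"
  proof (rule integral_null_lagrangian_eq_0[where u = u and H = H and r = r])
    show "continuous_on UNIV u" unfolding u_def[abs_def] by (intro continuous_intros \<phi> cw)
    show "continuous_on UNIV (du j)" for j
      unfolding du_def[abs_def] by (intro continuous_intros \<phi> cw cont)
    show "norm x \<le> r" if "u x \<noteq> 0" for x using that \<phi>(3) by (auto simp: u_def)
    show "norm x \<le> r" if "du j x \<noteq> 0" for x j
      using that \<phi>(3)[of x] sA[of j x] by (cases "\<phi> x = 0") (auto simp: du_def)
    show "((\<lambda>s. u (x + s *\<^sub>R axis j 1)) has_real_derivative du j x) (at 0)" for x j
      using DERIV_mult[OF \<phi>(6)[of x j] dw[of x j]] by (simp add: u_def[abs_def] du_def mult.commute add.commute)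
  qed (rule cont(2) cont(3) derG sym)+
  \<comment> \<open>The contribution of the derivative of the cutoff, with the sign pattern of a
    determinant.\<close>
  define B where "B x = (\<Sum>p | p permutes (UNIV :: 'n set). of_int (sign p) *
      (\<phi>1 (p i0) x * w x * (\<Prod>i\<in>UNIV - {i0}. G x $ i $ p i)))" for x
  have split: "(\<Sum>p | p permutes (UNIV :: 'n set). of_int (sign p) *
      (du (p i0) x * (\<Prod>i\<in>UNIV - {i0}. G x $ i $ p i))) = B x + \<phi> x * det (G x)" for x
  proof -
    have "(\<Prod>i\<in>(UNIV::'n set). G x $ i $ p i) = G x $ i0 $ p i0
        * (\<Prod>i\<in>UNIV - {i0}. G x $ i $ p i)" for p
      by (rule prod.remove) auto
    then show ?thesis
      by (simp add: B_def det_def du_def distrib_left distrib_right sum.distrib sum_distrib_left mult_ac)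
  qed
  have s1: "set_integrable lborel (cball 0 r :: (real^'n) set) (\<lambda>_. 1 :: real)"
    unfolding set_integrable_def by (intro borel_integrable_compact) auto
  have "continuous_on UNIV (\<lambda>x. \<phi> x * det (G x))"
    unfolding det_def by (intro continuous_intros \<phi> cont)
  then have i1: "integrable lborel (\<lambda>x. \<phi> x * det (G x))"
    using integrable_continuous_scaleR[of "\<lambda>x. \<phi> x * det (G x)" "cball 0 r" "\<lambda>_. 1 :: real"] \<phi>(3) s1 by simp
  have cB: "continuous_on UNIV B" unfolding B_def[abs_def] by (intro continuous_intros \<phi> cw cont)
  have suppB: "x \<in> A" if "B x \<noteq> 0" for x
  proof (rule ccontr)
    assume "x \<notin> A"
    then have "\<phi>1 j x = 0" for j using \<phi>(4) by blast
    then show False using that by (simp add: B_def)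
  qed
  then have "x \<in> cball 0 r" if "B x \<noteq> 0" for x
    using that A by blast
  then have i2: "integrable lborel B"
    using integrable_continuous_scaleR[of B "cball 0 r" "\<lambda>_. 1 :: real"] cB s1 by simp
  have bound: "\<bar>B x\<bar> \<le> fact ?n * (indicator A x * ((M * norm (g x - c)) ^ ?n + norm (G x) ^ ?n))" for x
  proof (cases "x \<in> A")
    case False
    then have "B x = 0" using suppB by blast
    then show ?thesis using False by simp
  next
    case True
    have "\<bar>B x\<bar> \<le> (\<Sum>p | p permutes (UNIV :: 'n set). \<bar>of_int (sign p) *
      (\<phi>1 (p i0) x * w x * (\<Prod>i\<in>UNIV - {i0}. G x $ i $ p i))\<bar>)"
      unfolding B_def by (rule sum_abs)
    also have "\<dots> \<le> (\<Sum>p | p permutes (UNIV :: 'n set). (M * norm (g x - c)) ^ ?n + norm (G x) ^ ?n)"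
    proof (rule sum_mono)
      fix p
      have "(\<Prod>i\<in>UNIV - {i0}. \<bar>G x $ i $ p i\<bar>) \<le> (\<Prod>i\<in>UNIV - {i0}. norm (G x))"
        by (intro prod_mono) (auto simp: norm_matrix_entry_le)
      then have P: "(\<Prod>i\<in>UNIV - {i0}. \<bar>G x $ i $ p i\<bar>) \<le> norm (G x) ^ (?n - 1)"
        by (simp add: card_Diff_singleton)
      have W: "\<bar>w x\<bar> \<le> norm (g x - c)"
        using component_le_norm_cart[of "g x - c" i0] by (simp add: w_def)
      have "\<bar>of_int (sign p) * (\<phi>1 (p i0) x * w x * (\<Prod>i\<in>UNIV - {i0}. G x $ i $ p i))\<bar>
        = \<bar>\<phi>1 (p i0) x\<bar> * \<bar>w x\<bar> * (\<Prod>i\<in>UNIV - {i0}. \<bar>G x $ i $ p i\<bar>)"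
        by (simp add: abs_mult abs_prod sign_def)
      also have "\<dots> \<le> M * norm (g x - c) * norm (G x) ^ (?n - 1)"
        using P W \<phi>(5) M by (intro mult_mono) (auto intro!: prod_nonneg mult_nonneg_nonneg)
      also have "\<dots> \<le> (M * norm (g x - c)) ^ ?n + norm (G x) ^ ?n"
        using M by (intro mult_power_le_sum_powers) auto
      finally show "\<bar>of_int (sign p) * (\<phi>1 (p i0) x * w x * (\<Prod>i\<in>UNIV - {i0}. G x $ i $ p i))\<bar>
        \<le> (M * norm (g x - c)) ^ ?n + norm (G x) ^ ?n" .
    qed
    also have "\<dots> = fact ?n * ((M * norm (g x - c)) ^ ?n + norm (G x) ^ ?n)"
      by (simp add: card_permutations)
    finally show ?thesis using True by simp
  qed
  have "(\<integral>x. \<phi> x * det (G x) \<partial>lborel) = - (\<integral>x. B x \<partial>lborel)"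
    using null i1 i2 unfolding split by simp
  then have "\<bar>\<integral>x. \<phi> x * det (G x) \<partial>lborel\<bar>
      \<le> (\<integral>x. \<bar>B x\<bar> \<partial>lborel)"
    using integral_norm_bound[of lborel B] by simp
  also have "\<dots> \<le> (\<integral>x. fact ?n * (indicator A x * ((M * norm (g x - c)) ^ ?n
      + norm (G x) ^ ?n)) \<partial>lborel)"
  proof (rule integral_mono)
    have "continuous_on A (\<lambda>x. (M * norm (g x - c)) ^ ?n + norm (G x) ^ ?n)"
      by (intro continuous_intros continuous_on_subset[OF cont(1)] continuous_on_subset[OF cont(2)]) auto
    from borel_integrable_compact[OF A(1) this]
    show "integrable lborel (\<lambda>x. fact ?n * (indicator A x * ((M * norm (g x - c)) ^ ?n + norm (G x) ^ ?n)))"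
      by simp
  qed (use i2 bound in auto)
  finally show ?thesis by simp
qed

section \<open>Poincare inequalities on convex sets\<close>

lemma norm_matrix_vector_mult_le: "norm (A *v x) \<le> norm A * norm x" for A :: "real^'n::finite^'m::finite"
proof -
  have "norm (A *v x) = L2_set (\<lambda>i. \<bar>(A $ i) \<bullet> x\<bar>) UNIV"
    by (simp add: norm_vec_def matrix_vector_mul_component)
  also have "\<dots> \<le> L2_set (\<lambda>i. norm (A $ i) * norm x) UNIV"
    by (intro L2_set_mono) (auto simp: Cauchy_Schwarz_ineq2)
  also have "\<dots> = norm A * norm x"
    by (subst L2_set_left_distrib[symmetric]) (auto simp: norm_vec_def)
  finally show ?thesis .
qed

lemma nn_integral_lborel_affine_le:
  fixes \<Phi> :: "'a::euclidean_space \<Rightarrow> ennreal"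
  assumes "\<Phi> \<in> borel_measurable borel" and c: "1 / 2 \<le> c"
  shows "(\<integral>\<^sup>+x. \<Phi> (t + c *\<^sub>R x) \<partial>lborel)
      \<le> ennreal (2 ^ DIM('a)) * (\<integral>\<^sup>+x. \<Phi> x \<partial>lborel)"
proof -
  have "1 \<le> (2 * c) ^ DIM('a)" using c by (intro one_le_power) auto
  then have "1 * (\<integral>\<^sup>+x. \<Phi> (t + c *\<^sub>R x) \<partial>lborel)
      \<le> ennreal ((2 * c) ^ DIM('a)) * (\<integral>\<^sup>+x. \<Phi> (t + c *\<^sub>R x) \<partial>lborel)"
    by (intro mult_right_mono) (auto simp: ennreal_leI simp flip: ennreal_1)
  also have "\<dots> = ennreal (2 ^ DIM('a)) * (ennreal (\<bar>c\<bar> ^ DIM('a))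
      * (\<integral>\<^sup>+x. \<Phi> (t + c *\<^sub>R x) \<partial>lborel))"
    using c by (simp add: power_mult_distrib ennreal_mult mult.assoc)
  also have "\<dots> = ennreal (2 ^ DIM('a)) * (\<integral>\<^sup>+x. \<Phi> x \<partial>lborel)"
    using c by (subst nn_integral_lborel_affine[OF assms(1), of c t]) auto
  finally show ?thesis by simp
qed

text \<open>For the larger of the weights \<open>t\<close> and \<open>1 - t\<close> an affine change of variables in the corresponding
  point loses only a bounded factor.\<close>

lemma nn_integral_segment_le:
  fixes \<Phi> :: "'a::euclidean_space \<Rightarrow> ennreal"
  assumes [measurable]: "\<Phi> \<in> borel_measurable borel" "C \<in> sets borel"
  shows "(\<integral>\<^sup>+x. \<integral>\<^sup>+y. indicator C x * (indicator C y * \<Phi> (x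
      + t *\<^sub>R (y - x))) \<partial>lborel \<partial>lborel)
    \<le> ennreal (2 ^ DIM('a)) * emeasure lborel C * (\<integral>\<^sup>+x. \<Phi> x \<partial>lborel)"
proof -
  define K where "K = ennreal (2 ^ DIM('a)) * (\<integral>\<^sup>+x. \<Phi> x \<partial>lborel)"
  have *: "(\<integral>\<^sup>+x. indicator C x * K \<partial>lborel)
      = ennreal (2 ^ DIM('a)) * emeasure lborel C * (\<integral>\<^sup>+x. \<Phi> x \<partial>lborel)"
    unfolding K_def by (subst nn_integral_multc) (auto simp: mult_ac)
  show ?thesis
  proof (cases "1 / 2 \<le> t")
    case True
    have "(\<integral>\<^sup>+y. indicator C x * (indicator C y * \<Phi> (x
        + t *\<^sub>R (y - x))) \<partial>lborel) \<le> indicator C x * K" for x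
    proof -
      have "(\<integral>\<^sup>+y. indicator C x * (indicator C y * \<Phi> (x + t *\<^sub>R (y - x))) \<partial>lborel)
        \<le> (\<integral>\<^sup>+y. indicator C x * \<Phi> ((x - t *\<^sub>R x) + t *\<^sub>R y) \<partial>lborel)"
        by (intro nn_integral_mono) (auto simp: indicator_def algebra_simps)
      also have "\<dots> = indicator C x * (\<integral>\<^sup>+y. \<Phi> ((x - t *\<^sub>R x)
          + t *\<^sub>R y) \<partial>lborel)"
        by (rule nn_integral_cmult) simp
      also have "\<dots> \<le> indicator C x * K"
        unfolding K_def by (intro mult_left_mono nn_integral_lborel_affine_le True) auto
      finally show ?thesis .
    qed
    then show ?thesis unfolding *[symmetric] by (rule nn_integral_mono)
  next
    case False
    have "(\<integral>\<^sup>+x. indicator C x * (indicator C y * \<Phi> (x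
        + t *\<^sub>R (y - x))) \<partial>lborel) \<le> indicator C y * K" for y
    proof -
      have "(\<integral>\<^sup>+x. indicator C x * (indicator C y * \<Phi> (x + t *\<^sub>R (y - x))) \<partial>lborel)
        \<le> (\<integral>\<^sup>+x. indicator C y * \<Phi> (t *\<^sub>R y + (1 - t) *\<^sub>R x) \<partial>lborel)"
        by (intro nn_integral_mono) (auto simp: indicator_def algebra_simps)
      also have "\<dots> = indicator C y * (\<integral>\<^sup>+x. \<Phi> (t *\<^sub>R y
          + (1 - t) *\<^sub>R x) \<partial>lborel)"
        by (rule nn_integral_cmult) simp
      also have "\<dots> \<le> indicator C y * K"
        unfolding K_def using False by (intro mult_left_mono nn_integral_lborel_affine_le) auto
      finally show ?thesis .
    qed
    then have "(\<integral>\<^sup>+y. \<integral>\<^sup>+x. indicator C x * (indicator C y * \<Phi> (x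
        + t *\<^sub>R (y - x))) \<partial>lborel \<partial>lborel)
      \<le> (\<integral>\<^sup>+x. indicator C x * K \<partial>lborel)" by (rule nn_integral_mono)
    also have "(\<integral>\<^sup>+y. \<integral>\<^sup>+x. indicator C x * (indicator C y * \<Phi> (x
        + t *\<^sub>R (y - x))) \<partial>lborel \<partial>lborel)
      = (\<integral>\<^sup>+x. \<integral>\<^sup>+y. indicator C x * (indicator C y * \<Phi> (x + t *\<^sub>R (y - x))) \<partial>lborel \<partial>lborel)"
      by (rule lborel_pair.Fubini') measurable
    finally show ?thesis unfolding * .
  qed
qed

text \<open>The fundamental theorem of calculus along the segment from x to y, followed by Jensen's
  inequality for the uniform density on [0, 1].\<close>

lemma norm_diff_power_le_segment_integral:
  fixes g :: "real^'n::finite \<Rightarrow> real^'n" and G :: "real^'n \<Rightarrow> real^'n^'n"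
  assumes G: "continuous_on UNIV G"
    and derg: "\<And>x v. ((\<lambda>s. g (x + s *\<^sub>R v)) has_vector_derivative G x *v v) (at 0)"
    and p: "0 < p" and d: "norm (y - x) \<le> d"
  shows "ennreal (norm (g y - g x) ^ p) \<le>
    (\<integral>\<^sup>+t. indicator {0..1} t * ennreal ((norm (G (x + t *\<^sub>R (y - x))) * d) ^ p) \<partial>lborel)"
proof -
  define v where "v = y - x"
  define h where "h t = G (x + t *\<^sub>R v) *v v" for t :: real
  have der: "((\<lambda>t. g (x + t *\<^sub>R v)) has_vector_derivative h t) (at t)" for t
  proof -
    have 1: "((\<lambda>\<tau>. \<tau> - t) has_vector_derivative 1) (at t)"
      by (auto intro!: derivative_eq_intros)
    have 2: "((\<lambda>s. g ((x + t *\<^sub>R v) + s *\<^sub>R v)) has_vector_derivative h t) (at ((\<lambda>\<tau>. \<tau> - t) t))"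
      using derg[of "x + t *\<^sub>R v" v] by (simp add: h_def)
    from vector_diff_chain_at[OF 1 2] show ?thesis
      by (simp add: o_def algebra_simps)
  qed
  have "((\<lambda>t. h t) has_integral (g (x + 1 *\<^sub>R v) - g (x + 0 *\<^sub>R v))) {0..1}"
    by (rule fundamental_theorem_of_calculus) (auto intro: has_vector_derivative_at_within der)
  then have int: "integral {0..1} h = g y - g x" by (simp add: integral_unique v_def)
  have ch: "continuous_on A h" for A
    unfolding h_def[abs_def] matrix_vector_mult_def
    by (intro continuous_intros continuous_on_compose2[OF G]) auto
  have "set_integrable lborel {0..1} h"
    unfolding set_integrable_def using ch by (intro borel_integrable_compact) auto
  from set_borel_integral_eq_integral(2)[OF this]
  have eq: "g y - g x = (\<integral>t. indicator {0..1} t *\<^sub>R h t \<partial>lborel)"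
    by (simp add: int set_lebesgue_integral_def)
  have [measurable]: "h \<in> borel_measurable borel" using ch by (rule borel_measurable_continuous_onI)
  have "ennreal (norm (g y - g x) ^ p) \<le> (\<integral>\<^sup>+t. ennreal (indicator {0..1} t
      * norm (h t) ^ p) \<partial>lborel)"
    unfolding eq using p
    by (intro jensen_norm_power) (auto simp: ennreal_indicator)
  also have "\<dots> \<le> (\<integral>\<^sup>+t. indicator {0..1} t * ennreal ((norm (G (x
      + t *\<^sub>R (y - x))) * d) ^ p) \<partial>lborel)"
  proof (rule nn_integral_mono)
    fix t :: real
    have "norm (h t) \<le> norm (G (x + t *\<^sub>R v)) * norm v"
      unfolding h_def by (rule norm_matrix_vector_mult_le)
    also have "\<dots> \<le> norm (G (x + t *\<^sub>R v)) * d"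
      using d by (intro mult_left_mono) (auto simp: v_def)
    finally have "norm (h t) ^ p \<le> (norm (G (x + t *\<^sub>R (y - x))) * d) ^ p"
      by (intro power_mono) (auto simp: v_def)
    then show "ennreal (indicator {0..1} t * norm (h t) ^ p)
      \<le> indicator {0..1} t * ennreal ((norm (G (x + t *\<^sub>R (y - x))) * d) ^ p)"
      by (cases "t \<in> {0..1}") (auto intro!: ennreal_leI)
  qed
  finally show ?thesis .
qed

text \<open>The symmetric double integral avoids mean values. By convexity the segments between
  points of C stay in C, and for each fixed t the points of the segments are handled by an affine
  change of variables.\<close>

lemma poincare_smooth:
  fixes g :: "real^'n::finite \<Rightarrow> real^'n" and G :: "real^'n \<Rightarrow> real^'n^'n"
  assumes g: "continuous_on UNIV g" and G: "continuous_on UNIV G"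
    and derg: "\<And>x v. ((\<lambda>s. g (x + s *\<^sub>R v)) has_vector_derivative G x *v v) (at 0)"
    and p: "0 < p" and C: "compact C" "convex C"
    and d: "\<And>x y. x \<in> C \<Longrightarrow> y \<in> C \<Longrightarrow> norm (y - x) \<le> d" "0 \<le> d"
  shows "(\<integral>\<^sup>+x. \<integral>\<^sup>+y. indicator C x * (indicator C y
      * ennreal (norm (g y - g x) ^ p)) \<partial>lborel \<partial>lborel)
    \<le> ennreal (2 ^ CARD('n) * d ^ p) * emeasure lborel C * pintegral p C G"
proof -
  have [measurable]: "C \<in> sets borel" using C by (simp add: borel_compact)
  have [measurable]: "G \<in> borel_measurable borel" "g \<in> borel_measurable borel"
    using G g by (auto intro: borel_measurable_continuous_onI)
  \<comment> \<open>The indicator is built in so that integrating over the whole space, as after the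
    change of variables, still sees only C.\<close>
  define \<Phi> where "\<Phi> z = indicator C z * ennreal ((norm (G z) * d) ^ p)" for z
  have [measurable]: "\<Phi> \<in> borel_measurable borel" unfolding \<Phi>_def by measurable
  have pt: "indicator C x * (indicator C y * ennreal (norm (g y - g x) ^ p))
     \<le> (\<integral>\<^sup>+t. indicator {0..1::real} t * (indicator C x * (indicator C y * \<Phi> (x + t *\<^sub>R (y - x)))) \<partial>lborel)" for x y
  proof (cases "x \<in> C \<and> y \<in> C")
    case True
    have inC: "x + t *\<^sub>R (y - x) \<in> C" if "t \<in> {0..1}" for t
      using convexD_alt[OF C(2), of x y t] True that by (simp add: algebra_simps)
    have "ennreal (norm (g y - g x) ^ p) \<le>
        (\<integral>\<^sup>+t. indicator {0..1} t * ennreal ((norm (G (x + t *\<^sub>R (y - x))) * d) ^ p) \<partial>lborel)"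
      using True by (intro norm_diff_power_le_segment_integral[OF G derg p] d) auto
    also have "\<dots> = (\<integral>\<^sup>+t. indicator {0..1} t * \<Phi> (x + t *\<^sub>R (y - x)) \<partial>lborel)"
      using inC by (intro nn_integral_cong) (auto simp: \<Phi>_def indicator_def)
    finally show ?thesis using True by simp
  qed auto
  have "(\<integral>\<^sup>+x. \<integral>\<^sup>+y. indicator C x * (indicator C y
      * ennreal (norm (g y - g x) ^ p)) \<partial>lborel \<partial>lborel)
    \<le> (\<integral>\<^sup>+x. \<integral>\<^sup>+y. (\<integral>\<^sup>+t. indicator {0..1::real} t * (indicator C x * (indicator C y * \<Phi> (x + t *\<^sub>R (y - x)))) \<partial>lborel) \<partial>lborel \<partial>lborel)"
    by (intro nn_integral_mono pt)
  also have "\<dots> = (\<integral>\<^sup>+x. \<integral>\<^sup>+t. (\<integral>\<^sup>+y. indicator {0..1::real} t * (indicator C x * (indicator C y * \<Phi> (x + t *\<^sub>R (y - x)))) \<partial>lborel) \<partial>lborel \<partial>lborel)"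
    by (intro nn_integral_cong lborel_pair.Fubini') measurable
  also have "\<dots> = (\<integral>\<^sup>+t. \<integral>\<^sup>+x. (\<integral>\<^sup>+y. indicator {0..1::real} t * (indicator C x * (indicator C y * \<Phi> (x + t *\<^sub>R (y - x)))) \<partial>lborel) \<partial>lborel \<partial>lborel)"
    by (rule lborel_pair.Fubini') measurable
  also have "\<dots> = (\<integral>\<^sup>+t. indicator {0..1::real} t
      * (\<integral>\<^sup>+x. \<integral>\<^sup>+y. indicator C x * (indicator C y * \<Phi> (x + t *\<^sub>R (y - x))) \<partial>lborel \<partial>lborel) \<partial>lborel)"
    by (intro nn_integral_cong) (simp add: nn_integral_cmult)
  also have "\<dots> \<le> (\<integral>\<^sup>+t. indicator {0..1::real} t * (ennreal (2 ^ CARD('n))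
      * emeasure lborel C * (\<integral>\<^sup>+x. \<Phi> x \<partial>lborel)) \<partial>lborel)"
    using nn_integral_segment_le[of \<Phi> C] by (intro nn_integral_mono mult_left_mono) auto
  also have "\<dots> = ennreal (2 ^ CARD('n)) * emeasure lborel C * (\<integral>\<^sup>+x. \<Phi> x \<partial>lborel)"
    by (subst nn_integral_multc) auto
  also have "(\<integral>\<^sup>+x. \<Phi> x \<partial>lborel)
      = (\<integral>\<^sup>+x. ennreal (d ^ p) * (indicator C x * ennreal (norm (G x) ^ p)) \<partial>lborel)"
    using d(2) by (intro nn_integral_cong) (simp add: \<Phi>_def power_mult_distrib ennreal_mult mult_ac)
  also have "\<dots> = ennreal (d ^ p) * pintegral p C G"
    by (rule nn_integral_cmult) simp
  finally show ?thesis using d(2) by (simp add: ennreal_mult mult_ac)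
qed

text \<open>Passage to the limit from mollifications. The factor 4^p stems from two uses of the
  inequality for p-th powers of sums: from \<open>f\<close> to \<open>g\<close>, and from
  \<open>G\<close> back to \<open>D\<close>.\<close>

lemma poincare_double:
  fixes f :: "real^'n::finite \<Rightarrow> real^'n" and D :: "real^'n \<Rightarrow> real^'n^'n"
  assumes wd: "borel_weak_derivative f D"
    and int: "\<And>C. compact C \<Longrightarrow> set_integrable lborel C (\<lambda>x. norm (D x) ^ Suc m)"
    and C: "compact C" "convex C"
    and d: "\<And>x y. x \<in> C \<Longrightarrow> y \<in> C \<Longrightarrow> norm (y - x) \<le> d" "0 \<le> d"
  shows "(\<integral>\<^sup>+x. \<integral>\<^sup>+y. indicator C x * (indicator C y
      * ennreal (norm (f y - f x) ^ Suc m)) \<partial>lborel \<partial>lborel)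
    \<le> ennreal (4 ^ Suc m * 2 ^ CARD('n) * d ^ Suc m) * emeasure lborel C *
      pintegral (Suc m) C D"
proof (rule ennreal_le_epsilon)
  let ?p = "Suc m" and ?N = "CARD('n)"
  fix \<eta> :: real assume \<eta>: "0 < \<eta>"
  have [measurable]: "C \<in> sets borel" using C by (simp add: borel_compact)
  have f: "continuous_on UNIV f" and [measurable]: "D \<in> borel_measurable borel"
    using wd by (auto simp: borel_weak_derivative_def)
  have [measurable]: "f \<in> borel_measurable borel" using f by (rule borel_measurable_continuous_onI)
  define X where "X = pintegral ?p C D"
  define c where "c = measure lborel C"
  have c: "emeasure lborel C = ennreal c" "0 \<le> c"
    unfolding c_def using emeasure_compact_finite[OF C(1)] by (auto simp: emeasure_eq_ennreal_measure top.not_eq_extremum)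
  \<comment> \<open>The total coefficient of the approximation error in the final estimate.\<close>
  define B where "B = 2 ^ ?p * (2 ^ ?N * d ^ ?p * c * 2 ^ ?p + 2 ^ ?p * c * c)"
  have B: "0 \<le> B" using c d by (simp add: B_def)
  \<comment> \<open>At most 1, so that powers of the error are bounded by the error itself; the
    second bound makes B e at most \<eta>.\<close>
  define e where "e = min 1 (\<eta> / (B + 1))"
  have e: "0 < e" "e \<le> 1" "B * e \<le> \<eta>"
  proof -
    show "0 < e" "e \<le> 1" using B \<eta> by (auto simp: e_def)
    have "B * e \<le> (B + 1) * (\<eta> / (B + 1))" using B \<eta> by (intro mult_mono) (auto simp: e_def)
    then show "B * e \<le> \<eta>" using B by simp
  qed
  obtain g :: "real^'n \<Rightarrow> real^'n" and G :: "real^'n \<Rightarrow> real^'n^'n" and H where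
    g: "continuous_on UNIV g" "continuous_on UNIV G" and "\<And>i j k. continuous_on UNIV (H i j k)" and
    g': "\<And>x. x \<in> C \<Longrightarrow> norm (g x - f x) \<le> e"
    "pintegral ?p C (\<lambda>x. G x - D x) \<le> ennreal e"
    "\<And>x v. ((\<lambda>s. g (x + s *\<^sub>R v)) has_vector_derivative G x *v v) (at 0)"
    and "\<And>x i j k. ((\<lambda>s. G (x + s *\<^sub>R axis k 1) $ i $ j) has_real_derivative H i j k x) (at 0)"
    "\<And>i j k. H i j k = H i k j"
    by (rule smooth_approximation[OF wd int C(1) e(1)]) (assumption, (rule that; assumption))
  have [measurable]: "G \<in> borel_measurable borel" "g \<in> borel_measurable borel"
    using g by (auto intro: borel_measurable_continuous_onI)
  have GX: "pintegral ?p C G \<le> ennreal (2 ^ ?p) * (X + ennreal e)"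
    unfolding X_def
    by (rule order_trans[OF pintegral_triangle[of C G D]]) (auto intro!: mult_left_mono add_left_mono g'(2) simp del: power_Suc)
  have "(\<integral>\<^sup>+x. \<integral>\<^sup>+y. indicator C x * (indicator C y
      * ennreal (norm (f y - f x) ^ ?p)) \<partial>lborel \<partial>lborel)
    \<le> (\<integral>\<^sup>+x. \<integral>\<^sup>+y. ennreal (2 ^ ?p) * (indicator C x * (indicator C y * ennreal (norm (g y - g x) ^ ?p))
        + indicator C x * (indicator C y * ennreal (2 ^ ?p * e))) \<partial>lborel \<partial>lborel)"
  proof (intro nn_integral_mono)
    fix x y
    show "indicator C x * (indicator C y * ennreal (norm (f y - f x) ^ ?p))
      \<le> ennreal (2 ^ ?p) * (indicator C x * (indicator C y * ennreal (norm (g y - g x) ^ ?p))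
        + indicator C x * (indicator C y * ennreal (2 ^ ?p * e)))"
    proof (cases "x \<in> C \<and> y \<in> C")
      case True
      have "norm (f y - f x) \<le> norm (g y - g x) + norm ((f y - g y) + (g x - f x))"
        using norm_triangle_ineq[of "g y - g x" "(f y - g y) + (g x - f x)"] by simp
      also have "norm ((f y - g y) + (g x - f x)) \<le> norm (f y - g y) + norm (g x - f x)"
        by (rule norm_triangle_ineq)
      also have "\<dots> \<le> 2 * e" using g'(1)[of x] g'(1)[of y] True by (simp add: norm_minus_commute)
      finally have "norm (f y - f x) ^ ?p \<le> (norm (g y - g x) + 2 * e) ^ ?p"
        by (intro power_mono) auto
      also have "\<dots> \<le> 2 ^ ?p * (norm (g y - g x) ^ ?p + (2 * e) ^ ?p)"
        using e by (intro power_add_le) auto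
      also have "\<dots> \<le> 2 ^ ?p * (norm (g y - g x) ^ ?p + 2 ^ ?p * e)"
      proof -
        have "e ^ ?p \<le> e ^ 1" using e by (intro power_decreasing) auto
        then show ?thesis unfolding power_mult_distrib by (intro mult_left_mono add_left_mono) auto
      qed
      finally have "ennreal (norm (f y - f x) ^ ?p) \<le> ennreal (2 ^ ?p) * (ennreal (norm (g y - g x) ^ ?p)
          + ennreal (2 ^ ?p * e))"
        using e by (subst ennreal_plus[symmetric], simp, simp, subst ennreal_mult[symmetric]) (auto intro!: ennreal_leI)
      then show ?thesis using True by simp
    qed auto
  qed
  also have "\<dots> = ennreal (2 ^ ?p) * ((\<integral>\<^sup>+x. \<integral>\<^sup>+y. indicator C x
      * (indicator C y * ennreal (norm (g y - g x) ^ ?p)) \<partial>lborel \<partial>lborel)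
      + (\<integral>\<^sup>+x. \<integral>\<^sup>+y. indicator C x * (indicator C y * ennreal (2 ^ ?p * e)) \<partial>lborel \<partial>lborel))"
    by (simp add: nn_integral_cmult nn_integral_add)
  also have "(\<integral>\<^sup>+x. \<integral>\<^sup>+y. indicator C x * (indicator C y * ennreal (2 ^ ?p
      * e)) \<partial>lborel \<partial>lborel) = ennreal (2 ^ ?p * e * c * c)"
    using e c by (simp add: nn_integral_cmult nn_integral_multc ennreal_mult mult_ac)
  also have "ennreal (2 ^ ?p) * ((\<integral>\<^sup>+x. \<integral>\<^sup>+y. indicator C x * (indicator C y
      * ennreal (norm (g y - g x) ^ ?p)) \<partial>lborel \<partial>lborel)
      + ennreal (2 ^ ?p * e * c * c))
    \<le> ennreal (2 ^ ?p) * (ennreal (2 ^ ?N * d ^ ?p) * ennreal c * (ennreal (2 ^ ?p) * (X + ennreal e)) + ennreal (2 ^ ?p * e * c * c))"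
  proof (intro mult_left_mono add_right_mono)
    have "(\<integral>\<^sup>+x. \<integral>\<^sup>+y. indicator C x * (indicator C y
        * ennreal (norm (g y - g x) ^ ?p)) \<partial>lborel \<partial>lborel)
      \<le> ennreal (2 ^ ?N * d ^ ?p) * emeasure lborel C * pintegral ?p C G"
      by (rule poincare_smooth[OF g(1,2) g'(3) _ C d]) auto
    also have "\<dots> \<le> ennreal (2 ^ ?N * d ^ ?p) * ennreal c * (ennreal (2 ^ ?p) * (X + ennreal e))"
      unfolding c(1) by (rule mult_left_mono[OF GX]) simp
    finally show "(\<integral>\<^sup>+x. \<integral>\<^sup>+y. indicator C x * (indicator C y
        * ennreal (norm (g y - g x) ^ ?p)) \<partial>lborel \<partial>lborel)
      \<le> ennreal (2 ^ ?N * d ^ ?p) * ennreal c * (ennreal (2 ^ ?p) * (X + ennreal e))" .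
  qed simp
  also have "\<dots> = ennreal (4 ^ ?p * 2 ^ ?N * d ^ ?p) * ennreal c * X + ennreal (B * e)"
  proof -
    have "ennreal (2 ^ ?p) * (ennreal (2 ^ ?N * d ^ ?p) * ennreal c * (ennreal (2 ^ ?p) * (X + ennreal e))
        + ennreal (2 ^ ?p * e * c * c))
      = (ennreal (2 ^ ?p) * (ennreal (2 ^ ?N * d ^ ?p) * ennreal c * ennreal (2 ^ ?p))) * X
       + (ennreal (2 ^ ?p) * (ennreal (2 ^ ?N * d ^ ?p) * ennreal c * (ennreal (2 ^ ?p) * ennreal e) + ennreal (2 ^ ?p * e * c * c)))"
      by (simp only: distrib_left mult.assoc add.assoc)
    also have "ennreal (2 ^ ?p) * (ennreal (2 ^ ?N * d ^ ?p) * ennreal c * ennreal (2 ^ ?p))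
      = ennreal (2 ^ ?p * (2 ^ ?N * d ^ ?p * c * 2 ^ ?p))"
      using c d by (subst ennreal_mult[symmetric], simp, simp)+ simp
    also have "2 ^ ?p * (2 ^ ?N * d ^ ?p * c * 2 ^ ?p) = (2 * 2) ^ ?p * 2 ^ ?N * d ^ ?p * c"
      unfolding power_mult_distrib by simp
    also have "(2 * 2 :: real) = 4" by simp
    also have "ennreal (2 ^ ?p) * (ennreal (2 ^ ?N * d ^ ?p) * ennreal c * (ennreal (2 ^ ?p) * ennreal e)
        + ennreal (2 ^ ?p * e * c * c))
      = ennreal (2 ^ ?p * (2 ^ ?N * d ^ ?p * c * (2 ^ ?p * e) + 2 ^ ?p * e * c * c))"
      using c d e by (simp only: ennreal_mult ennreal_plus zero_le_power mult_nonneg_nonneg add_nonneg_nonneg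
          zero_le_numeral less_imp_le)
    also have "2 ^ ?p * (2 ^ ?N * d ^ ?p * c * (2 ^ ?p * e) + 2 ^ ?p * e * c * c) = B * e"
      by (simp add: B_def algebra_simps)
    finally show ?thesis using c d by (simp add: ennreal_mult)
  qed
  also have "\<dots> \<le> ennreal (4 ^ ?p * 2 ^ ?N * d ^ ?p) * ennreal c * X + ennreal \<eta>"
    by (intro add_left_mono ennreal_leI e)
  finally show "(\<integral>\<^sup>+x. \<integral>\<^sup>+y. indicator C x * (indicator C y
      * ennreal (norm (f y - f x) ^ ?p)) \<partial>lborel \<partial>lborel)
    \<le> ennreal (4 ^ ?p * 2 ^ ?N * d ^ ?p) * emeasure lborel C * pintegral ?p C D + ennreal \<eta>"
    unfolding c X_def .
qed

text \<open>Some y does at least as well as the average in the double integral, so the value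
  \<open>f y\<close> can play the role of the mean value of \<open>f\<close> on C.\<close>

lemma poincare:
  fixes f :: "real^'n::finite \<Rightarrow> real^'n" and D :: "real^'n \<Rightarrow> real^'n^'n"
  assumes wd: "borel_weak_derivative f D"
    and int: "\<And>C. compact C \<Longrightarrow> set_integrable lborel C (\<lambda>x. norm (D x) ^ Suc m)"
    and C: "compact C" "convex C" "0 < measure lborel C"
    and d: "\<And>x y. x \<in> C \<Longrightarrow> y \<in> C \<Longrightarrow> norm (y - x) \<le> d" "0 \<le> d"
  obtains y where "y \<in> C" "pintegral (Suc m) C (\<lambda>x. f x - f y)
    \<le> ennreal (4 ^ Suc m * 2 ^ CARD('n) * d ^ Suc m) * pintegral (Suc m) C D"
proof (rule ccontr)
  assume neg: "\<not> thesis"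
  let ?p = "Suc m"
  have [measurable]: "C \<in> sets borel" using C by (simp add: borel_compact)
  have f: "continuous_on UNIV f" and [measurable]: "D \<in> borel_measurable borel"
    using wd by (auto simp: borel_weak_derivative_def)
  have [measurable]: "f \<in> borel_measurable borel" using f by (rule borel_measurable_continuous_onI)
  have c: "emeasure lborel C = ennreal (measure lborel C)"
    using emeasure_compact_finite[OF C(1)] by (auto simp: emeasure_eq_ennreal_measure top.not_eq_extremum)
  define L where "L = ennreal (4 ^ ?p * 2 ^ CARD('n) * d ^ ?p) * pintegral ?p C D"
  define I where "I y = pintegral ?p C (\<lambda>x. f x - f y)" for y
  have [measurable]: "I \<in> borel_measurable borel" unfolding I_def by measurable
  have big: "L < I y" if "y \<in> C" for y
    using neg that \<open>\<And>y. y \<in> C \<Longrightarrow> _ y \<le> _ \<Longrightarrow> thesis\<close> unfolding L_def I_def by (meson not_le)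
  have "pintegral ?p C D < \<infinity>"
  proof -
    have "integrable lborel (\<lambda>x. indicator C x * norm (D x) ^ ?p)"
      using int[OF C(1)] by (simp add: set_integrable_def)
    then have "(\<integral>\<^sup>+x. ennreal (norm (indicator C x * norm (D x) ^ ?p)) \<partial>lborel) < \<infinity>"
      by (simp only: integrable_iff_bounded)
    also have "(\<integral>\<^sup>+x. ennreal (norm (indicator C x * norm (D x) ^ ?p)) \<partial>lborel)
        = pintegral ?p C D"
      by (intro nn_integral_cong) (auto simp: indicator_def)
    finally show ?thesis .
  qed
  then have Lfin: "L < \<infinity>" unfolding L_def by (simp add: ennreal_mult_less_top)
  \<comment> \<open>Strictness survives integration because C has positive measure and the smaller
    integral is finite.\<close>
  have "(\<integral>\<^sup>+y. indicator C y * L \<partial>lborel) < (\<integral>\<^sup>+y. indicator C y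
      * I y \<partial>lborel)"
  proof (rule nn_integral_less)
    show "(\<integral>\<^sup>+y. indicator C y * L \<partial>lborel) \<noteq> \<infinity>"
      using Lfin c by (simp add: nn_integral_multc ennreal_mult_eq_top_iff)
    show "AE y in lborel. indicator C y * L \<le> indicator C y * I y"
      using big by (intro AE_I2) (auto simp: indicator_def less_imp_le)
    show "\<not> (AE y in lborel. indicator C y * I y \<le> indicator C y * L)"
    proof
      assume "AE y in lborel. indicator C y * I y \<le> indicator C y * L"
      then have "AE y in lborel. y \<notin> C"
      proof eventually_elim
        case (elim y)
        then show ?case using big[of y] by (auto simp: not_le)
      qed
      then have "C \<in> null_sets lborel" by (subst AE_iff_null_sets) auto
      then show False using C(3) by (simp add: measure_def null_sets_def)
    qed
  qed auto
  also have "(\<integral>\<^sup>+y. indicator C y * I y \<partial>lborel)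
      = (\<integral>\<^sup>+y. \<integral>\<^sup>+x. indicator C y * (indicator C x * ennreal (norm (f x - f y) ^ ?p)) \<partial>lborel \<partial>lborel)"
    unfolding I_def by (simp add: nn_integral_cmult)
  also have "\<dots> \<le> ennreal (4 ^ ?p * 2 ^ CARD('n) * d ^ ?p) * emeasure lborel C *
      pintegral ?p C D"
    by (rule poincare_double[OF wd int C(1,2) d])
  also have "\<dots> = (\<integral>\<^sup>+y. indicator C y * L \<partial>lborel)"
    by (simp add: nn_integral_multc L_def mult_ac)
  finally show False by simp
qed

section \<open>Hole filling\<close>

text \<open>The matrix norm is the Euclidean one, which suits the integral estimates; comparison
  with the operator norm only enlarges K.\<close>

locale distortion_inequality =
  fixes f :: "real^'n::finite \<Rightarrow> real^'n" and D :: "real^'n \<Rightarrow> real^'n^'n" and K :: real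
  assumes weak_deriv: "borel_weak_derivative f D"
    and Ln_loc: "\<And>C. compact C \<Longrightarrow> set_integrable lborel C (\<lambda>x. norm (D x) ^ CARD('n))"
    and K_pos: "0 < K"
    and distortion: "AE x in lborel. norm (D x) ^ CARD('n) \<le> K * det (D x)"
begin

lemma continuous_f: "continuous_on A f"
  using weak_deriv by (auto simp: borel_weak_derivative_def intro: continuous_on_subset)

lemma f_measurable [measurable]: "f \<in> borel_measurable borel"
  using continuous_f by (rule borel_measurable_continuous_onI)

lemma D_measurable [measurable]: "D \<in> borel_measurable borel"
  using weak_deriv by (simp add: borel_weak_derivative_def)

lemma det_D_measurable [measurable]: "(\<lambda>x. det (D x)) \<in> borel_measurable borel"
  by (rule borel_measurable_continuous_on[OF _ D_measurable])
    (unfold det_def, intro continuous_intros)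

definition energy :: "(real^'n) set \<Rightarrow> ennreal" where
  "energy S = pintegral CARD('n) S D"

lemma energy_mono: "S \<subseteq> T \<Longrightarrow> energy S \<le> energy T"
  unfolding energy_def by (intro nn_integral_mono mult_right_mono) (auto simp: indicator_def)

lemma energy_Un:
  assumes "S \<in> sets borel" "T \<in> sets borel" "S \<inter> T = {}"
  shows "energy (S \<union> T) = energy S + energy T"
proof -
  have "energy (S \<union> T) = (\<integral>\<^sup>+x. indicator S x * ennreal (norm (D x) ^ CARD('n))
      + indicator T x * ennreal (norm (D x) ^ CARD('n)) \<partial>lborel)"
    unfolding energy_def using assms(3) by (intro nn_integral_cong) (auto simp: indicator_def)
  also have "\<dots> = energy S + energy T"
    unfolding energy_def using assms by (intro nn_integral_add) auto
  finally show ?thesis .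
qed

lemma integrable_energy: "compact C \<Longrightarrow> integrable lborel (\<lambda>x. indicator C x
    * norm (D x) ^ CARD('n))"
  using Ln_loc[of C] by (simp add: set_integrable_def)

lemma energy_eq: "compact C \<Longrightarrow> energy C = ennreal (\<integral>x. indicator C x
    * norm (D x) ^ CARD('n) \<partial>lborel)"
  unfolding energy_def
  by (subst nn_integral_eq_integral[symmetric, OF integrable_energy])
    (auto intro!: nn_integral_cong simp: indicator_def)

text \<open>The smooth inequality is transferred to weak derivatives. On the left,
  \<open>det_diff_le\<close> replaces \<open>det (D x)\<close> by the determinant of the
  approximation; on the right, returning from the approximation to \<open>f\<close> and
  \<open>D\<close> costs the factor 2^n.\<close>

lemma caccioppoli_limit:
  assumes \<phi>: "continuous_on UNIV \<phi>" "\<And>j. continuous_on UNIV (\<phi>1 j)" "\<And>x. 0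
      \<le> \<phi> x" "\<And>x. \<phi> x \<le> 1"
      "\<And>x. \<phi> x \<noteq> 0 \<Longrightarrow> x \<in> Q" "\<And>x j. \<phi>1 j x \<noteq> 0 \<Longrightarrow>
          x \<in> A" "\<And>x j. \<bar>\<phi>1 j x\<bar> \<le> M"
      "\<And>x j. ((\<lambda>s. \<phi> (x + s *\<^sub>R axis j 1)) has_real_derivative \<phi>1 j x) (at 0)"
    and Q: "compact Q" and A: "compact A" "A \<subseteq> Q"
  shows "(\<integral>x. \<phi> x * det (D x) \<partial>lborel) \<le> fact CARD('n) * 2 ^ CARD('n) *
    (\<integral>x. indicator A x * ((M * norm (f x - c)) ^ CARD('n) + norm (D x) ^ CARD('n)) \<partial>lborel)"
    (is "_ \<le> ?F * ?Y")
proof (rule field_le_epsilon)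
  let ?n = "CARD('n)"
  obtain m where m: "?n = Suc m" using not0_implies_Suc[of ?n] by auto
  fix \<eta> :: real assume \<eta>: "0 < \<eta>"
  have M: "0 \<le> M" using \<phi>(7)[of undefined undefined] by simp
  have [measurable]: "A \<in> sets borel" "Q \<in> sets borel" using A Q by (auto simp: borel_compact)
  have [measurable]: "\<phi> \<in> borel_measurable borel" using \<phi>(1) by (rule borel_measurable_continuous_onI)
  obtain r where r: "\<forall>x\<in>Q. norm x \<le> r" using compact_imp_bounded[OF Q] bounded_iff by blast
  define EQ where "EQ = (\<integral>x. indicator Q x * norm (D x) ^ ?n \<partial>lborel)"
  have EQ: "0 \<le> EQ" unfolding EQ_def by (intro integral_nonneg_AE) auto
  \<comment> \<open>The relative error allowed for the determinant: times the energy of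
    \<open>Q\<close> it uses up half of \<eta>.\<close>
  define \<kappa> where "\<kappa> = \<eta> / 2 / (EQ + 1)"
  have \<kappa>: "0 < \<kappa>" "\<kappa> * EQ \<le> \<eta> / 2"
  proof -
    show "0 < \<kappa>" using EQ \<eta> by (simp add: \<kappa>_def)
    have "\<kappa> * EQ \<le> \<kappa> * (EQ + 1)" using \<open>0 < \<kappa>\<close> by (intro mult_left_mono) auto
    also have "EQ + 1 \<noteq> 0" using EQ by simp
    then have "\<kappa> * (EQ + 1) = \<eta> / 2" using \<kappa>_def nonzero_eq_divide_eq by blast
    finally show "\<kappa> * EQ \<le> \<eta> / 2" .
  qed
  obtain C where C: "0 \<le> C"
    "\<And>A B :: real^'n^'n. \<bar>det A - det B\<bar> \<le> \<kappa> * norm A ^ ?n + C * norm (A - B) ^ ?n"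
    using det_diff_le[OF \<kappa>(1)] by blast
  define \<mu> where "\<mu> = measure lborel A"
  have \<mu>: "0 \<le> \<mu>" by (simp add: \<mu>_def)
  \<comment> \<open>Collects everything that multiplies e: the constant of the determinant estimate
    on the left, and the uniform and mean errors over \<open>A\<close> on the right.\<close>
  define B where "B = C + ?F * (M ^ ?n * \<mu> + 1)"
  have B: "0 \<le> B" using C M \<mu> by (simp add: B_def)
  define e where "e = min 1 (\<eta> / 2 / (B + 1))"
  have e: "0 < e" "e \<le> 1" "B * e \<le> \<eta> / 2"
  proof -
    show "0 < e" "e \<le> 1" using B \<eta> by (auto simp: e_def)
    have "B * e \<le> (B + 1) * (\<eta> / 2 / (B + 1))" using B \<eta> by (intro mult_mono) (auto simp: e_def)
    also have "\<dots> = \<eta> / 2 / (B + 1) * (B + 1)" by (rule mult.commute)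
    also have "B + 1 \<noteq> 0" using B by simp
    then have "\<eta> / 2 / (B + 1) * (B + 1) = \<eta> / 2" using nonzero_eq_divide_eq by blast
    finally show "B * e \<le> \<eta> / 2" .
  qed
  obtain g :: "real^'n \<Rightarrow> real^'n" and G :: "real^'n \<Rightarrow> real^'n^'n" and H where
    g: "continuous_on UNIV g" "continuous_on UNIV G" and H: "\<And>i j k. continuous_on UNIV (H i j k)" and
    close: "\<And>x. x \<in> Q \<Longrightarrow> norm (g x - f x) \<le> e"
    "pintegral (Suc m) Q (\<lambda>x. G x - D x) \<le> ennreal e" and
    derg: "\<And>x v. ((\<lambda>s. g (x + s *\<^sub>R v)) has_vector_derivative G x *v v) (at 0)"
    and derG: "\<And>x i j k. ((\<lambda>s. G (x + s *\<^sub>R axis k 1) $ i $ j) has_real_derivative H i j k x) (at 0)"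
    and sym: "\<And>i j k. H i j k = H i k j"
    by (rule smooth_approximation[OF weak_deriv Ln_loc[unfolded m] Q e(1)]) (assumption, (rule that; assumption))
  have [measurable]: "G \<in> borel_measurable borel" "g \<in> borel_measurable borel"
    using g by (auto intro: borel_measurable_continuous_onI)
  have iDG: "integrable lborel (\<lambda>x. indicator Q x * norm (G x - D x) ^ ?n)"
    and DGe: "(\<integral>x. indicator Q x * norm (G x - D x) ^ ?n \<partial>lborel) \<le> e"
  proof -
    have eq: "(\<integral>\<^sup>+x. ennreal (indicator Q x * norm (G x - D x) ^ ?n) \<partial>lborel) \<le> ennreal e"
      using close(2) unfolding m
      by (rule order_trans[rotated]) (auto intro!: nn_integral_mono simp: indicator_def)
    show i: "integrable lborel (\<lambda>x. indicator Q x * norm (G x - D x) ^ ?n)"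
      using eq by (intro integrableI_nonneg) (auto simp: le_less_trans)
    have "ennreal (\<integral>x. indicator Q x * norm (G x - D x) ^ ?n \<partial>lborel) \<le> ennreal e"
      using eq nn_integral_eq_integral[OF i] by simp
    then show "(\<integral>x. indicator Q x * norm (G x - D x) ^ ?n \<partial>lborel) \<le> e"
      using e by simp
  qed
  have iD: "integrable lborel (\<lambda>x. indicator Q x * norm (D x) ^ ?n)" by (rule integrable_energy[OF Q])
  have iDA: "integrable lborel (\<lambda>x. indicator A x * norm (D x) ^ ?n)" by (rule integrable_energy[OF A(1)])
  have iDGA: "integrable lborel (\<lambda>x. indicator A x * norm (G x - D x) ^ ?n)"
    by (rule Bochner_Integration.integrable_bound[OF iDG]) (use A in \<open>auto simp: indicator_def\<close>)
  have "continuous_on A (\<lambda>x. (M * norm (f x - c)) ^ ?n)"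
    by (intro continuous_intros continuous_f)
  from borel_integrable_compact[OF A(1) this]
  have ifA: "integrable lborel (\<lambda>x. indicator A x * (M * norm (f x - c)) ^ ?n)" by simp
  have i1A: "integrable lborel (indicator A :: _ \<Rightarrow> real)"
    using borel_integrable_compact[OF A(1), of "\<lambda>_. 1 :: real"] by simp
  have \<phi>Q: "\<bar>\<phi> x\<bar> \<le> indicator Q x" for x
    using \<phi>(3-5)[of x] by (auto simp: indicator_def)
  have iA: "integrable lborel (\<lambda>x. \<phi> x * det (D x))"
  proof (rule Bochner_Integration.integrable_bound)
    show "integrable lborel (\<lambda>x. fact ?n * (indicator Q x * norm (D x) ^ ?n))" using iD by simp
    show "AE x in lborel. norm (\<phi> x * det (D x)) \<le> norm (fact ?n * (indicator Q x * norm (D x) ^ ?n))"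
    proof (rule AE_I2)
      fix x
      have "\<bar>\<phi> x\<bar> * \<bar>det (D x)\<bar> \<le> indicator Q x * (fact ?n * norm (D x) ^ ?n)"
        by (intro mult_mono \<phi>Q abs_det_le) auto
      then show "norm (\<phi> x * det (D x)) \<le> norm (fact ?n * (indicator Q x * norm (D x) ^ ?n))"
        by (simp add: abs_mult mult_ac)
    qed
  qed simp
  have "continuous_on UNIV (\<lambda>x. \<phi> x * det (G x))"
    unfolding det_def by (intro continuous_intros \<phi> g)
  moreover have "set_integrable lborel Q (\<lambda>_. 1 :: real)"
    unfolding set_integrable_def by (intro borel_integrable_compact Q) auto
  ultimately have iG: "integrable lborel (\<lambda>x. \<phi> x * det (G x))"
    using integrable_continuous_scaleR[of "\<lambda>x. \<phi> x * det (G x)" Q "\<lambda>_. 1 :: real"] \<phi>(5) Q by simp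
  have "(\<integral>x. \<phi> x * det (D x) \<partial>lborel) - (\<integral>x. \<phi> x * det (G x) \<partial>lborel)
     = (\<integral>x. \<phi> x * det (D x) - \<phi> x * det (G x) \<partial>lborel)"
    using iA iG by simp
  also have "\<dots> \<le> (\<integral>x. \<kappa> * (indicator Q x * norm (D x) ^ ?n) + C * (indicator Q x
      * norm (G x - D x) ^ ?n) \<partial>lborel)"
  proof (rule integral_mono)
    fix x
    have "\<phi> x * (det (D x) - det (G x)) \<le> \<bar>\<phi> x\<bar> * \<bar>det (D x) - det (G x)\<bar>"
      by (metis abs_ge_self abs_mult)
    also have "\<dots> \<le> indicator Q x * (\<kappa> * norm (D x) ^ ?n + C * norm (D x - G x) ^ ?n)"
      by (intro mult_mono \<phi>Q C) auto
    finally show "\<phi> x * det (D x) - \<phi> x * det (G x)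
        \<le> \<kappa> * (indicator Q x * norm (D x) ^ ?n) + C * (indicator Q x * norm (G x - D x) ^ ?n)"
      by (simp add: algebra_simps norm_minus_commute)
  qed (use iA iG iD iDG in auto)
  also have "\<dots> = \<kappa> * EQ + C * (\<integral>x. indicator Q x * norm (G x - D x) ^ ?n \<partial>lborel)"
    using iD iDG by (simp add: EQ_def)
  also have "\<dots> \<le> \<eta> / 2 + C * e"
    using \<kappa> DGe C by (intro add_mono mult_left_mono) auto
  finally have 1: "(\<integral>x. \<phi> x * det (D x) \<partial>lborel)
      \<le> (\<integral>x. \<phi> x * det (G x) \<partial>lborel) + \<eta> / 2 + C * e" by simp
  have "\<bar>\<integral>x. \<phi> x * det (G x) \<partial>lborel\<bar> \<le> fact ?n *
    (\<integral>x. indicator A x * ((M * norm (g x - c)) ^ ?n + norm (G x) ^ ?n) \<partial>lborel)"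
    by (rule caccioppoli_smooth[OF g H derg derG sym \<phi>(1,2) _ \<phi>(6,7,8) A(1), where r = r])
      (use r \<phi>(5) A in auto)
  also have "\<dots> \<le> fact ?n * (\<integral>x. 2 ^ ?n * (indicator A x * (M * norm (f x - c)) ^ ?n
     + M ^ ?n * e * indicator A x + indicator A x * norm (D x) ^ ?n + indicator A x * norm (G x - D x) ^ ?n) \<partial>lborel)"
  proof (intro mult_left_mono integral_mono)
    have "continuous_on A (\<lambda>x. (M * norm (g x - c)) ^ ?n + norm (G x) ^ ?n)"
      by (intro continuous_intros continuous_on_subset[OF g(1)] continuous_on_subset[OF g(2)]) auto
    from borel_integrable_compact[OF A(1) this]
    show "integrable lborel (\<lambda>x. indicator A x * ((M * norm (g x - c)) ^ ?n + norm (G x) ^ ?n))" by simp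
    show "integrable lborel (\<lambda>x. 2 ^ ?n * (indicator A x * (M * norm (f x - c)) ^ ?n
     + M ^ ?n * e * indicator A x + indicator A x * norm (D x) ^ ?n + indicator A x * norm (G x - D x) ^ ?n))"
      using ifA i1A iDA iDGA by simp
    fix x
    show "indicator A x * ((M * norm (g x - c)) ^ ?n + norm (G x) ^ ?n)
        \<le> 2 ^ ?n * (indicator A x * (M * norm (f x - c)) ^ ?n
     + M ^ ?n * e * indicator A x + indicator A x * norm (D x) ^ ?n + indicator A x * norm (G x - D x) ^ ?n)"
    proof (cases "x \<in> A")
      case True
      have "norm (g x - c) \<le> norm (f x - c) + e"
        using close(1)[of x] True A norm_triangle_ineq[of "f x - c" "g x - f x"] by auto
      then have "(M * norm (g x - c)) ^ ?n \<le> (M * norm (f x - c) + M * e) ^ ?n"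
        using M by (intro power_mono) (auto simp: mult_left_mono simp flip: distrib_left)
      also have "\<dots> \<le> 2 ^ ?n * ((M * norm (f x - c)) ^ ?n + (M * e) ^ ?n)"
        using M e by (intro power_add_le) auto
      also have "(M * e) ^ ?n \<le> M ^ ?n * e"
      proof -
        have "e ^ ?n \<le> e ^ 1" using e m by (intro power_decreasing) auto
        then show ?thesis using M unfolding power_mult_distrib by (intro mult_left_mono) auto
      qed
      finally have a: "(M * norm (g x - c)) ^ ?n \<le> 2 ^ ?n * ((M * norm (f x - c)) ^ ?n + M ^ ?n * e)" by simp
      have "norm (G x) ^ ?n \<le> (norm (D x) + norm (G x - D x)) ^ ?n"
        by (intro power_mono norm_triangle_sub) auto
      also have "\<dots> \<le> 2 ^ ?n * (norm (D x) ^ ?n + norm (G x - D x) ^ ?n)" by (rule power_add_le) auto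
      finally show ?thesis using a True by (simp add: algebra_simps)
    qed simp
  qed auto
  also have "\<dots> = ?F * (?Y + M ^ ?n * e * \<mu> + (\<integral>x. indicator A x
      * norm (G x - D x) ^ ?n \<partial>lborel))"
    using ifA i1A iDA iDGA by (simp add: \<mu>_def distrib_left)
  also have "\<dots> \<le> ?F * (?Y + M ^ ?n * e * \<mu> + e)"
  proof (intro mult_left_mono add_left_mono)
    have "(\<integral>x. indicator A x * norm (G x - D x) ^ ?n \<partial>lborel)
        \<le> (\<integral>x. indicator Q x * norm (G x - D x) ^ ?n \<partial>lborel)"
      using A by (intro integral_mono iDG iDGA) (auto simp: indicator_def)
    then show "(\<integral>x. indicator A x * norm (G x - D x) ^ ?n \<partial>lborel) \<le> e" using DGe by simp
  qed auto
  finally have 2: "(\<integral>x. \<phi> x * det (G x) \<partial>lborel)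
      \<le> ?F * (?Y + M ^ ?n * e * \<mu> + e)" by simp
  have "(\<integral>x. \<phi> x * det (D x) \<partial>lborel) \<le> ?F * ?Y + \<eta> / 2 + B * e"
    using 1 2 by (simp add: B_def algebra_simps)
  then show "(\<integral>x. \<phi> x * det (D x) \<partial>lborel) \<le> ?F * ?Y + \<eta>" using e by simp
qed

text \<open>Closed, hence compact, at the price of sharing its inner boundary with
  \<open>cube a R\<close>; disjointness is obtained later by passing to a smaller cube.\<close>

definition annulus :: "real^'n \<Rightarrow> real \<Rightarrow> (real^'n) set" where
  "annulus a R = {x \<in> cube a (2 * R). \<exists>j. R \<le> \<bar>x $ j - a $ j\<bar>}"

lemma compact_annulus: "compact (annulus a R)"
proof -
  have "annulus a R = cube a (2 * R) \<inter> (\<Union>j. {x. R \<le> \<bar>x $ j - a $ j\<bar>})"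
    by (auto simp: annulus_def)
  moreover have "closed (\<Union>j. {x. R \<le> \<bar>x $ j - a $ j\<bar>})"
    by (intro closed_UN finite closed_Collect_le continuous_intros ballI)
  ultimately show ?thesis by (simp add: compact_Int_closed)
qed

lemma annulus_subset: "annulus a R \<subseteq> cube a (2 * R)"
  by (auto simp: annulus_def)

text \<open>The energy weighted by the cutoff is at most K times the weighted Jacobian integral, and
  this is governed by the annulus, where the cutoff is not constant. The constant c is free, to be
  chosen by a Poincare inequality.\<close>

lemma caccioppoli:
  assumes R: "0 < R"
  shows "energy (cube a R) \<le> ennreal (K * fact CARD('n) * 2 ^ CARD('n)) *
    ((\<integral>\<^sup>+x. indicator (annulus a R) x * ennreal ((4 / R * norm (f x - c)) ^ CARD('n)) \<partial>lborel)
      + energy (annulus a R))"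
proof -
  let ?n = "CARD('n)" and ?A = "annulus a R" and ?Q = "cube a (2 * R)"
  obtain \<phi> :: "real^'n \<Rightarrow> real" and \<phi>1 where
    c\<phi>: "continuous_on UNIV \<phi>" "\<And>j. continuous_on UNIV (\<phi>1 j)" and
    b\<phi>: "\<And>x. 0 \<le> \<phi> x" "\<And>x. \<phi> x \<le> 1" and one: "\<And>x. x \<in> cube a R \<Longrightarrow>
        \<phi> x = 1" and
    s\<phi>: "\<And>x. \<phi> x \<noteq> 0 \<Longrightarrow> x \<in> ?Q" and s\<phi>1: "\<And>x j. \<phi>1 j x \<noteq> 0 \<Longrightarrow> x \<in> ?Q \<and> R \<le> \<bar>x $ j - a $ j\<bar>" and
    m\<phi>: "\<And>x j. \<bar>\<phi>1 j x\<bar> \<le> 4 / R" and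
    d\<phi>: "\<And>x j. ((\<lambda>s. \<phi> (x + s *\<^sub>R axis j 1)) has_real_derivative \<phi>1 j x) (at 0)"
    by (rule cutoff_exists[OF R]) (rule that; assumption)
  have [measurable]: "\<phi> \<in> borel_measurable borel" using c\<phi>(1) by (rule borel_measurable_continuous_onI)
  have [measurable]: "?A \<in> sets borel" using compact_annulus by (rule borel_compact)
  have sA: "x \<in> ?A" if "\<phi>1 j x \<noteq> 0" for x j using s\<phi>1[OF that] by (auto simp: annulus_def)
  define Y where "Y = (\<integral>x. indicator ?A x * ((4 / R * norm (f x - c)) ^ ?n
      + norm (D x) ^ ?n) \<partial>lborel)"
  have lim: "(\<integral>x. \<phi> x * det (D x) \<partial>lborel) \<le> fact ?n * 2 ^ ?n * Y"
    unfolding Y_def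
    by (rule caccioppoli_limit[OF c\<phi> b\<phi> s\<phi> sA m\<phi> d\<phi> compact_cube compact_annulus annulus_subset])
  have \<phi>Q: "\<phi> x \<le> indicator ?Q x" for x
    using b\<phi>(2)[of x] s\<phi>[of x] by (cases "\<phi> x = 0") auto
  have i\<phi>: "integrable lborel (\<lambda>x. \<phi> x * norm (D x) ^ ?n)"
    by (rule Bochner_Integration.integrable_bound[OF integrable_energy[OF compact_cube, of a "2 * R"]])
      (use b\<phi>(1) \<phi>Q in \<open>auto simp: abs_mult intro!: AE_I2 mult_right_mono\<close>)
  have "continuous_on ?A (\<lambda>x. (4 / R * norm (f x - c)) ^ ?n)"
    using R by (intro continuous_intros continuous_f)
  from borel_integrable_compact[OF compact_annulus this]
  have ifA: "integrable lborel (\<lambda>x. indicator ?A x * (4 / R * norm (f x - c)) ^ ?n)" by simp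
  have "energy (cube a R) \<le> (\<integral>\<^sup>+x. ennreal (\<phi> x * norm (D x) ^ ?n) \<partial>lborel)"
    unfolding energy_def using one by (intro nn_integral_mono) (auto simp: indicator_def)
  also have "\<dots> = ennreal (\<integral>x. \<phi> x * norm (D x) ^ ?n \<partial>lborel)"
    using i\<phi> b\<phi> by (intro nn_integral_eq_integral) auto
  also have "(\<integral>x. \<phi> x * norm (D x) ^ ?n \<partial>lborel)
      \<le> (\<integral>x. K * (\<phi> x * det (D x)) \<partial>lborel)"
  proof (rule integral_mono_AE)
    have "integrable lborel (\<lambda>x. \<phi> x * det (D x))"
    proof (rule Bochner_Integration.integrable_bound)
      show "integrable lborel (\<lambda>x. fact ?n * (\<phi> x * norm (D x) ^ ?n))" using i\<phi> by simp
      show "AE x in lborel. norm (\<phi> x * det (D x)) \<le> norm (fact ?n * (\<phi> x * norm (D x) ^ ?n))"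
      proof (rule AE_I2)
        fix x
        have "\<bar>\<phi> x\<bar> * \<bar>det (D x)\<bar> \<le> \<bar>\<phi> x\<bar> * (fact ?n * norm (D x) ^ ?n)"
          by (intro mult_left_mono abs_det_le) auto
        then show "norm (\<phi> x * det (D x)) \<le> norm (fact ?n * (\<phi> x * norm (D x) ^ ?n))"
          by (simp add: abs_mult mult_ac)
      qed
    qed simp
    then show "integrable lborel (\<lambda>x. K * (\<phi> x * det (D x)))" by simp
    show "AE x in lborel. \<phi> x * norm (D x) ^ ?n \<le> K * (\<phi> x * det (D x))"
      using distortion
    proof eventually_elim
      case (elim x)
      then have "\<phi> x * norm (D x) ^ ?n \<le> \<phi> x * (K * det (D x))" using b\<phi> by (intro mult_left_mono)
      then show ?case by (simp add: mult_ac)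
    qed
  qed (rule i\<phi>)
  also have "(\<integral>x. K * (\<phi> x * det (D x)) \<partial>lborel) \<le> K * (fact ?n * 2 ^ ?n * Y)"
    using lim K_pos by simp
  also have "ennreal (K * (fact ?n * 2 ^ ?n * Y)) = ennreal (K * fact ?n * 2 ^ ?n) * ennreal Y"
    using K_pos by (simp add: ennreal_mult' mult.assoc)
  also have "ennreal Y = (\<integral>\<^sup>+x. ennreal (indicator ?A x * ((4 / R * norm (f x - c)) ^ ?n
      + norm (D x) ^ ?n)) \<partial>lborel)"
    unfolding Y_def using ifA integrable_energy[OF compact_annulus, of a R] R
    by (intro nn_integral_eq_integral[symmetric]) (auto simp: distrib_left)
  also have "\<dots> = (\<integral>\<^sup>+x. indicator ?A x * ennreal ((4 / R * norm (f x - c)) ^ ?n)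
      + indicator ?A x * ennreal (norm (D x) ^ ?n) \<partial>lborel)"
    using R by (intro nn_integral_cong) (auto simp: indicator_def)
  also have "\<dots> = (\<integral>\<^sup>+x. indicator ?A x * ennreal ((4 / R
      * norm (f x - c)) ^ ?n) \<partial>lborel) + energy ?A"
    unfolding energy_def by (rule nn_integral_add) auto
  finally show ?thesis by (simp add: ennreal_leI)
qed

end

section \<open>Poincare inequality on annuli and energy decay\<close>

lemma measure_cube: "0 \<le> r \<Longrightarrow> measure lborel (cube a r)
    = (2 * r) ^ CARD('n)" for a :: "real^'n::finite"
  by (subst cube_eq_cbox, subst content_cbox_cart) (auto simp: interval_ne_empty_cart)

lemma emeasure_cube: "0 \<le> r \<Longrightarrow> emeasure lborel (cube a r)
    = ennreal ((2 * r) ^ CARD('n))" for a :: "real^'n::finite"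
  using emeasure_compact_finite[OF compact_cube, of a r] measure_cube[of r a]
  by (subst emeasure_eq_ennreal_measure) (auto simp: top.not_eq_extremum)

lemma cube_norm_diff_le:
  fixes a :: "real^'n::finite"
  assumes "x \<in> cube a r" "y \<in> cube a r"
  shows "norm (y - x) \<le> 2 * r * CARD('n)"
proof -
  have "norm (y - x) \<le> (\<Sum>i\<in>UNIV. \<bar>(y - x) $ i\<bar>)" by (rule norm_le_l1_cart)
  also have "\<dots> \<le> (\<Sum>i\<in>(UNIV::'n set). 2 * r)"
  proof (rule sum_mono)
    fix i show "\<bar>(y - x) $ i\<bar> \<le> 2 * r"
      using assms[unfolded cube_def, simplified, rule_format, of i] by simp
  qed
  finally show ?thesis by (simp add: mult_ac)
qed

lemma cube_subset: "(\<And>i. \<bar>b $ i - a $ i\<bar> + s \<le> r) \<Longrightarrow> cube b s \<subseteq> cube a r"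
proof
  fix x assume le: "\<And>i. \<bar>b $ i - a $ i\<bar> + s \<le> r" and x: "x \<in> cube b s"
  have "\<bar>x $ i - a $ i\<bar> \<le> r" for i
  proof -
    have "\<bar>x $ i - b $ i\<bar> \<le> s" using x by (simp add: cube_def)
    then show ?thesis using le[of i] by linarith
  qed
  then show "x \<in> cube a r" by (simp add: cube_def)
qed

context distortion_inequality
begin

text \<open>The inner cube guarantees positive measure, the outer one bounds the diameter by
  2rn.\<close>

lemma poincare_convex:
  fixes r :: real
  assumes C: "compact C" "convex C" and b: "cube b s \<subseteq> C" "0 < s" and a: "C \<subseteq> cube a r"
  obtains y where "y \<in> C" "pintegral CARD('n) C (\<lambda>x. f x - f y)
    \<le> ennreal ((16 * real CARD('n)) ^ CARD('n) * r ^ CARD('n)) * energy C"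
proof -
  let ?n = "CARD('n)"
  obtain m where m: "?n = Suc m" using not0_implies_Suc[of ?n] by auto
  have "b \<in> cube b s" using b by (simp add: cube_def)
  then have "b \<in> cube a r" using a b by auto
  then have r: "0 \<le> r" unfolding cube_def using abs_ge_zero order_trans by blast
  have pos: "0 < measure lborel C"
  proof -
    have "0 < measure lborel (cube b s)" using b(2) by (simp add: measure_cube)
    also have "\<dots> \<le> measure lborel C"
      using b C emeasure_compact_finite[OF C(1)]
      by (intro measure_mono_fmeasurable) (auto simp: fmeasurable_def borel_compact)
    finally show ?thesis .
  qed
  have d: "norm (y - x) \<le> 2 * r * ?n" if "x \<in> C" "y \<in> C" for x y
    using that a by (intro cube_norm_diff_le) auto
  obtain y where y: "y \<in> C" "pintegral (Suc m) C (\<lambda>x. f x - f y)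
    \<le> ennreal (4 ^ Suc m * 2 ^ CARD('n) * (2 * r * ?n) ^ Suc m) * pintegral (Suc m) C D"
    using poincare[OF weak_deriv Ln_loc[unfolded m] C pos d] r by auto
  \<comment> \<open>Origin of 16n: the base is 4 * 2 * (2rn).\<close>
  have "4 ^ ?n * 2 ^ ?n * (2 * r * ?n) ^ ?n = (4 * 2 * (2 * r * ?n)) ^ ?n"
    by (simp only: power_mult_distrib)
  also have "\<dots> = (16 * real ?n * r) ^ ?n" by (simp add: mult_ac)
  also have "\<dots> = (16 * real ?n) ^ ?n * r ^ ?n" by (rule power_mult_distrib)
  finally show ?thesis using that[OF y(1)] y(2) unfolding m[symmetric] energy_def by simp
qed

text \<open>On a common subcube, of volume (2s)^n, both constants are close to \<open>f\<close> in
  mean, hence close to each other.\<close>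

lemma mean_difference_le:
  assumes [measurable]: "S1 \<in> sets borel" "S2 \<in> sets borel"
    and S: "cube b s \<subseteq> S1" "cube b s \<subseteq> S2" "0 \<le> s"
    and t: "pintegral CARD('n) S1 (\<lambda>x. f x - c1) \<le> ennreal t1"
       "pintegral CARD('n) S2 (\<lambda>x. f x - c2) \<le> ennreal t2" "0 \<le> t1" "0 \<le> t2"
  shows "norm (c1 - c2) ^ CARD('n) * (2 * s) ^ CARD('n) \<le> 2 ^ CARD('n) * (t1 + t2)"
proof -
  let ?n = "CARD('n)"
  have "ennreal (norm (c1 - c2) ^ ?n * (2 * s) ^ ?n) = pintegral ?n (cube b s) (\<lambda>_. c1 - c2)"
    using S(3) by (subst pintegral_const) (auto simp: emeasure_cube ennreal_mult)
  also have "\<dots> \<le> ennreal (2 ^ ?n) * (pintegral ?n (cube b s) (\<lambda>x. f x - c2)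
      + pintegral ?n (cube b s) (\<lambda>x. (c1 - c2) - (f x - c2)))"
    by (rule pintegral_triangle) auto
  also have "pintegral ?n (cube b s) (\<lambda>x. (c1 - c2) - (f x - c2))
      = pintegral ?n (cube b s) (\<lambda>x. f x - c1)"
    by (simp add: norm_minus_commute)
  also have "pintegral ?n (cube b s) (\<lambda>x. f x - c2) + pintegral ?n (cube b s) (\<lambda>x. f x - c1)
    \<le> pintegral ?n S2 (\<lambda>x. f x - c2) + pintegral ?n S1 (\<lambda>x. f x - c1)"
    by (intro add_mono pintegral_mono S)
  finally have "ennreal (norm (c1 - c2) ^ ?n * (2 * s) ^ ?n)
    \<le> ennreal (2 ^ ?n) * (pintegral ?n S2 (\<lambda>x. f x - c2) + pintegral ?n S1 (\<lambda>x. f x - c1))"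
    by (simp add: mult_left_mono)
  also have "\<dots> \<le> ennreal (2 ^ ?n) * (ennreal t1 + ennreal t2)"
    using add_mono[OF t(2,1)] by (intro mult_left_mono) (auto simp: add.commute)
  also have "\<dots> = ennreal (2 ^ ?n * (t1 + t2))"
    using t by (simp add: ennreal_mult)
  finally show ?thesis using t by (simp add: ennreal_le_iff mult_left_mono)
qed

text \<open>The annulus is a union of \<open>2n\<close> convex slabs. Two slabs in different coordinate directions overlap in
  a cube, so their mean values are comparable; opposite slabs are compared through a third one.\<close>

lemma poincare_annulus:
  fixes R :: real
  assumes n2: "CARD('n) \<ge> 2" and R: "0 < R"
  obtains c where "pintegral CARD('n) (annulus a R) (\<lambda>x. f x - c)
    \<le> ennreal (2 * real CARD('n) * (2 ^ CARD('n) * (1 + 4 ^ CARD('n) * 2 ^ (2 * CARD('n) + 2))) *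
        ((16 * real CARD('n)) ^ CARD('n) * (2 * R) ^ CARD('n))) * energy (annulus a R)"
proof -
  let ?n = "CARD('n)" and ?A = "annulus a R"
  \<comment> \<open>A slab is indexed by a coordinate and a sign.\<close>
  define S where "S q = cube a (2 * R) \<inter> {x. R \<le> snd q
      * (x $ fst q - a $ fst q)}" for q :: "'n \<times> real"
  define I where "I = (UNIV :: 'n set) \<times> {1, -1 :: real}"
  have finI: "finite I" by (simp add: I_def)
  have cardI: "card I = 2 * ?n" by (simp add: I_def card_cartesian_product)
  have cS: "compact (S q)" "convex (S q)" for q
  proof -
    have h: "{x :: real^'n. R \<le> snd q * (x $ fst q - a $ fst q)}
        = {x. (snd q *\<^sub>R axis (fst q) 1) \<bullet> x \<ge> R + snd q * a $ fst q}"
      by (auto simp: inner_axis' algebra_simps)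
    show "compact (S q)" unfolding S_def h by (intro compact_Int_closed closed_halfspace_ge) simp
    show "convex (S q)" unfolding S_def h by (intro convex_Int convex_halfspace_ge) simp
  qed
  have [measurable]: "S q \<in> sets borel" for q using cS by (intro borel_compact)
  have [measurable]: "?A \<in> sets borel" using compact_annulus by (rule borel_compact)
  have SA: "S q \<subseteq> ?A" if "q \<in> I" for q
    using that R by (auto simp: S_def annulus_def I_def intro!: exI[of _ "fst q"])
  have AS: "?A \<subseteq> (\<Union>q\<in>I. S q)"
  proof
    fix x assume x: "x \<in> ?A"
    then obtain j where j: "R \<le> \<bar>x $ j - a $ j\<bar>" by (auto simp: annulus_def)
    then have "x \<in> S (j, 1) \<or> x \<in> S (j, -1)" using x annulus_subset by (auto simp: S_def abs_if split: if_splits)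
    then show "x \<in> (\<Union>q\<in>I. S q)" by (auto simp: I_def)
  qed
  have Scube: "S q \<subseteq> cube a (2 * R)" for q by (auto simp: S_def)
  define \<tau> where "\<tau> = (16 * real ?n) ^ ?n * (2 * R) ^ ?n * (\<integral>x. indicator ?A x
      * norm (D x) ^ ?n \<partial>lborel)"
  have \<tau>: "ennreal ((16 * real ?n) ^ ?n * (2 * R) ^ ?n) * energy ?A = ennreal \<tau>"
    unfolding \<tau>_def energy_eq[OF compact_annulus] using R by (subst ennreal_mult[symmetric]) (auto intro!: integral_nonneg_AE)
  have \<tau>0: "0 \<le> \<tau>" unfolding \<tau>_def using R by (intro mult_nonneg_nonneg integral_nonneg_AE) auto
  \<comment> \<open>Centre of a cube of half side R / 2 in the overlap of two slabs: both relevant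
    coordinates are at distance 3R/2, the middle of [R, 2R].\<close>
  define pt where "pt q k \<sigma> = (\<chi> i. a $ i + (if i = fst q then snd q * (3 * R / 2) else if i
      = k then \<sigma> * (3 * R / 2) else 0))"
    for q k and \<sigma> :: real
  have ptS: "cube (pt q k \<sigma>) (R / 2) \<subseteq> S q \<and> cube (pt q k \<sigma>) (R / 2)
      \<subseteq> S (k, \<sigma>)"
    if q: "q \<in> I" "k \<noteq> fst q" "\<sigma> \<in> {1, -1}" for q k \<sigma>
  proof -
    have "cube (pt q k \<sigma>) (R / 2) \<subseteq> cube a (2 * R)"
      using q R by (intro cube_subset) (auto simp: pt_def I_def)
    moreover have "R \<le> snd q * (x $ fst q - a $ fst q)" "R
        \<le> \<sigma> * (x $ k - a $ k)" if "x \<in> cube (pt q k \<sigma>) (R / 2)" for x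
    proof -
      have b: "\<bar>x $ fst q - (a $ fst q + snd q * (3 * R / 2))\<bar> \<le> R / 2"
        using that by (auto simp: cube_def pt_def dest!: spec[of _ "fst q"])
      have "snd q = 1 \<or> snd q = -1" using q by (auto simp: I_def)
      then show "R \<le> snd q * (x $ fst q - a $ fst q)"
        using abs_le_D1[OF b] abs_le_D2[OF b] by auto
      have b: "\<bar>x $ k - (a $ k + \<sigma> * (3 * R / 2))\<bar> \<le> R / 2"
        using that q by (auto simp: cube_def pt_def dest!: spec[of _ k])
      then show "R \<le> \<sigma> * (x $ k - a $ k)" using q abs_le_D1[OF b] abs_le_D2[OF b] by auto
    qed
    ultimately show ?thesis by (auto simp: S_def)
  qed
  \<comment> \<open>Here n >= 2 is used: there is a second coordinate direction.\<close>
  have other: "\<exists>k. k \<noteq> j" for j :: 'n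
  proof (rule ccontr)
    assume "\<nexists>k. k \<noteq> j"
    then have "(UNIV :: 'n set) = {j}" by auto
    then have "?n = 1" by (metis card.empty card.insert finite.emptyI empty_iff One_nat_def)
    then show False using n2 by simp
  qed
  have "\<exists>c. pintegral ?n (S q) (\<lambda>x. f x - c) \<le> ennreal \<tau>" if q: "q \<in> I" for q
  proof -
    obtain k where k: "k \<noteq> fst q" using other by blast
    have sub: "cube (pt q k 1) (R / 2) \<subseteq> S q" using ptS[OF q k, of 1] by simp
    have half: "0 < R / 2" using R by simp
    obtain y where "pintegral ?n (S q) (\<lambda>x. f x - f y)
      \<le> ennreal ((16 * real ?n) ^ ?n * (2 * R) ^ ?n) * energy (S q)"
      by (rule poincare_convex[OF cS sub half Scube])
    also have "\<dots> \<le> ennreal \<tau>" unfolding \<tau>[symmetric] by (intro mult_left_mono energy_mono SA q) auto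
    finally show ?thesis by blast
  qed
  then have "\<forall>q\<in>I. \<exists>c. pintegral ?n (S q) (\<lambda>x. f x - c) \<le> ennreal \<tau>" by blast
  from bchoice[OF this] obtain c where
    c: "\<And>q. q \<in> I \<Longrightarrow> pintegral ?n (S q) (\<lambda>x. f x - c q) \<le> ennreal \<tau>" by blast
  have adj: "norm (c q - c (k, \<sigma>)) ^ ?n * R ^ ?n \<le> 2 ^ ?n * (\<tau>
      + \<tau>)" if q: "q \<in> I" "k \<noteq> fst q" "\<sigma> \<in> {1, -1}" for q k \<sigma>
  proof -
    have "(k, \<sigma>) \<in> I" using q by (auto simp: I_def)
    then have "norm (c q - c (k, \<sigma>)) ^ ?n * (2 * (R / 2)) ^ ?n \<le> 2 ^ ?n * (\<tau> + \<tau>)"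
      using ptS[OF q] R q \<tau>0 by (intro mean_difference_le[of "S q" "S (k, \<sigma>)" "pt q k \<sigma>"] c) auto
    then show ?thesis by simp
  qed
  obtain j0 :: 'n where True by blast
  define c0 where "c0 = c (j0, 1)"
  have dist: "norm (c q - c0) ^ ?n * R ^ ?n \<le> 2 ^ (2 * ?n + 2) * \<tau>" if q: "q \<in> I" for q
  proof (cases "fst q = j0")
    case False
    have "norm (c q - c0) ^ ?n * R ^ ?n \<le> 2 ^ ?n * (\<tau> + \<tau>)"
      unfolding c0_def using q False by (intro adj) auto
    also have "\<dots> = 2 ^ (?n + 1) * \<tau>" by simp
    also have "\<dots> \<le> 2 ^ (2 * ?n + 2) * \<tau>"
      using \<tau>0 by (intro mult_right_mono power_increasing) auto
    finally show ?thesis .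
  next
    \<comment> \<open>The slab is the reference slab or the one opposite to it. Both overlap the
      slab of another coordinate, and two adjacent comparisons yield 2^n * 2^n * 4 = 2^(2n +
      2).\<close>
    case True
    obtain k where k: "k \<noteq> j0" using other by blast
    have a1: "norm (c q - c (k, 1)) ^ ?n * R ^ ?n \<le> 2 ^ ?n * (\<tau> + \<tau>)"
      using q k True by (intro adj) auto
    have "norm (c (j0, 1) - c (k, 1)) ^ ?n * R ^ ?n \<le> 2 ^ ?n * (\<tau> + \<tau>)"
      using k by (intro adj) (auto simp: I_def)
    then have a2: "norm (c (k, 1) - c0) ^ ?n * R ^ ?n \<le> 2 ^ ?n * (\<tau> + \<tau>)"
      by (simp add: c0_def norm_minus_commute)
    have "norm (c q - c0) ^ ?n \<le> (norm (c q - c (k, 1)) + norm (c (k, 1) - c0)) ^ ?n"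
      using norm_triangle_ineq[of "c q - c (k, 1)" "c (k, 1) - c0"] by (intro power_mono) auto
    also have "\<dots> \<le> 2 ^ ?n * (norm (c q - c (k, 1)) ^ ?n
        + norm (c (k, 1) - c0) ^ ?n)" by (rule power_add_le) auto
    finally have "norm (c q - c0) ^ ?n * R ^ ?n \<le> 2 ^ ?n * (norm (c q - c (k, 1)) ^ ?n
        + norm (c (k, 1) - c0) ^ ?n) * R ^ ?n"
      using R by (intro mult_right_mono) auto
    also have "\<dots> = 2 ^ ?n * (norm (c q - c (k, 1)) ^ ?n * R ^ ?n + norm (c (k, 1) - c0) ^ ?n * R ^ ?n)"
      by (simp add: algebra_simps)
    also have "\<dots> \<le> 2 ^ ?n * (2 ^ ?n * (\<tau> + \<tau>) + 2 ^ ?n * (\<tau> + \<tau>))"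
      using a1 a2 by (intro mult_left_mono add_mono) auto
    also have "\<dots> = (2 ^ ?n * 2 ^ ?n) * 4 * \<tau>" by (simp add: algebra_simps)
    also have "\<dots> = 2 ^ (2 * ?n + 2) * \<tau>" by (simp only: power_add mult_2) simp
    finally show ?thesis .
  qed
  \<comment> \<open>The summand 1 is the deviation of \<open>f\<close> from the constant of its own
    slab; the other one is the distance of that constant from \<open>c0\<close>, integrated over a
    cube of volume (4R)^n.\<close>
  define B where "B = 2 ^ ?n * (1 + 4 ^ ?n * 2 ^ (2 * ?n + 2)) * \<tau>"
  have slab: "pintegral ?n (S q) (\<lambda>x. f x - c0) \<le> ennreal B" if q: "q \<in> I" for q
  proof -
    have "pintegral ?n (S q) (\<lambda>x. f x - c0)
      \<le> ennreal (2 ^ ?n) * (pintegral ?n (S q) (\<lambda>x. f x - c q) + pintegral ?n (S q) (\<lambda>x. (f x - c0) - (f x - c q)))"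
      by (rule pintegral_triangle) auto
    also have "(\<lambda>x. (f x - c0) - (f x - c q)) = (\<lambda>_. c q - c0)" by auto
    also have "pintegral ?n (S q) (\<lambda>_. c q - c0) \<le> pintegral ?n (cube a (2 * R)) (\<lambda>_. c q - c0)"
      by (rule pintegral_mono[OF Scube])
    also have "\<dots> = ennreal (norm (c q - c0) ^ ?n) * emeasure lborel (cube a (2 * R))"
      by (rule pintegral_const) simp
    finally have "pintegral ?n (S q) (\<lambda>x. f x - c0) \<le> ennreal (2 ^ ?n)
        * (pintegral ?n (S q) (\<lambda>x. f x - c q)
       + ennreal (norm (c q - c0) ^ ?n) * emeasure lborel (cube a (2 * R)))"
      by (simp add: mult_left_mono add_left_mono)
    also have "\<dots> \<le> ennreal (2 ^ ?n) * (ennreal \<tau> + ennreal (4 ^ ?n * 2 ^ (2 * ?n + 2) * \<tau>))"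
    proof (intro mult_left_mono add_mono c q)
      have "2 * (2 * R) = 4 * R" by simp
      then have "(2 * (2 * R)) ^ ?n = 4 ^ ?n * R ^ ?n" by (simp only: power_mult_distrib)
      then have "norm (c q - c0) ^ ?n * (2 * (2 * R)) ^ ?n = 4 ^ ?n * (norm (c q - c0) ^ ?n * R ^ ?n)"
        by (simp only: mult_ac)
      also have "\<dots> \<le> 4 ^ ?n * (2 ^ (2 * ?n + 2) * \<tau>)" using dist[OF q] by (intro mult_left_mono) auto
      finally show "ennreal (norm (c q - c0) ^ ?n) * emeasure lborel (cube a (2 * R))
          \<le> ennreal (4 ^ ?n * 2 ^ (2 * ?n + 2) * \<tau>)"
        using R by (subst emeasure_cube, simp, subst ennreal_mult[symmetric]) (auto intro!: ennreal_leI simp: mult.assoc)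
    qed simp
    also have "\<dots> = ennreal B"
      unfolding B_def using \<tau>0 by (subst ennreal_plus[symmetric], simp, simp, subst ennreal_mult[symmetric]) (auto simp: algebra_simps)
    finally show ?thesis .
  qed
  have "pintegral ?n ?A (\<lambda>x. f x - c0)
    \<le> (\<integral>\<^sup>+x. (\<Sum>q\<in>I. indicator (S q) x * ennreal (norm (f x - c0) ^ ?n)) \<partial>lborel)"
  proof (rule nn_integral_mono)
    fix x
    show "indicator ?A x * ennreal (norm (f x - c0) ^ ?n) \<le> (\<Sum>q\<in>I. indicator (S q) x
        * ennreal (norm (f x - c0) ^ ?n))"
    proof (cases "x \<in> ?A")
      case True
      then obtain q where q: "q \<in> I" "x \<in> S q" using AS by blast
      have "indicator (S q) x * ennreal (norm (f x - c0) ^ ?n)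
          \<le> (\<Sum>q\<in>I. indicator (S q) x * ennreal (norm (f x - c0) ^ ?n))"
        by (rule member_le_sum[OF q(1)]) (auto simp: finI)
      then show ?thesis using True q by simp
    qed simp
  qed
  also have "\<dots> = (\<Sum>q\<in>I. \<integral>\<^sup>+x. indicator (S q) x
      * ennreal (norm (f x - c0) ^ ?n) \<partial>lborel)"
    by (rule nn_integral_sum) simp
  also have "\<dots> \<le> (\<Sum>q\<in>I. ennreal B)" by (intro sum_mono slab)
  also have "\<dots> = ennreal (2 * real ?n * B)"
    by (simp add: cardI ennreal_mult' ennreal_of_nat_eq_real_of_nat flip: ennreal_numeral)
  also have "2 * real ?n * B = 2 * real ?n * (2 ^ ?n * (1 + 4 ^ ?n * 2 ^ (2 * ?n + 2))) * \<tau>" by (simp add: B_def)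
  also have "ennreal \<dots> = ennreal (2 * real ?n * (2 ^ ?n * (1 + 4 ^ ?n * 2 ^ (2 * ?n + 2))) * ((16
      * real ?n) ^ ?n * (2 * R) ^ ?n)) * energy ?A"
  proof -
    have "ennreal (2 * real ?n * (2 ^ ?n * (1 + 4 ^ ?n * 2 ^ (2 * ?n + 2))) * \<tau>)
      = ennreal (2 * real ?n * (2 ^ ?n * (1 + 4 ^ ?n * 2 ^ (2 * ?n + 2)))) * (ennreal ((16 * real ?n) ^ ?n * (2 * R) ^ ?n) * energy ?A)"
      unfolding \<tau> using \<tau>0 by (rule ennreal_mult'')
    also have "\<dots> = ennreal (2 * real ?n * (2 ^ ?n * (1 + 4 ^ ?n * 2 ^ (2 * ?n + 2)))) * ennreal ((16
        * real ?n) ^ ?n * (2 * R) ^ ?n) * energy ?A"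
      by (rule mult.assoc[symmetric])
    also have "ennreal (2 * real ?n * (2 ^ ?n * (1 + 4 ^ ?n * 2 ^ (2 * ?n + 2)))) * ennreal ((16 * real ?n) ^ ?n
        * (2 * R) ^ ?n)
      = ennreal (2 * real ?n * (2 ^ ?n * (1 + 4 ^ ?n * 2 ^ (2 * ?n + 2))) * ((16 * real ?n) ^ ?n * (2 * R) ^ ?n))"
      using R by (intro ennreal_mult[symmetric]) auto
    finally show ?thesis .
  qed
  finally show ?thesis by (rule that)
qed

text \<open>Let u, v, w be the energies of the inner cube, the annulus and the outer cube. From u
  \<le> C v and u + v \<le> w, adding C u to the first inequality gives (1 + C) u \<le> C w. The
  inner cube has a quarter of the size, not half, to be disjoint from the closed annulus.\<close>

lemma hole_filling:
  assumes n2: "CARD('n) \<ge> 2"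
  obtains q where "0 < q" "q < 1" "\<And>a R. 0 < R \<Longrightarrow> energy (cube a (R / 4))
      \<le> ennreal q * energy (cube a R)"
proof -
  let ?n = "CARD('n)"
  define P where "P = 2 * real ?n * (2 ^ ?n * (1 + 4 ^ ?n * 2 ^ (2 * ?n + 2))) * ((16 * real ?n) ^ ?n * 2 ^ ?n)"
  have P: "0 \<le> P" by (simp add: P_def)
  define C where "C = K * fact ?n * 2 ^ ?n * (4 ^ ?n * P + 1)"
  have C: "0 < C" unfolding C_def using K_pos P by (intro mult_pos_pos add_nonneg_pos) auto
  have bound: "energy (cube a R) \<le> ennreal C * energy (annulus a R)" if R: "0 < R" for a R
  proof -
    have [measurable]: "annulus a R \<in> sets borel" using compact_annulus by (rule borel_compact)
    obtain c where c: "pintegral ?n (annulus a R) (\<lambda>x. f x - c)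
      \<le> ennreal (2 * real ?n * (2 ^ ?n * (1 + 4 ^ ?n * 2 ^ (2 * ?n + 2))) * ((16 * real ?n) ^ ?n * (2 * R) ^ ?n)) * energy (annulus a R)"
      using poincare_annulus[OF n2 R] by blast
    have e: "2 * real ?n * (2 ^ ?n * (1 + 4 ^ ?n * 2 ^ (2 * ?n + 2))) * ((16 * real ?n) ^ ?n * (2 * R) ^ ?n)
        = P * R ^ ?n"
      unfolding P_def power_mult_distrib[of 2 R] by (simp add: mult_ac)
    have "(\<integral>\<^sup>+x. indicator (annulus a R) x * ennreal ((4 / R * norm (f x - c)) ^ ?n) \<partial>lborel)
      = (\<integral>\<^sup>+x. ennreal ((4 / R) ^ ?n) * (indicator (annulus a R) x * ennreal (norm (f x - c) ^ ?n)) \<partial>lborel)"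
      unfolding power_mult_distrib using R by (intro nn_integral_cong) (auto simp: ennreal_mult mult_ac)
    also have "\<dots> = ennreal ((4 / R) ^ ?n) * pintegral ?n (annulus a R) (\<lambda>x. f x - c)"
      by (rule nn_integral_cmult) simp
    also have "\<dots> \<le> ennreal ((4 / R) ^ ?n) * (ennreal (P * R ^ ?n) * energy (annulus a R))"
      using c unfolding e by (intro mult_left_mono) auto
    also have "\<dots> = ennreal ((4 / R) ^ ?n * (P * R ^ ?n)) * energy (annulus a R)"
      using R P by (subst mult.assoc[symmetric], subst ennreal_mult[symmetric]) auto
    \<comment> \<open>The radius cancels because the exponent of the energy equals the dimension;
      this is the scale invariance behind geometric decay.\<close>
    also have "(4 / R) ^ ?n * (P * R ^ ?n) = 4 ^ ?n * P" using R by (simp add: power_divide)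
    finally have f1: "(\<integral>\<^sup>+x. indicator (annulus a R) x * ennreal ((4 / R
        * norm (f x - c)) ^ ?n) \<partial>lborel)
      \<le> ennreal (4 ^ ?n * P) * energy (annulus a R)" .
    have "energy (cube a R) \<le> ennreal (K * fact ?n * 2 ^ ?n) * (ennreal (4 ^ ?n * P) * energy (annulus a R)
        + energy (annulus a R))"
      by (rule order_trans[OF caccioppoli[OF R, of a c]]) (intro mult_left_mono add_right_mono f1, simp)
    also have "ennreal (4 ^ ?n * P) * energy (annulus a R) + energy (annulus a R)
        = ennreal (4 ^ ?n * P + 1) * energy (annulus a R)"
      using P by (subst ennreal_plus) (auto simp: distrib_right)
    also have "ennreal (K * fact ?n * 2 ^ ?n) * (ennreal (4 ^ ?n * P + 1) * energy (annulus a R))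
        = ennreal C * energy (annulus a R)"
      unfolding C_def using K_pos P by (subst mult.assoc[symmetric], subst ennreal_mult[symmetric]) auto
    finally show ?thesis .
  qed
  define q where "q = C / (1 + C)"
  have "energy (cube a (R / 4)) \<le> ennreal q * energy (cube a R)" if R: "0 < R" for a R
  proof -
    have sub: "cube a (R / 4) \<subseteq> cube a (R / 2)" using R by (intro cube_subset) auto
    have disj: "cube a (R / 4) \<inter> annulus a (R / 2) = {}"
    proof -
      have False if "x \<in> cube a (R / 4)" "x \<in> annulus a (R / 2)" for x
      proof -
        obtain j where "R / 2 \<le> \<bar>x $ j - a $ j\<bar>" using \<open>x \<in> annulus a (R / 2)\<close> by (auto simp: annulus_def)
        moreover have "\<bar>x $ j - a $ j\<bar> \<le> R / 4" using \<open>x \<in> cube a (R / 4)\<close> by (simp add: cube_def)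
        ultimately show False using R by simp
      qed
      then show ?thesis by blast
    qed
    have m: "annulus a (R / 2) \<in> sets borel" using compact_annulus by (rule borel_compact)
    have "energy (cube a (R / 4)) + energy (annulus a (R / 2)) = energy (cube a (R / 4) \<union> annulus a (R / 2))"
      by (rule energy_Un[symmetric, OF cube_in_borel m disj])
    also have "\<dots> \<le> energy (cube a R)"
    proof (rule energy_mono)
      have "cube a (R / 4) \<subseteq> cube a R" using R by (intro cube_subset) auto
      then show "cube a (R / 4) \<union> annulus a (R / 2) \<subseteq> cube a R" using annulus_subset[of a "R / 2"] by auto
    qed
    finally have s: "energy (cube a (R / 4)) + energy (annulus a (R / 2)) \<le> energy (cube a R)" .
    have b: "energy (cube a (R / 4)) \<le> ennreal C * energy (annulus a (R / 2))"
      using bound[of "R / 2" a] energy_mono[OF sub] R by (meson half_gt_zero order_trans)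
    \<comment> \<open>All three energies are finite, and rearranging the inequality needs
      subtraction of reals.\<close>
    define u v w where "u = (\<integral>x. indicator (cube a (R / 4)) x * norm (D x) ^ ?n \<partial>lborel)"
      and "v = (\<integral>x. indicator (annulus a (R / 2)) x * norm (D x) ^ ?n \<partial>lborel)"
      and "w = (\<integral>x. indicator (cube a R) x * norm (D x) ^ ?n \<partial>lborel)"
    have uvw: "energy (cube a (R / 4)) = ennreal u" "energy (annulus a (R / 2)) = ennreal v" "energy (cube a R)
        = ennreal w"
      unfolding u_def v_def w_def by (intro energy_eq compact_cube compact_annulus)+
    have nn: "0 \<le> u" "0 \<le> v" "0 \<le> w" unfolding u_def v_def w_def by (auto intro!: integral_nonneg_AE)
    have "u + v \<le> w" using s nn unfolding uvw by (simp add: ennreal_le_iff flip: ennreal_plus)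
    moreover have "u \<le> C * v"
    proof -
      have "ennreal u \<le> ennreal (C * v)" using b nn C unfolding uvw by (simp add: ennreal_mult)
      then show ?thesis using nn C by (simp add: ennreal_le_iff)
    qed
    moreover have "C * v \<le> C * (w - u)" using \<open>u + v \<le> w\<close> C by (intro mult_left_mono) auto
    ultimately have "u * (1 + C) \<le> C * w" by (simp add: algebra_simps)
    then have "u \<le> q * w" using C by (simp add: q_def field_simps)
    then show ?thesis unfolding uvw using C nn by (simp add: ennreal_mult[symmetric] q_def ennreal_leI)
  qed
  moreover have "0 < q" "q < 1" using C by (auto simp: q_def)
  ultimately show ?thesis using that by blast
qed

end

section \<open>Hoelder continuity\<close>

text \<open>The exact geometric partial sum serves as the induction bound, and then the limit is
  taken with k fixed.\<close>

lemma geometric_telescope_le: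
  fixes c :: "nat \<Rightarrow> 'a::real_normed_vector"
  assumes step: "\<And>k. norm (c k - c (Suc k)) \<le> B * l ^ k" and l: "0 < l" "l < 1"
    and lim: "c \<longlonglongrightarrow> L"
  shows "norm (c k - L) \<le> B * l ^ k / (1 - l)"
proof -
  have B: "0 \<le> B" using order_trans[OF norm_ge_zero step[of 0]] by simp
  have fin: "norm (c k - c (k + m)) \<le> B * l ^ k * (1 - l ^ m) / (1 - l)" for m
  proof (induction m)
    case (Suc m)
    have "norm (c k - c (k + Suc m)) \<le> norm (c k - c (k + m)) + norm (c (k + m) - c (Suc (k + m)))"
      using norm_triangle_ineq[of "c k - c (k + m)" "c (k + m) - c (Suc (k + m))"] by simp
    also have "\<dots> \<le> B * l ^ k * (1 - l ^ m) / (1 - l) + B * l ^ (k + m)"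
      by (intro add_mono Suc step)
    also have "\<dots> = B * l ^ k * (1 - l ^ Suc m) / (1 - l)"
      using l by (simp add: field_simps power_add)
    finally show ?case .
  qed simp
  have "norm (c k - c (k + m)) \<le> B * l ^ k / (1 - l)" for m
  proof -
    have "B * l ^ k * (1 - l ^ m) \<le> B * l ^ k * 1"
      using B l by (intro mult_left_mono) auto
    then have "B * l ^ k * (1 - l ^ m) / (1 - l) \<le> B * l ^ k / (1 - l)"
      using l by (intro divide_right_mono) auto
    then show ?thesis using fin[of m] by linarith
  qed
  moreover have "(\<lambda>m. norm (c k - c (k + m))) \<longlonglongrightarrow> norm (c k - L)"
    using LIMSEQ_ignore_initial_segment[OF lim, of k]
    by (intro tendsto_norm tendsto_diff tendsto_const) (simp add: add.commute)
  ultimately show ?thesis by (intro LIMSEQ_le_const2) auto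
qed

lemma holder_of_dyadic_estimate:
  fixes f :: "'a::real_normed_vector \<Rightarrow> 'b::real_normed_vector"
  assumes est: "\<And>x y k. x \<in> E \<Longrightarrow> y \<in> E \<Longrightarrow>
      norm (x - y) \<le> 3 / 4 * (1 / 4) ^ k \<Longrightarrow> norm (f x - f y) \<le> B * l ^ k"
    and l: "0 < l" "l < 1" and B: "0 \<le> B" and bd: "\<And>x. x \<in> E \<Longrightarrow> norm (f x) \<le> S"
  obtains \<alpha> C where "0 < \<alpha>" "0 < C"
    "\<And>x y. x \<in> E \<Longrightarrow> y \<in> E \<Longrightarrow> dist (f x) (f y)
        \<le> C * dist x y powr \<alpha>"
proof -
  \<comment> \<open>Chosen so that l = (1/4)^\<alpha>: a decay by l per quartering of the scale is
    Hoelder continuity of this order.\<close>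
  define \<alpha> where "\<alpha> = - ln l / ln 4"
  have \<alpha>: "0 < \<alpha>" using l by (simp add: \<alpha>_def divide_neg_pos)
  have lk: "l ^ k = ((1 / 4) ^ k) powr \<alpha>" for k
  proof -
    have "((1 / 4 :: real) ^ k) powr \<alpha> = exp (\<alpha> * (real k * - ln 4))"
      by (simp add: powr_def ln_realpow ln_div)
    also have "\<alpha> * (real k * - ln 4) = real k * ln l" by (simp add: \<alpha>_def)
    also have "exp \<dots> = l ^ k" using l by (simp add: exp_of_nat_mult)
    finally show ?thesis by simp
  qed
  define C where "C = (B + 2 * \<bar>S\<bar> + 1) * (16 / 3) powr \<alpha>"
  have C: "0 < C" using B unfolding C_def by (intro mult_pos_pos) auto
  have "dist (f x) (f y) \<le> C * dist x y powr \<alpha>" if x: "x \<in> E" and y: "y \<in> E" for x y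
  proof (cases "x = y")
    case False
    define t where "t = norm (x - y)"
    have t: "0 < t" using False by (simp add: t_def)
    have "norm (f x - f y) \<le> (B + 2 * \<bar>S\<bar> + 1) * (16 / 3 * t) powr \<alpha>"
    proof (cases "t \<le> 3 / 4")
      case True
      have ex: "\<exists>k. 3 / 4 * (1 / 4) ^ k < t"
      proof -
        obtain k where "(1 / 4 :: real) ^ k < 4 / 3 * t"
          using real_arch_pow_inv[of "4 / 3 * t" "1 / 4"] t by auto
        then show ?thesis by (intro exI[of _ k]) simp
      qed
      \<comment> \<open>The first scale too small for the estimate; its predecessor j still allows
        it, and (1/4)^j = 4 (1/4)^k < 4 * (4/3) t explains the constant 16/3.\<close>
      define k where "k = (LEAST k. 3 / 4 * (1 / 4) ^ k < t)"
      have k: "3 / 4 * (1 / 4) ^ k < t" unfolding k_def using ex by (rule LeastI_ex)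
      then have "k \<noteq> 0" using True by (intro notI) simp
      then obtain j where j: "k = Suc j" using not0_implies_Suc by blast
      have "j < k" by (simp add: j)
      then have "\<not> 3 / 4 * (1 / 4) ^ j < t" unfolding k_def by (rule not_less_Least)
      then have "norm (f x - f y) \<le> B * l ^ j"
        using est[OF x y, of j] by (simp add: t_def)
      also have "\<dots> \<le> B * (16 / 3 * t) powr \<alpha>"
        unfolding lk using k B \<alpha> by (intro mult_left_mono powr_mono2) (auto simp: j)
      also have "\<dots> \<le> (B + 2 * \<bar>S\<bar> + 1) * (16 / 3 * t) powr \<alpha>"
        by (intro mult_right_mono) auto
      finally show ?thesis .
    next
      \<comment> \<open>For distant points boundedness of \<open>f\<close> suffices, since 16/3 t
        exceeds 1.\<close>
      case False
      have "norm (f x - f y) \<le> norm (f x) + norm (f y)" by (rule norm_triangle_ineq4)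
      also have "\<dots> \<le> 2 * \<bar>S\<bar>" using bd[OF x] bd[OF y] by linarith
      also have "\<dots> \<le> (B + 2 * \<bar>S\<bar> + 1) * 1" using B by simp
      also have "\<dots> \<le> (B + 2 * \<bar>S\<bar> + 1) * (16 / 3 * t) powr \<alpha>"
        using False \<alpha> B by (intro mult_left_mono ge_one_powr_ge_zero) auto
      finally show ?thesis .
    qed
    also have "(16 / 3 * t) powr \<alpha> = (16 / 3) powr \<alpha> * t powr \<alpha>"
      by (rule powr_mult)
    also have "(B + 2 * \<bar>S\<bar> + 1) * ((16 / 3) powr \<alpha> * t powr \<alpha>) = C * t powr \<alpha>"
      by (simp add: C_def mult.assoc)
    finally show ?thesis by (simp add: dist_norm t_def)
  qed (use C in simp)
  then show ?thesis using that \<alpha> C by blast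
qed

context distortion_inequality
begin

lemma energy_decay:
  assumes q: "0 \<le> q" "\<And>a R. 0 < R \<Longrightarrow> energy (cube a (R / 4))
      \<le> ennreal q * energy (cube a R)"
  shows "energy (cube a ((1 / 4) ^ k)) \<le> ennreal (q ^ k) * energy (cube a 1)"
proof (induction k)
  case (Suc k)
  have "energy (cube a ((1 / 4) ^ Suc k)) \<le> ennreal q * energy (cube a ((1 / 4) ^ k))"
    using q(2)[of "(1 / 4) ^ k" a] by simp
  also have "\<dots> \<le> ennreal q * (ennreal (q ^ k) * energy (cube a 1))"
    by (intro mult_left_mono Suc) simp
  also have "\<dots> = ennreal (q ^ Suc k) * energy (cube a 1)"
    using q(1) by (simp add: ennreal_mult mult.assoc)
  finally show ?case .
qed simp

text \<open>A Campanato-type argument: on cubes shrinking by a factor 4 the Poincare inequality has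
  right-hand side of order s^n q^k, and dividing by the volume shows that consecutive approximating
  constants differ by at most a multiple of q^(k/n). They converge to \<open>f x\<close>, being
  values of \<open>f\<close> at points that tend to x.\<close>

lemma holder_on_compact:
  assumes n2: "CARD('n) \<ge> 2" and E: "compact E"
  obtains \<alpha> C where "0 < \<alpha>" "0 < C"
    "\<And>x y. x \<in> E \<Longrightarrow> y \<in> E \<Longrightarrow> dist (f x) (f y)
        \<le> C * dist x y powr \<alpha>"
proof -
  let ?n = "CARD('n)"
  obtain q where q: "0 < q" "q < 1" "\<And>a R. 0 < R \<Longrightarrow> energy (cube a (R / 4))
      \<le> ennreal q * energy (cube a R)"
    using hole_filling[OF n2] by blast
  obtain r where r: "\<forall>x\<in>E. norm x \<le> r" using compact_imp_bounded[OF E] bounded_iff by blast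
  \<comment> \<open>The ball contains the unit cubes around all points of E, so M bounds all initial
    energies at once.\<close>
  define M where "M = (\<integral>x. indicator (cball 0 (r + 2 * ?n)) x * norm (D x) ^ ?n \<partial>lborel)"
  have M: "0 \<le> M" unfolding M_def by (intro integral_nonneg_AE) auto
  have sub: "cube x 1 \<subseteq> cball 0 (r + 2 * ?n)" if "x \<in> E" for x
  proof
    fix z assume "z \<in> cube x 1"
    moreover have "x \<in> cube x 1" by (simp add: cube_def)
    ultimately have "norm (z - x) \<le> 2 * (1 :: real) * real ?n" by (intro cube_norm_diff_le)
    then show "z \<in> cball 0 (r + 2 * ?n)"
      using r that norm_triangle_sub[of z x] by force
  qed
  define s where "s k = (1 / 4 :: real) ^ k" for k
  have s0: "0 < s k" "s k \<le> 1" "s (Suc k) = s k / 4" for k by (auto simp: s_def power_le_one)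
  have en: "energy (cube x (s k)) \<le> ennreal (q ^ k * M)" if "x \<in> E" for x k
  proof -
    have "energy (cube x (s k)) \<le> ennreal (q ^ k) * energy (cube x 1)"
      unfolding s_def using q by (intro energy_decay) auto
    also have "\<dots> \<le> ennreal (q ^ k) * energy (cball 0 (r + 2 * ?n))"
      by (intro mult_left_mono energy_mono sub that) simp
    also have "\<dots> = ennreal (q ^ k * M)"
      using q M by (subst energy_eq) (auto simp: M_def ennreal_mult)
    finally show ?thesis .
  qed
  define P where "P = (16 * real ?n) ^ ?n"
  have P: "0 \<le> P" by (simp add: P_def)
  define T where "T k = P * s k ^ ?n * (q ^ k * M)" for k
  have T0: "0 \<le> T k" for k using P M q s0[of k] by (simp add: T_def)
  have TS: "T (Suc k) \<le> T k" for k
  proof -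
    have "0 \<le> s (Suc k)" "s (Suc k) \<le> s k" using s0(1)[of "Suc k"] s0(1)[of k] s0(3)[of k] by auto
    then show ?thesis
      unfolding T_def using P M q(1,2)
      by (intro mult_mono power_mono mult_right_mono power_decreasing) auto
  qed
  have "\<exists>y. y \<in> cube x (s k) \<and> pintegral ?n (cube x (s k)) (\<lambda>z. f z - f y) \<le> ennreal (T k)"
    if "x \<in> E" for x k
  proof -
    obtain y where y: "y \<in> cube x (s k)" "pintegral ?n (cube x (s k)) (\<lambda>z. f z - f y)
      \<le> ennreal ((16 * real ?n) ^ ?n * s k ^ ?n) * energy (cube x (s k))"
      by (rule poincare_convex[OF compact_cube convex_cube subset_refl s0(1) subset_refl])
    note y(2)
    also have "ennreal ((16 * real ?n) ^ ?n * s k ^ ?n) * energy (cube x (s k))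
        \<le> ennreal (P * s k ^ ?n) * ennreal (q ^ k * M)"
      unfolding P_def by (intro mult_left_mono en that) simp
    also have "\<dots> = ennreal (T k)"
      unfolding T_def using P q M s0[of k] by (intro ennreal_mult[symmetric]) auto
    finally show ?thesis using y(1) by blast
  qed
  then have ex: "\<forall>p\<in>UNIV \<times> E. \<exists>y. y \<in> cube (snd p) (s (fst p)) \<and>
     (\<integral>\<^sup>+z. indicator (cube (snd p) (s (fst p))) z * ennreal (norm (f z - f y) ^ ?n) \<partial>lborel) \<le> ennreal (T (fst p))"
    by auto
  from bchoice[OF ex] obtain Y where Y0: "\<forall>p\<in>UNIV \<times> E. Y p \<in> cube (snd p) (s (fst p)) \<and>
     (\<integral>\<^sup>+z. indicator (cube (snd p) (s (fst p))) z * ennreal (norm (f z - f (Y p)) ^ ?n) \<partial>lborel) \<le> ennreal (T (fst p))"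
    by blast
  define c where "c x k = f (Y (k, x))" for x k
  have Y: "Y (k, x) \<in> cube x (s k)"
    "pintegral ?n (cube x (s k)) (\<lambda>z. f z - c x k) \<le> ennreal (T k)" if "x \<in> E" for x k
    using bspec[OF Y0, of "(k, x)"] that by (auto simp: c_def)
  \<comment> \<open>The estimates are for n-th powers, so the decay factor and the constant are n-th
    roots.\<close>
  define l where "l = root ?n q"
  define B where "B = root ?n (2 * 4 ^ ?n * P * M)"
  have npos: "0 < ?n" by simp
  have l: "0 < l" "l < 1" using q by (auto simp: l_def)
  have B: "0 \<le> B" using P M by (simp add: B_def)
  \<comment> \<open>Two centres are allowed: equal ones serve the convergence at one point,
    different ones the comparison of two points.\<close>
  have step: "norm (c x k - c z (Suc k)) \<le> B * l ^ k"
    if xz: "x \<in> E" "z \<in> E" and inc: "cube z (s (Suc k)) \<subseteq> cube x (s k)" for x z k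
  proof (rule power_le_imp_le_base)
    have "norm (c x k - c z (Suc k)) ^ ?n * (2 * s (Suc k)) ^ ?n \<le> 2 ^ ?n * (T k + T (Suc k))"
      using s0[of "Suc k"] by (intro mean_difference_le[OF _ _ inc subset_refl _ Y(2)[OF xz(1)] Y(2)[OF xz(2)]] T0) auto
    also have "\<dots> \<le> 2 ^ ?n * (2 * T k)" using TS[of k] by (intro mult_left_mono) auto
    also have "\<dots> = (2 * 4 ^ ?n * P * M * q ^ k) * (s k / 2) ^ ?n"
    proof -
      have "(4 :: real) ^ ?n * (s k / 2) ^ ?n = (4 * (s k / 2)) ^ ?n" by (rule power_mult_distrib[symmetric])
      also have "4 * (s k / 2) = 2 * s k" by simp
      finally have "(4 :: real) ^ ?n * (s k / 2) ^ ?n = 2 ^ ?n * s k ^ ?n" by (simp only: power_mult_distrib)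
      then show ?thesis by (simp add: T_def mult_ac)
    qed
    finally have "norm (c x k - c z (Suc k)) ^ ?n * (s k / 2) ^ ?n \<le> (2 * 4 ^ ?n * P * M * q ^ k) * (s k / 2) ^ ?n"
      by (simp add: s0(3))
    then have "norm (c x k - c z (Suc k)) ^ ?n \<le> 2 * 4 ^ ?n * P * M * q ^ k"
      using s0(1)[of k] by (simp add: mult_le_cancel_right)
    also have "\<dots> = (B * l ^ k) ^ ?n"
    proof -
      have "B ^ ?n = 2 * 4 ^ ?n * P * M" unfolding B_def using P M by (intro real_root_pow_pos2) auto
      moreover have "(l ^ k) ^ ?n = q ^ k"
      proof -
        have "(l ^ k) ^ ?n = (l ^ ?n) ^ k" by (metis power_mult mult.commute)
        also have "l ^ ?n = q" unfolding l_def using q by (intro real_root_pow_pos2) auto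
        finally show ?thesis .
      qed
      ultimately show ?thesis by (simp only: power_mult_distrib)
    qed
    finally show "norm (c x k - c z (Suc k)) ^ Suc (?n - 1) \<le> (B * l ^ k) ^ Suc (?n - 1)" by simp
  qed (use B l in auto)
  have lim: "c x \<longlonglongrightarrow> f x" if x: "x \<in> E" for x
  proof -
    have nb: "norm (Y (k, x) - x) \<le> 2 * ?n * s k" for k
    proof -
      have "x \<in> cube x (s k)" using s0(1)[of k] by (simp add: cube_def)
      then have "norm (Y (k, x) - x) \<le> 2 * s k * ?n" using Y(1)[OF x] by (intro cube_norm_diff_le)
      then show ?thesis by (simp add: mult_ac)
    qed
    have "s \<longlonglongrightarrow> 0" unfolding s_def[abs_def] by (intro LIMSEQ_realpow_zero) auto
    then have "(\<lambda>k. 2 * ?n * s k) \<longlonglongrightarrow> 0" by (auto intro!: tendsto_eq_intros)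
    then have "(\<lambda>k. Y (k, x) - x) \<longlonglongrightarrow> 0"
      by (rule Lim_null_comparison[rotated]) (use nb in auto)
    then have "(\<lambda>k. Y (k, x)) \<longlonglongrightarrow> x" by (simp add: LIM_zero_iff)
    moreover have "isCont f x" using continuous_f[of UNIV] by (simp add: continuous_on_eq_continuous_at)
    ultimately show ?thesis unfolding c_def by (rule isCont_tendsto_compose[rotated])
  qed
  have close: "norm (c x k - f x) \<le> B * l ^ k / (1 - l)" if x: "x \<in> E" for x k
  proof (rule geometric_telescope_le[OF _ l lim[OF x]])
    fix k show "norm (c x k - c x (Suc k)) \<le> B * l ^ k"
      using s0[of k] by (intro step x cube_subset) (auto simp: s0(3))
  qed
  define B' where "B' = B * (2 / (1 - l) + 1)"
  have B': "0 \<le> B'" using B l by (simp add: B'_def)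
  have est: "norm (f x - f y) \<le> B' * l ^ k" if xy: "x \<in> E" "y \<in> E" "norm (x - y)
      \<le> 3 / 4 * (1 / 4) ^ k" for x y k
  proof -
    \<comment> \<open>This explains 3/4: the smaller cube has half side s/4, and 3/4 + 1/4 =
      1.\<close>
    have inc: "cube y (s (Suc k)) \<subseteq> cube x (s k)"
    proof (rule cube_subset)
      fix i
      have "\<bar>y $ i - x $ i\<bar> \<le> norm (y - x)" using component_le_norm_cart[of "y - x" i] by simp
      also have "\<dots> \<le> 3 / 4 * s k" using xy(3) by (simp add: s_def norm_minus_commute)
      finally show "\<bar>y $ i - x $ i\<bar> + s (Suc k) \<le> s k" by (simp add: s0(3))
    qed
    have "norm (f x - f y) \<le> norm (f x - c x k) + norm ((c x k - c y (Suc k)) + (c y (Suc k) - f y))"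
      using norm_triangle_ineq[of "f x - c x k" "(c x k - c y (Suc k)) + (c y (Suc k) - f y)"] by simp
    also have "\<dots> \<le> norm (c x k - f x) + (norm (c x k - c y (Suc k)) + norm (c y (Suc k) - f y))"
      by (intro add_mono norm_triangle_ineq) (simp add: norm_minus_commute)
    also have "\<dots> \<le> B * l ^ k / (1 - l) + (B * l ^ k + B * l ^ Suc k / (1 - l))"
      by (intro add_mono close step xy inc)
    also have "\<dots> \<le> B * l ^ k / (1 - l) + (B * l ^ k + B * l ^ k / (1 - l))"
      using B l by (intro add_left_mono divide_right_mono mult_left_mono power_decreasing) auto
    also have "\<dots> = B' * l ^ k" by (simp add: B'_def divide_inverse algebra_simps)
    finally show ?thesis .
  qed
  have "compact (f ` E)" using E continuous_f by (intro compact_continuous_image)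
  then obtain S where "\<forall>z\<in>f ` E. norm z \<le> S" using compact_imp_bounded bounded_iff by metis
  then have bd: "norm (f x) \<le> S" if "x \<in> E" for x using that by blast
  show ?thesis
    by (rule holder_of_dyadic_estimate[OF est l B' bd]) (use that in blast)+
qed

end

section \<open>From quasiconformality to the distortion inequality\<close>

lemma norm_matrix_le_onorm: "norm A \<le> (real CARD('n))\<^sup>2 * onorm ((*v) A)" for A :: "real^'n::finite^'n"
proof -
  have e: "\<bar>A $ i $ j\<bar> \<le> onorm ((*v) A)" for i j
  proof -
    have "\<bar>A $ i $ j\<bar> = \<bar>(A *v axis j 1) $ i\<bar>" by (simp add: matrix_vector_mult_basis column_def)
    also have "\<dots> \<le> norm (A *v axis j 1)" by (rule component_le_norm_cart)
    also have "\<dots> \<le> onorm ((*v) A) * norm (axis j 1 :: real^'n)"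
      by (rule onorm) (rule matrix_vector_mul_bounded_linear)
    finally show ?thesis by (simp add: norm_axis_1)
  qed
  have "norm A \<le> (\<Sum>i\<in>UNIV. norm (A $ i))"
    unfolding norm_vec_def[of A] by (rule L2_set_le_sum) simp
  also have "\<dots> \<le> (\<Sum>i\<in>(UNIV :: 'n set). \<Sum>j\<in>(UNIV :: 'n set). \<bar>A $ i $ j\<bar>)"
    by (intro sum_mono norm_le_l1_cart)
  also have "\<dots> \<le> (\<Sum>i\<in>(UNIV :: 'n set). \<Sum>j\<in>(UNIV :: 'n set). onorm ((*v) A))"
    by (intro sum_mono e)
  finally show ?thesis by (simp add: power2_eq_square)
qed

text \<open>Quasiconformality supplies one weak derivative that is locally n-integrable and another
  that satisfies the distortion bound; uniqueness identifies them almost everywhere, so one Borel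
  version has both properties.\<close>

lemma quasiconformal_imp_distortion_inequality:
  fixes f :: "real^'n::finite \<Rightarrow> real^'n"
  assumes "quasiconformal UNIV UNIV f"
  obtains D K where "distortion_inequality f D K"
proof -
  let ?n = "CARD('n)"
  obtain K where K: "1 \<le> K" and qc: "K_quasiconformal K UNIV UNIV f"
    using assms unfolding quasiconformal_def by blast
  have f: "continuous_on UNIV f"
    using qc unfolding K_quasiconformal_def homeomorphism_def by blast
  obtain D1 where D1: "weak_derivative UNIV f D1" "Lp_loc (real ?n) UNIV D1"
    using qc unfolding K_quasiconformal_def W1_loc_def by blast
  obtain D2 where D2: "weak_derivative UNIV f D2"
    and ineq0: "AE x in lebesgue_on UNIV. onorm ((*v) (D2 x)) ^ ?n \<le> K * det (D2 x)"
    using qc unfolding K_quasiconformal_def by blast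
  have ineq: "AE x in lebesgue. onorm ((*v) (D2 x)) ^ ?n \<le> K * det (D2 x)"
    using ineq0 unfolding lebesgue_on_UNIV_eq .
  have m: "D1 \<in> borel_measurable lebesgue" "D2 \<in> borel_measurable lebesgue"
    using D1 D2 by (auto simp: weak_derivative_def Lp_loc_def)
  obtain D1' where D1': "D1' \<in> borel_measurable borel" "AE x in lebesgue. D1 x = D1' x"
    using borel_version_of_lebesgue_measurable[OF m(1)] by blast
  obtain D2' where D2': "D2' \<in> borel_measurable borel" "AE x in lebesgue. D2 x = D2' x"
    using borel_version_of_lebesgue_measurable[OF m(2)] by blast
  have w1: "borel_weak_derivative f D1'"
    by (rule borel_weak_derivative_of_weak_derivative[OF f D1(1) D1'])
  have w2: "borel_weak_derivative f D2'"
    by (rule borel_weak_derivative_of_weak_derivative[OF f D2(1) D2'])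
  have u: "AE x in lebesgue. D1' x = D2' x"
    by (rule AE_completion) (rule borel_weak_derivative_unique[OF w1 w2])
  \<comment> \<open>The factor pays for passing from the operator norm to the Euclidean norm inside
    the n-th power.\<close>
  define K' where "K' = ((real ?n)\<^sup>2) ^ ?n * K"
  have "AE x in lebesgue. norm (D1' x) ^ ?n \<le> K' * det (D1' x)"
    using ineq D2'(2) u
  proof eventually_elim
    case (elim x)
    have "norm (D1' x) ^ ?n \<le> ((real ?n)\<^sup>2 * onorm ((*v) (D1' x))) ^ ?n"
      by (intro power_mono norm_matrix_le_onorm) auto
    also have "\<dots> = ((real ?n)\<^sup>2) ^ ?n * onorm ((*v) (D1' x)) ^ ?n" by (rule power_mult_distrib)
    also have "\<dots> \<le> ((real ?n)\<^sup>2) ^ ?n * (K * det (D1' x))"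
      using elim by (intro mult_left_mono) auto
    finally show ?case by (simp add: K'_def mult.assoc)
  qed
  then have "AE x in lborel. norm (D1' x) ^ ?n \<le> K' * det (D1' x)"
    by (simp add: AE_completion_iff)
  then have "distortion_inequality f D1' K'"
    using w1 K set_integrable_of_Lp_loc[OF D1(2) _ D1']
    by unfold_locales (auto simp: K'_def)
  then show ?thesis by (rule that)
qed

theorem corollary1p4:
  fixes E F :: "(real^'n::finite) set"
  assumes "CARD('n) \<ge> 2"
    and "compact E" and "compact F"
    and "quasi_hausdorff_dim E = 0" and "hausdorff_dim F = 0"
    and "0 < upper_box_dim F" and "upper_box_dim F = assouad_dim F"
  shows "\<not> (\<exists>f :: real^'n \<Rightarrow> real^'n. quasiconformal UNIV UNIV f \<and> f ` E = F)"
proof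
  assume "\<exists>f :: real^'n \<Rightarrow> real^'n. quasiconformal UNIV UNIV f \<and> f ` E = F"
  then obtain f :: "real^'n \<Rightarrow> real^'n" where f: "quasiconformal UNIV UNIV f" and F: "f ` E = F"
    by blast
  obtain D K where "distortion_inequality f D K"
    using quasiconformal_imp_distortion_inequality[OF f] by blast
  then interpret distortion_inequality f D K .
  obtain \<alpha> C where "0 < \<alpha>" "0 < C"
    and "\<And>x y. x \<in> E \<Longrightarrow> y \<in> E \<Longrightarrow> dist (f x) (f y)
        \<le> C * dist x y powr \<alpha>"
    using holder_on_compact[OF assms(1,2)] by blast
  \<comment> \<open>The equality of box and Assouad dimension is assumed for F, which is exactly the
    image to which the counting argument applies.\<close>
  then have "upper_box_dim (f ` E) \<le> 0"
    by (intro upper_box_dim_holder_image_le_0[where C = C and \<alpha> = \<alpha>]) (use assms(4,7) F in auto)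
  then show False
    using assms(6) unfolding F by simp
qed

end
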